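(* Let $\xi$ be a closed conformal vector field on an $(n+1)$-dimensional Lorentz manifold $(\overline{M},\overline{g})$, and let $\mathcal{F}$ be a codimension-one foliation of $\overline{M}$ by compact spacelike hypersurfaces, with unit timelike normal field $N$, such that $\xi$ is not tangent to the leaves $L\in\mathcal{F}$ (at any point). For each leaf $L$ let $\xi^\top$ denote the tangential component of $\xi$ to $L$. If the Ricci curvature $\mathrm{Ric}(\xi^\top,\xi^\top)$ of each leaf $L$ satisfies $$\mathrm{Ric}(\xi^\top,\xi^\top)\ge\frac{n-1}{n}\left(\operatorname{div}\xi^\top\right)^2,$$ then $L$ is a totally umbilical hypersurface.
   Context: A Lorentz manifold has a metric of signature $(+,\dots,+,-)$. A hypersurface is spacelike if its induced metric is Riemannian. Leaves are connected. A vector field $\xi$ is closed and conformal if there is $\sigma\in C^\infty(\overline{M})$ with $\overline{\nabla}_X\xi=\sigma X$ for all vector fields $X$, where $\overline{\nabla}$ is the Levi-Civita connection of $\overline{g}$. On each leaf, $\xi=\xi^\top+fN$ with $\xi^\top$ tangent to $L$ and $f=-\overline{g}(\xi,N)$. $\mathrm{Ric}$ and $\operatorname{div}$ are the Ricci tensor and the divergence of $L$ with its induced Riemannian metric. $L$ is totally umbilical if its shape operator $A$, $A(X)=-\overline{\nabla}_XN$, is a multiple of the identity at every point. *)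

theory Defs
  imports "HOL-Analysis.Analysis"
begin

subsection \<open>Smooth maps\<close>

text \<open>
  These notions are meant for open \<^term>\<open>S\<close>. In finite dimension a map is \<open>C\<^sup>k\<^sup>+\<^sup>1\<close> iff it is
  differentiable and all its directional derivatives are \<open>C\<^sup>k\<close>.
\<close>

primrec Ck_on :: "nat \<Rightarrow> 'a::euclidean_space set \<Rightarrow> ('a \<Rightarrow> 'b::real_normed_vector) \<Rightarrow> bool" where
  "Ck_on 0 S f \<longleftrightarrow> continuous_on S f"
| "Ck_on (Suc k) S f \<longleftrightarrow> (\<forall>x\<in>S. f differentiable (at x)) \<and>
     (\<forall>v. Ck_on k S (\<lambda>x. frechet_derivative f (at x) v))"

definition smooth_on :: "'a::euclidean_space set \<Rightarrow> ('a \<Rightarrow> 'b::real_normed_vector) \<Rightarrow> bool" where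
  "smooth_on S f \<longleftrightarrow> (\<forall>k. Ck_on k S f)"


subsection \<open>Smooth manifolds\<close>

text \<open>
  A chart is a pair of a domain and a coordinate map; the values of the coordinate map outside the
  domain are irrelevant. The manifold is the whole type \<^typ>\<open>'m\<close>, whose class provides the
  Hausdorff and second countability axioms.
\<close>

type_synonym ('m, 'e) chart = "'m set \<times> ('m \<Rightarrow> 'e)"

abbreviation chart_dom :: "('m, 'e) chart \<Rightarrow> 'm set" where "chart_dom \<equiv> fst"
abbreviation chart_map :: "('m, 'e) chart \<Rightarrow> 'm \<Rightarrow> 'e" where "chart_map \<equiv> snd"

definition chart_img :: "('m, 'e) chart \<Rightarrow> 'e set" where
  "chart_img c = chart_map c ` chart_dom c"

definition chart_inv :: "('m, 'e) chart \<Rightarrow> 'e \<Rightarrow> 'm" where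
  "chart_inv c = inv_into (chart_dom c) (chart_map c)"

definition is_chart :: "('m::topological_space, 'e::euclidean_space) chart \<Rightarrow> bool" where
  "is_chart c \<longleftrightarrow> open (chart_dom c) \<and> open (chart_img c) \<and>
     homeomorphism (chart_dom c) (chart_img c) (chart_map c) (chart_inv c)"

definition transition :: "('m, 'e) chart \<Rightarrow> ('m, 'e) chart \<Rightarrow> 'e \<Rightarrow> 'e" where
  "transition c d = chart_map d \<circ> chart_inv c"

definition compatible :: "('m, 'e::euclidean_space) chart \<Rightarrow> ('m, 'e) chart \<Rightarrow> bool" where
  "compatible c d \<longleftrightarrow>
     smooth_on (chart_map c ` (chart_dom c \<inter> chart_dom d)) (transition c d) \<and>
     smooth_on (chart_map d ` (chart_dom c \<inter> chart_dom d)) (transition d c)"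

text \<open>A smooth structure is a maximal smooth atlas.\<close>

definition smooth_structure ::
    "('m::{t2_space, second_countable_topology}, 'e::euclidean_space) chart set \<Rightarrow> bool" where
  "smooth_structure A \<longleftrightarrow>
     (\<forall>c\<in>A. is_chart c) \<and> (\<Union>c\<in>A. chart_dom c) = UNIV \<and>
     (\<forall>c\<in>A. \<forall>d\<in>A. compatible c d) \<and>
     (\<forall>c. is_chart c \<and> (\<forall>d\<in>A. compatible c d) \<longrightarrow> c \<in> A)"

definition smooth_function :: "('m, 'e::euclidean_space) chart set \<Rightarrow> ('m \<Rightarrow> real) \<Rightarrow> bool" where
  "smooth_function A f \<longleftrightarrow> (\<forall>c\<in>A. smooth_on (chart_img c) (f \<circ> chart_inv c))"

text \<open>
  Vector fields and covariant 2-tensor fields are given by their components: \<open>X c y\<close> and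
  \<open>g c y\<close> are the components in the chart \<open>c\<close> at the coordinate point \<open>y\<close>. They have to transform
  by the derivatives of the transition maps.
\<close>

type_synonym ('m, 'e) vfield = "('m, 'e) chart \<Rightarrow> 'e \<Rightarrow> 'e"
type_synonym ('m, 'e) tensor2 = "('m, 'e) chart \<Rightarrow> 'e \<Rightarrow> 'e \<Rightarrow> 'e \<Rightarrow> real"

definition vector_field ::
    "('m, 'e::euclidean_space) chart set \<Rightarrow> ('m, 'e) vfield \<Rightarrow> bool" where
  "vector_field A X \<longleftrightarrow>
     (\<forall>c\<in>A. smooth_on (chart_img c) (X c)) \<and>
     (\<forall>c\<in>A. \<forall>d\<in>A. \<forall>p \<in> chart_dom c \<inter> chart_dom d.
        X d (chart_map d p) =
        frechet_derivative (transition c d) (at (chart_map c p)) (X c (chart_map c p)))"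

definition lorentz_form :: "('e::euclidean_space \<times> real \<Rightarrow> 'e \<times> real \<Rightarrow> real) \<Rightarrow> bool" where
  "lorentz_form B \<longleftrightarrow> bilinear B \<and> (\<forall>u v. B u v = B v u) \<and>
     (\<exists>T :: 'e \<times> real \<Rightarrow> 'e \<times> real. linear T \<and> bij T \<and>
        (\<forall>u v. B (T u) (T v) = fst u \<bullet> fst v - snd u * snd v))"

definition lorentz_metric ::
    "('m, 'e::euclidean_space \<times> real) chart set \<Rightarrow> ('m, 'e \<times> real) tensor2 \<Rightarrow> bool" where
  "lorentz_metric A g \<longleftrightarrow>
     (\<forall>c\<in>A. (\<forall>u v. smooth_on (chart_img c) (\<lambda>y. g c y u v)) \<and>
             (\<forall>y\<in>chart_img c. lorentz_form (g c y))) \<and>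
     (\<forall>c\<in>A. \<forall>d\<in>A. \<forall>p \<in> chart_dom c \<inter> chart_dom d.
        let D = frechet_derivative (transition c d) (at (chart_map c p)) in
        \<forall>u v. g c (chart_map c p) u v = g d (chart_map d p) (D u) (D v))"


subsection \<open>Levi-Civita connection, Ricci tensor and divergence\<close>

text \<open>
  Here \<open>G\<close> is the coordinate expression, on an open set, of a metric of any signature. The
  Levi-Civita connection is \<open>D\<^sub>u Y + \<Gamma>(u, Y)\<close>, where \<open>\<Gamma>\<close> is the unique bilinear map that makes it
  torsion-free (symmetry of \<open>\<Gamma>\<close>) and metric.
\<close>

definition christoffel ::
    "('e::euclidean_space \<Rightarrow> 'e \<Rightarrow> 'e \<Rightarrow> real) \<Rightarrow> 'e \<Rightarrow> 'e \<Rightarrow> 'e \<Rightarrow> 'e" where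
  "christoffel G x = (THE \<Gamma>. bilinear \<Gamma> \<and> (\<forall>u v. \<Gamma> u v = \<Gamma> v u) \<and>
     (\<forall>u v w. frechet_derivative (\<lambda>y. G y v w) (at x) u = G x (\<Gamma> u v) w + G x v (\<Gamma> u w)))"

text \<open>Existence and uniqueness of \<open>\<Gamma>\<close> at a point, where \<open>B = G x\<close> is nondegenerate and \<open>D u v w\<close> is the derivative of
  \<open>G(v, w)\<close> in direction \<open>u\<close>.\<close>

lemma christoffel_well_defined:
  fixes B :: "'e::euclidean_space \<Rightarrow> 'e \<Rightarrow> real" and D :: "'e \<Rightarrow> 'e \<Rightarrow> 'e \<Rightarrow> real"
  assumes B: "bilinear B" "\<And>u v. B u v = B v u" "\<And>w. (\<And>z. B w z = 0) \<Longrightarrow> w = 0"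
    and D: "\<And>v w. linear (\<lambda>u. D u v w)" "\<And>u w. linear (\<lambda>v. D u v w)" "\<And>u v w. D u v w = D u w v"
  shows "\<exists>!\<Gamma>. bilinear \<Gamma> \<and> (\<forall>u v. \<Gamma> u v = \<Gamma> v u) \<and>
           (\<forall>u v w. D u v w = B (\<Gamma> u v) w + B v (\<Gamma> u w))"
proof -
  have inj: "w = w'" if "\<And>z. B w z = B w' z" for w w'
    using B(3)[of "w - w'"] that by (simp add: bilinear_lsub[OF B(1)])
  have lin: "linear (B w)" for w
    using B(1) by (simp add: bilinear_def)
  define \<Phi> where "\<Phi> w = (\<Sum>b\<in>Basis. B w b *\<^sub>R b)" for w
  have "linear \<Phi>"
    by (rule linearI) (simp_all add: \<Phi>_def bilinear_ladd[OF B(1)] bilinear_lmul[OF B(1)]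
        scaleR_add_left sum.distrib scaleR_sum_right)
  moreover have "inj \<Phi>"
  proof (rule injI)
    fix w w' assume "\<Phi> w = \<Phi> w'"
    then have "\<Phi> w \<bullet> b = \<Phi> w' \<bullet> b" for b by simp
    then have "B w b = B w' b" if "b \<in> Basis" for b
      using inner_sum_left_Basis[OF that, of "B w"] inner_sum_left_Basis[OF that, of "B w'"]
      by (metis \<Phi>_def)
    then have "B w = B w'"
      using linear_eq_stdbasis[OF lin lin] by blast
    then show "w = w'" by (intro inj) simp
  qed
  ultimately have "surj \<Phi>" by (simp add: linear_injective_imp_surjective)
  have rep: "\<exists>w. \<forall>z. B w z = l z" if "linear l" for l :: "'e \<Rightarrow> real"
  proof -
    obtain w where w: "\<Phi> w = (\<Sum>b\<in>Basis. l b *\<^sub>R b)" using \<open>surj \<Phi>\<close> by (metis surjD)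
    have "B w b = l b" if "b \<in> Basis" for b
      using w inner_sum_left_Basis[OF that, of "B w"] inner_sum_left_Basis[OF that, of l]
      by (metis \<Phi>_def)
    then have "B w = l" using linear_eq_stdbasis[OF lin that] by blast
    then show ?thesis by auto
  qed
  define K where "K u v z = (D u v z + D v u z - D z u v) / 2" for u v z
  have D3: "linear (\<lambda>w. D u v w)" for u v using D(2)[of u v] D(3) by simp
  have linK: "linear (K u v)" "linear (\<lambda>u. K u v z)" "linear (\<lambda>v. K u v z)" for u v z
    by (rule linearI; simp add: K_def linear_add[OF D(1)] linear_add[OF D(2)] linear_add[OF D3]
        linear_cmul[OF D(1)] linear_cmul[OF D(2)] linear_cmul[OF D3] field_simps)+
  define \<Gamma> where "\<Gamma> u v = (SOME w. \<forall>z. B w z = K u v z)" for u v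
  have \<Gamma>: "B (\<Gamma> u v) z = K u v z" for u v z
    using someI_ex[OF rep[OF linK(1)[of u v]]] unfolding \<Gamma>_def by blast
  show ?thesis
  proof (rule ex1I[of _ \<Gamma>], intro conjI allI)
    show "bilinear \<Gamma>"
      unfolding bilinear_def
      by (intro conjI allI linearI inj)
         (simp_all add: \<Gamma> bilinear_ladd[OF B(1)] bilinear_lmul[OF B(1)] linear_add[OF linK(2)]
           linear_add[OF linK(3)] linear_cmul[OF linK(2)] linear_cmul[OF linK(3)])
    show "\<Gamma> u v = \<Gamma> v u" for u v
      by (rule inj) (simp add: \<Gamma> K_def D(3)[of _ u v])
    show "D u v w = B (\<Gamma> u v) w + B v (\<Gamma> u w)" for u v w
      by (simp add: B(2)[of v] \<Gamma> K_def D(3)[of _ w] field_simps)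
  next
    fix \<Gamma>' assume a: "bilinear \<Gamma>' \<and> (\<forall>u v. \<Gamma>' u v = \<Gamma>' v u) \<and>
           (\<forall>u v w. D u v w = B (\<Gamma>' u v) w + B v (\<Gamma>' u w))"
    have "B (\<Gamma>' u v) z = K u v z" for u v z
    proof -
      have "D u v z = B (\<Gamma>' u v) z + B v (\<Gamma>' u z)" "D v u z = B (\<Gamma>' u v) z + B u (\<Gamma>' v z)"
        "D z u v = B v (\<Gamma>' u z) + B u (\<Gamma>' v z)"
        using a B(2) by (metis, metis, metis add.commute)
      then show ?thesis by (simp add: K_def)
    qed
    then show "\<Gamma>' = \<Gamma>" by (intro ext inj) (simp add: \<Gamma>)
  qed
qed

definition cov_deriv ::
    "('e::euclidean_space \<Rightarrow> 'e \<Rightarrow> 'e \<Rightarrow> real) \<Rightarrow> ('e \<Rightarrow> 'e) \<Rightarrow> 'e \<Rightarrow> 'e \<Rightarrow> 'e" where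
  "cov_deriv G Y x u = frechet_derivative Y (at x) u + christoffel G x u (Y x)"

text \<open>
  Curvature \<open>R(u,v)w = \<nabla>\<^sub>u\<nabla>\<^sub>v w - \<nabla>\<^sub>v\<nabla>\<^sub>u w\<close>, with \<open>u, v, w\<close> extended to constant coordinate fields, for
  which \<open>[u,v] = 0\<close>. \<open>Ric(v,w)\<close> is the trace of \<open>u \<mapsto> R(u,v)w\<close>, so that round spheres have positive
  Ricci curvature.
\<close>

definition curvature ::
    "('e::euclidean_space \<Rightarrow> 'e \<Rightarrow> 'e \<Rightarrow> real) \<Rightarrow> 'e \<Rightarrow> 'e \<Rightarrow> 'e \<Rightarrow> 'e \<Rightarrow> 'e" where
  "curvature G x u v w =
     cov_deriv G (\<lambda>y. cov_deriv G (\<lambda>_. w) y v) x u -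
     cov_deriv G (\<lambda>y. cov_deriv G (\<lambda>_. w) y u) x v"

definition linear_trace :: "('e::euclidean_space \<Rightarrow> 'e) \<Rightarrow> real" where
  "linear_trace f = (\<Sum>b\<in>Basis. f b \<bullet> b)"

definition ricci ::
    "('e::euclidean_space \<Rightarrow> 'e \<Rightarrow> 'e \<Rightarrow> real) \<Rightarrow> 'e \<Rightarrow> 'e \<Rightarrow> 'e \<Rightarrow> real" where
  "ricci G x v w = linear_trace (\<lambda>u. curvature G x u v w)"

definition divergence ::
    "('e::euclidean_space \<Rightarrow> 'e \<Rightarrow> 'e \<Rightarrow> real) \<Rightarrow> ('e \<Rightarrow> 'e) \<Rightarrow> 'e \<Rightarrow> real" where
  "divergence G Y x = linear_trace (cov_deriv G Y x)"

definition closed_conformal ::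
    "('m, 'e::euclidean_space) chart set \<Rightarrow> ('m, 'e) tensor2 \<Rightarrow> ('m, 'e) vfield \<Rightarrow> bool" where
  "closed_conformal A g \<xi> \<longleftrightarrow> vector_field A \<xi> \<and>
     (\<exists>\<sigma>. smooth_function A \<sigma> \<and>
       (\<forall>X. vector_field A X \<longrightarrow> (\<forall>c\<in>A. \<forall>p\<in>chart_dom c.
          cov_deriv (g c) (\<xi> c) (chart_map c p) (X c (chart_map c p)) =
          \<sigma> p *\<^sub>R X c (chart_map c p))))"


subsection \<open>Codimension-one foliations\<close>

text \<open>
  A foliation is given by a set of foliated charts of the smooth structure. The plaques are the
  level sets of the last coordinate, and on overlaps the last coordinates are locally functions of
  each other.
\<close>

definition foliation ::
    "('m::topological_space, 'e \<times> real) chart set \<Rightarrow> ('m, 'e \<times> real) chart set \<Rightarrow> bool" where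
  "foliation A F \<longleftrightarrow> F \<subseteq> A \<and> (\<Union>c\<in>F. chart_dom c) = UNIV \<and>
     (\<forall>c\<in>F. \<forall>d\<in>F. \<forall>p \<in> chart_dom c \<inter> chart_dom d.
        \<exists>W. open W \<and> p \<in> W \<and> W \<subseteq> chart_dom c \<inter> chart_dom d \<and>
          (\<forall>q\<in>W. \<forall>r\<in>W. snd (chart_map c q) = snd (chart_map c r) \<longrightarrow>
                        snd (chart_map d q) = snd (chart_map d r)))"

text \<open>
  The leaf topology is in general finer than the topology of the manifold: the relatively open
  subsets of plaques are open. Leaves are its connected components, and compactness of a leaf refers
  to it.
\<close>

definition leaf_topology ::
    "('m::topological_space, 'e \<times> real) chart set \<Rightarrow> 'm topology" where
  "leaf_topology F = topology_generated_by
     {{p \<in> W. snd (chart_map c p) = t} | c W t. c \<in> F \<and> open W \<and> W \<subseteq> chart_dom c}"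

definition leaves :: "('m::topological_space, 'e \<times> real) chart set \<Rightarrow> 'm set set" where
  "leaves F = connected_components_of (leaf_topology F)"

text \<open>
  For a foliated chart \<open>c\<close> and a height \<open>t\<close>, the points of a leaf in the slice of height \<open>t\<close> are
  charted by the first coordinate \<open>x\<close>; these are the charts of the leaf. The inclusion of the leaf
  reads \<open>x \<mapsto> (x, t)\<close> in such coordinates, with derivative \<open>u \<mapsto> (u, 0)\<close>, so the tangent space of the
  leaf consists of the vectors \<open>(u, 0)\<close>.
\<close>

definition induced_metric ::
    "('m, 'e::euclidean_space \<times> real) tensor2 \<Rightarrow> ('m, 'e \<times> real) chart \<Rightarrow> real \<Rightarrow>
     'e \<Rightarrow> 'e \<Rightarrow> 'e \<Rightarrow> real" where
  "induced_metric g c t x u v = g c (x, t) (u, 0) (v, 0)"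

definition compact_leaf :: "('m::topological_space, 'e \<times> real) chart set \<Rightarrow> 'm set \<Rightarrow> bool" where
  "compact_leaf F L \<longleftrightarrow> compactin (leaf_topology F) L"

definition spacelike_leaf ::
    "('m, 'e::euclidean_space \<times> real) chart set \<Rightarrow> ('m, 'e \<times> real) tensor2 \<Rightarrow> 'm set \<Rightarrow> bool" where
  "spacelike_leaf F g L \<longleftrightarrow>
     (\<forall>p\<in>L. \<forall>c\<in>F. p \<in> chart_dom c \<longrightarrow>
        (let (x, t) = chart_map c p in \<forall>u. u \<noteq> 0 \<longrightarrow> induced_metric g c t x u u > 0))"

definition tangent_at_leaf ::
    "('m, 'e::euclidean_space \<times> real) chart set \<Rightarrow> ('m, 'e \<times> real) vfield \<Rightarrow> 'm \<Rightarrow> bool" where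
  "tangent_at_leaf F X p \<longleftrightarrow>
     (\<forall>c\<in>F. p \<in> chart_dom c \<longrightarrow> (\<exists>u. X c (chart_map c p) = (u, 0)))"

definition unit_timelike_normal ::
    "('m, 'e::euclidean_space \<times> real) chart set \<Rightarrow> ('m, 'e \<times> real) chart set \<Rightarrow>
     ('m, 'e \<times> real) tensor2 \<Rightarrow> ('m, 'e \<times> real) vfield \<Rightarrow> bool" where
  "unit_timelike_normal A F g N \<longleftrightarrow> vector_field A N \<and>
     (\<forall>c\<in>F. \<forall>y\<in>chart_img c. g c y (N c y) (N c y) = -1 \<and> (\<forall>u. g c y (N c y) (u, 0) = 0))"

text \<open>
  \<open>\<xi>\<^sup>\<top> = \<xi> - f N\<close> with \<open>f = - g(\<xi>, N)\<close>. In a foliated chart its last component vanishes, and the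
  second definition is its expression in the chart of the leaf.
\<close>

definition tangential_part ::
    "('m, 'e::euclidean_space) tensor2 \<Rightarrow> ('m, 'e) vfield \<Rightarrow> ('m, 'e) vfield \<Rightarrow> ('m, 'e) vfield" where
  "tangential_part g N \<xi> c y = \<xi> c y - (- g c y (\<xi> c y) (N c y)) *\<^sub>R N c y"

definition leaf_tangential_part ::
    "('m, 'e::euclidean_space \<times> real) tensor2 \<Rightarrow> ('m, 'e \<times> real) vfield \<Rightarrow>
     ('m, 'e \<times> real) vfield \<Rightarrow> ('m, 'e \<times> real) chart \<Rightarrow> real \<Rightarrow> 'e \<Rightarrow> 'e" where
  "leaf_tangential_part g N \<xi> c t x = fst (tangential_part g N \<xi> c (x, t))"

definition shape_operator ::
    "('m, 'e::euclidean_space) tensor2 \<Rightarrow> ('m, 'e) vfield \<Rightarrow> ('m, 'e) chart \<Rightarrow> 'e \<Rightarrow> 'e \<Rightarrow> 'e" where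
  "shape_operator g N c y X = - cov_deriv (g c) (N c) y X"

definition totally_umbilical ::
    "('m, 'e::euclidean_space \<times> real) chart set \<Rightarrow> ('m, 'e \<times> real) tensor2 \<Rightarrow>
     ('m, 'e \<times> real) vfield \<Rightarrow> 'm set \<Rightarrow> bool" where
  "totally_umbilical F g N L \<longleftrightarrow>
     (\<forall>p\<in>L. \<exists>a::real. \<forall>c\<in>F. p \<in> chart_dom c \<longrightarrow>
        (\<forall>u. shape_operator g N c (chart_map c p) (u, 0) = a *\<^sub>R (u, 0)))"

end

theory Submission
  imports Defs
begin

text \<open>
  On a leaf, \<open>E = \<nabla>\<xi>\<^sup>\<top>\<close> equals \<open>\<sigma> I + f A\<close> and is therefore self-adjoint. The vector field
  \<open>W = E \<xi>\<^sup>\<top> - (tr E) \<xi>\<^sup>\<top>\<close> has the divergence \<open>Ric(\<xi>\<^sup>\<top>, \<xi>\<^sup>\<top>) + tr E\<^sup>2 - (tr E)\<^sup>2\<close>. Since \<open>tr E = div \<xi>\<^sup>\<top>\<close>, the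
  hypothesis on the Ricci curvature bounds it from below by \<open>tr E\<^sup>2 - (tr E)\<^sup>2/n\<close>, which is nonnegative by
  the Cauchy-Schwarz inequality. The integral of \<open>div W\<close> over the compact leaf vanishes, so equality holds
  everywhere, and \<open>E\<close> is a multiple of the identity. As \<open>f\<close> has no zeros, so is \<open>A\<close>.
\<close>

subsection \<open>Calculus of continuously differentiable maps\<close>

text \<open>The symmetry of \<open>E\<close> is that of the shape operator, which comes from
  differentiating g(N, v) = 0 along the leaf with a torsion-free connection. The constant (n-1)/n =
  1 - 1/n is the one for which the Ricci bound turns -(tr E)^2 into -(tr E)^2/n, so that div W is
  bounded below by the squared norm of the trace-free part of \<open>E\<close>.

  The obstacle is the integration. A leaf is a component of a topology finer than that of the
  manifold, it is seen only through the slices of foliated charts, and no measure is built on it.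
  Every integral is a Lebesgue integral over a Euclidean space, weighted by the root of the Gram
  determinant. The charts are linked by the fact that the transition maps of the leaf are
  isometries, so that the density, \<open>E\<close> and \<open>W\<close> transform as they should.
  Compactness yields finitely many coordinate balls covering the leaf; a ball about the point under
  study is added to them, and the vanishing of div W is read off in the chart of that ball.\<close>

abbreviation (input) fd :: "('a::euclidean_space \<Rightarrow> 'b::real_normed_vector) \<Rightarrow> 'a \<Rightarrow> 'a \<Rightarrow> 'b" where
  "fd f x \<equiv> frechet_derivative f (at x)"

lemma fd_eqI: "(f has_derivative f') (at x) \<Longrightarrow> fd f x = f'"
  by (metis frechet_derivative_at)

lemma fd_works: "f differentiable (at x) \<Longrightarrow> (f has_derivative fd f x) (at x)"
  by (simp add: frechet_derivative_works)

lemma differentiable_cong_open: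
  assumes "open S" "x \<in> S" "\<And>y. y \<in> S \<Longrightarrow> f y = g y" "f differentiable (at x)"
  shows "g differentiable (at x)" "fd g x = fd f x"
proof -
  have "(g has_derivative fd f x) (at x)"
    using has_derivative_transform_within_open[OF fd_works[OF assms(4)] assms(1,2)] assms(3) by blast
  then show "g differentiable (at x)" "fd g x = fd f x"
    by (auto simp: differentiable_def dest: fd_eqI)
qed

lemma fd_eq_0:
  assumes "open S" "x \<in> S" "\<And>y. y \<in> S \<Longrightarrow> f y = 0"
  shows "fd f x u = 0"
proof -
  have "(f has_derivative (\<lambda>u. 0)) (at x)"
    by (rule has_derivative_transform_within_open[OF has_derivative_const assms(1,2)]) (simp add: assms(3))
  then show ?thesis by (simp add: fd_eqI)
qed

lemma Ck_on_cong:
  assumes "open S" "\<And>y. y \<in> S \<Longrightarrow> f y = g y"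
  shows "Ck_on k S f \<longleftrightarrow> Ck_on k S g"
  using assms
proof (induction k arbitrary: f g)
  case 0 then show ?case by (simp cong: continuous_on_cong)
next
  case (Suc k)
  have *: "Ck_on (Suc k) S g"
    if fg: "\<And>y. y \<in> S \<Longrightarrow> f y = g y" and C: "Ck_on (Suc k) S f" for f g :: "'a \<Rightarrow> 'b"
  proof -
    have "Ck_on k S (\<lambda>x. fd g x v)" for v
      using C Suc.IH[OF Suc.prems(1), of "\<lambda>x. fd f x v" "\<lambda>x. fd g x v"]
        differentiable_cong_open(2)[OF Suc.prems(1) _ fg] by simp
    then show ?thesis using C differentiable_cong_open(1)[OF Suc.prems(1) _ fg] by simp
  qed
  have "g y = f y" if "y \<in> S" for y using Suc.prems(2)[OF that] ..
  then show ?case using *[of f g] *[of g f] Suc.prems(2) by blast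
qed

text \<open>The closure properties below are inductions through this rule: an explicit derivative is
  written in terms of functions that the induction hypothesis covers.\<close>

lemma Ck_on_SucI:
  assumes "open S" "\<And>x. x \<in> S \<Longrightarrow> (f has_derivative f' x) (at x)" "\<And>v. Ck_on k S (\<lambda>x. f' x v)"
  shows "Ck_on (Suc k) S f"
proof -
  have "Ck_on k S (\<lambda>x. fd f x v)" for v
    using assms(3)[of v] Ck_on_cong[OF assms(1), of "\<lambda>x. fd f x v" "\<lambda>x. f' x v" k]
      fd_eqI[OF assms(2)] by simp
  then show ?thesis using assms(2) by (auto simp: differentiable_def)
qed

lemma Ck_on_imp_differentiable: "Ck_on (Suc k) S f \<Longrightarrow> x \<in> S \<Longrightarrow> f differentiable (at x)"
  by simp

lemma Ck_on_fd: "Ck_on (Suc k) S f \<Longrightarrow> Ck_on k S (\<lambda>x. fd f x v)"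
  by simp

lemma Ck_on_pred: "Ck_on (Suc k) S f \<Longrightarrow> Ck_on k S f"
proof (induction k arbitrary: f)
  case 0 then show ?case
    by (auto intro!: continuous_at_imp_continuous_on differentiable_imp_continuous_within)
next
  case (Suc k) then show ?case by (metis Ck_on.simps(2))
qed

lemma Ck_on_le: "Ck_on k S f \<Longrightarrow> j \<le> k \<Longrightarrow> Ck_on j S f"
proof (induction k)
  case (Suc k) then show ?case by (metis Ck_on_pred le_Suc_eq)
qed simp

lemma Ck_on_imp_continuous_on: "Ck_on k S f \<Longrightarrow> continuous_on S f"
  using Ck_on_le[of k S f 0] by simp

text \<open>Differentiability is local, so a function given by different formulas on overlapping
  open sets can be treated on each of them. Bump functions extended by zero are handled in this
  way.\<close>

lemma Ck_on_local:
  assumes "\<And>x. x \<in> S \<Longrightarrow> \<exists>T. open T \<and> x \<in> T \<and> Ck_on k T f"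
  shows "Ck_on k S f"
  using assms
proof (induction k arbitrary: f)
  case 0
  then show ?case
    by (metis Ck_on.simps(1) continuous_at_imp_continuous_on continuous_on_eq_continuous_at)
next
  case (Suc k)
  have "Ck_on k S (\<lambda>x. fd f x v)" for v by (rule Suc.IH) (metis Suc.prems Ck_on.simps(2))
  moreover have "f differentiable (at x)" if "x \<in> S" for x using Suc.prems[OF that] by auto
  ultimately show ?case by simp
qed

lemma Ck_on_const: "open S \<Longrightarrow> Ck_on k S (\<lambda>x. c)"
  by (induction k arbitrary: c) auto

lemma Ck_on_bounded_linear:
  assumes "open S" "bounded_linear h" "Ck_on k S f"
  shows "Ck_on k S (\<lambda>x. h (f x))"
  using assms(3)
proof (induction k arbitrary: f)
  case 0 then show ?case
    by (simp add: bounded_linear.continuous_on[OF assms(2)])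
next
  case (Suc k)
  show ?case
    by (rule Ck_on_SucI[OF assms(1), where f' = "\<lambda>x v. h (fd f x v)"])
       (use Suc in \<open>auto intro!: bounded_linear.has_derivative[OF assms(2)] fd_works\<close>)
qed

lemma Ck_on_linear: "open S \<Longrightarrow> bounded_linear h \<Longrightarrow> Ck_on k S h"
proof (induction k)
  case 0 then show ?case by (simp add: linear_continuous_on)
next
  case (Suc k)
  show ?case
    by (rule Ck_on_SucI[OF Suc.prems(1), where f' = "\<lambda>x. h"])
       (use Suc.prems in \<open>auto intro: bounded_linear_imp_has_derivative Ck_on_const\<close>)
qed

lemma Ck_on_id: "open S \<Longrightarrow> Ck_on k S (\<lambda>x. x)"
  by (rule Ck_on_linear) (auto simp: bounded_linear_ident)

lemma Ck_on_add:
  assumes "open S" "Ck_on k S f" "Ck_on k S g"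
  shows "Ck_on k S (\<lambda>x. f x + g x)"
  using assms(2,3)
proof (induction k arbitrary: f g)
  case 0 then show ?case by (simp add: continuous_on_add)
next
  case (Suc k)
  show ?case
    by (rule Ck_on_SucI[OF assms(1), where f' = "\<lambda>x v. fd f x v + fd g x v"])
       (use Suc in \<open>auto intro!: has_derivative_add fd_works\<close>)
qed

text \<open>The Leibniz rule holds for every bounded bilinear product, so one induction serves
  products of reals, scalar multiples and inner products.\<close>

lemma Ck_on_bilinear:
  assumes "open S" "bounded_bilinear p" "Ck_on k S f" "Ck_on k S g"
  shows "Ck_on k S (\<lambda>x. p (f x) (g x))"
  using assms(3,4)
proof (induction k arbitrary: f g)
  case 0 then show ?case by (simp add: bounded_bilinear.continuous_on[OF assms(2)])
next
  case (Suc k)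
  show ?case
  proof (rule Ck_on_SucI[OF assms(1), where f' = "\<lambda>x v. p (f x) (fd g x v) + p (fd f x v) (g x)"])
    show "((\<lambda>x. p (f x) (g x)) has_derivative (\<lambda>v. p (f x) (fd g x v) + p (fd f x v) (g x))) (at x)"
      if "x \<in> S" for x
      by (rule bounded_bilinear.FDERIV[OF assms(2)]) (use Suc.prems that in \<open>auto intro: fd_works\<close>)
    show "Ck_on k S (\<lambda>x. p (f x) (fd g x v) + p (fd f x v) (g x))" for v
      by (intro Ck_on_add[OF assms(1)] Suc.IH Ck_on_pred[OF Suc.prems(1)] Ck_on_pred[OF Suc.prems(2)]
            Ck_on_fd[OF Suc.prems(1)] Ck_on_fd[OF Suc.prems(2)])
  qed
qed

lemmas Ck_on_mult = Ck_on_bilinear[OF _ bounded_bilinear_mult]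
lemmas Ck_on_scaleR = Ck_on_bilinear[OF _ bounded_bilinear_scaleR]
lemmas Ck_on_inner = Ck_on_bilinear[OF _ bounded_bilinear_inner]

lemma Ck_on_minus: "open S \<Longrightarrow> Ck_on k S f \<Longrightarrow> Ck_on k S (\<lambda>x. - f x)"
  by (rule Ck_on_bounded_linear[OF _ bounded_linear_minus[OF bounded_linear_ident]])

lemma Ck_on_diff: "open S \<Longrightarrow> Ck_on k S f \<Longrightarrow> Ck_on k S g \<Longrightarrow> Ck_on k S (\<lambda>x. f x - g x)"
  using Ck_on_add[of S k f "\<lambda>x. - g x"] Ck_on_minus[of S k g] by simp

lemma Ck_on_sum:
  assumes "open S" "\<And>i. i \<in> I \<Longrightarrow> Ck_on k S (f i)"
  shows "Ck_on k S (\<lambda>x. \<Sum>i\<in>I. f i x)"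
  using assms(2) by (induction I rule: infinite_finite_induct)
    (auto intro: Ck_on_const Ck_on_add assms(1))

lemma Ck_on_prod:
  fixes f :: "'i \<Rightarrow> 'a::euclidean_space \<Rightarrow> real"
  assumes "open S" "\<And>i. i \<in> I \<Longrightarrow> Ck_on k S (f i)"
  shows "Ck_on k S (\<lambda>x. \<Prod>i\<in>I. f i x)"
  using assms(2) by (induction I rule: infinite_finite_induct)
    (auto intro: Ck_on_const Ck_on_mult assms(1))

lemma Ck_on_inverse:
  fixes f :: "'a::euclidean_space \<Rightarrow> real"
  assumes "open S" "Ck_on k S f" "\<And>x. x \<in> S \<Longrightarrow> f x \<noteq> 0"
  shows "Ck_on k S (\<lambda>x. inverse (f x))"
  using assms(2,3)
proof (induction k)
  case 0 then show ?case by (simp add: continuous_on_inverse)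
next
  case (Suc k)
  \<comment> \<open>The derivative of 1/f contains 1/f itself, but only its regularity of order
    \<open>k\<close> is required, which the induction hypothesis supplies.\<close>
  have C: "Ck_on k S (\<lambda>x. inverse (f x))"
    using Suc.IH Suc.prems Ck_on_pred by blast
  show ?case
  proof (rule Ck_on_SucI[OF assms(1), where f' = "\<lambda>x v. - (inverse (f x) * fd f x v * inverse (f x))"])
    show "((\<lambda>x. inverse (f x)) has_derivative (\<lambda>v. - (inverse (f x) * fd f x v * inverse (f x)))) (at x)"
      if "x \<in> S" for x
      by (rule Deriv.has_derivative_inverse) (use Suc.prems that in \<open>auto intro: fd_works\<close>)
    show "Ck_on k S (\<lambda>x. - (inverse (f x) * fd f x v * inverse (f x)))" for v
      by (intro Ck_on_minus[OF assms(1)] Ck_on_mult[OF assms(1)] C Ck_on_fd[OF Suc.prems(1)])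
  qed
qed

lemma Ck_on_divide:
  fixes f g :: "'a::euclidean_space \<Rightarrow> real"
  assumes "open S" "Ck_on k S f" "Ck_on k S g" "\<And>x. x \<in> S \<Longrightarrow> g x \<noteq> 0"
  shows "Ck_on k S (\<lambda>x. f x / g x)"
  unfolding divide_inverse by (intro Ck_on_mult Ck_on_inverse assms)

lemma Ck_on_sqrt:
  assumes "open S" "Ck_on k S f" "\<And>x. x \<in> S \<Longrightarrow> f x > 0"
  shows "Ck_on k S (\<lambda>x. sqrt (f x))"
  using assms(2,3)
proof (induction k)
  case 0 then show ?case by (simp add: continuous_on_real_sqrt)
next
  case (Suc k)
  have C: "Ck_on k S (\<lambda>x. sqrt (f x))"
    using Suc.IH Suc.prems Ck_on_pred by blast
  show ?case
  proof (rule Ck_on_SucI[OF assms(1), where f' = "\<lambda>x v. fd f x v * (1/2) * inverse (sqrt (f x))"])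
    show "((\<lambda>x. sqrt (f x)) has_derivative (\<lambda>v. fd f x v * (1/2) * inverse (sqrt (f x)))) (at x)"
      if x: "x \<in> S" for x
    proof -
      have "(f has_derivative fd f x) (at x)" using Suc.prems x by (auto intro: fd_works)
      from has_derivative_real_sqrt[OF _ this] Suc.prems(2)[OF x]
      show ?thesis by (simp add: field_simps)
    qed
    show "Ck_on k S (\<lambda>x. fd f x v * (1/2) * inverse (sqrt (f x)))" for v
      by (intro Ck_on_mult[OF assms(1)] Ck_on_const[OF assms(1)] Ck_on_inverse[OF assms(1)] C
            Ck_on_fd[OF Suc.prems(1)]) (use Suc.prems in force)
  qed
qed

lemma fd_Basis_sum:
  assumes "f differentiable (at x)"
  shows "fd f x v = (\<Sum>b\<in>Basis. (v \<bullet> b) *\<^sub>R fd f x b)"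
proof -
  interpret linear "fd f x" using assms by (rule linear_frechet_derivative)
  show ?thesis by (subst euclidean_representation[of v, symmetric]) (simp only: sum scale)
qed

text \<open>The chain rule applies the derivative of \<open>f\<close> to a vector that moves with
  the point, whereas \<open>Ck_on\<close> speaks of fixed directions. Expanding the vector in the
  basis reduces one to the other.\<close>

lemma Ck_on_compose:
  fixes f :: "'b::euclidean_space \<Rightarrow> 'c::real_normed_vector" and g :: "'a::euclidean_space \<Rightarrow> 'b"
  assumes "open S" "open T" "Ck_on k S g" "Ck_on k T f" "\<And>x. x \<in> S \<Longrightarrow> g x \<in> T"
  shows "Ck_on k S (\<lambda>x. f (g x))"
  using assms(3,4)
proof (induction k arbitrary: f)
  case 0
  then show ?case using continuous_on_compose2[of T f S g] assms(5) by auto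
next
  case (Suc k)
  have df: "f differentiable (at (g x))" if "x \<in> S" for x using Suc.prems assms(5)[OF that] by auto
  show ?case
  proof (rule Ck_on_SucI[OF assms(1), where f' = "\<lambda>x v. \<Sum>b\<in>Basis. (fd g x v \<bullet> b) *\<^sub>R fd f (g x) b"])
    show "((\<lambda>x. f (g x)) has_derivative (\<lambda>v. \<Sum>b\<in>Basis. (fd g x v \<bullet> b) *\<^sub>R fd f (g x) b)) (at x)"
      if x: "x \<in> S" for x
    proof -
      have "((\<lambda>x. f (g x)) has_derivative (\<lambda>v. fd f (g x) (fd g x v))) (at x)"
        by (rule has_derivative_compose[of g]) (use Suc.prems x df in \<open>auto intro: fd_works\<close>)
      then show ?thesis unfolding fd_Basis_sum[OF df[OF x], of "fd g x _"] .
    qed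
    have "Ck_on k S (\<lambda>x. fd f (g x) b)" for b
      by (rule Suc.IH) (use Suc.prems Ck_on_pred in auto)
    then show "Ck_on k S (\<lambda>x. \<Sum>b\<in>Basis. (fd g x v \<bullet> b) *\<^sub>R fd f (g x) b)" for v
      by (intro Ck_on_sum[OF assms(1)] Ck_on_scaleR[OF assms(1)] Ck_on_inner[OF assms(1)]
          Ck_on_const[OF assms(1)] Ck_on_fd[OF Suc.prems(1)])
  qed
qed

lemma Ck_on_components:
  fixes f :: "'a::euclidean_space \<Rightarrow> 'b::euclidean_space"
  assumes "open S" "\<And>b. b \<in> Basis \<Longrightarrow> Ck_on k S (\<lambda>x. f x \<bullet> b)"
  shows "Ck_on k S f"
proof -
  have "Ck_on k S (\<lambda>x. \<Sum>b\<in>Basis. (f x \<bullet> b) *\<^sub>R b)"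
    by (intro Ck_on_sum Ck_on_scaleR assms Ck_on_const)
  then show ?thesis by (simp add: euclidean_representation)
qed

text \<open>Both the base point and the direction of the derivative may vary. One order of
  differentiability of \<open>f\<close> is lost.\<close>

lemma Ck_on_fd_comp:
  fixes X :: "'a::euclidean_space \<Rightarrow> 'b::euclidean_space"
  assumes "open S" "open T" "Ck_on (Suc k) T f" "Ck_on k S \<phi>" "\<And>x. x \<in> S \<Longrightarrow> \<phi> x \<in> T" "Ck_on k S X"
  shows "Ck_on k S (\<lambda>x. fd f (\<phi> x) (X x))"
proof -
  have d: "f differentiable (at (\<phi> x))" if "x \<in> S" for x using assms(3,5) that by auto
  have "Ck_on k S (\<lambda>x. fd f (\<phi> x) b)" for b
    by (rule Ck_on_compose[OF assms(1,2,4) Ck_on_fd[OF assms(3)] assms(5)])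
  then have "Ck_on k S (\<lambda>x. \<Sum>b\<in>Basis. (X x \<bullet> b) *\<^sub>R fd f (\<phi> x) b)"
    by (intro Ck_on_sum[OF assms(1)] Ck_on_scaleR[OF assms(1)] Ck_on_inner[OF assms(1)]
          Ck_on_const[OF assms(1)] assms(6))
  then show ?thesis by (subst Ck_on_cong[OF assms(1) fd_Basis_sum[OF d]])
qed

subsection \<open>A smooth bump function\<close>

text \<open>The derivative of each function of this family is a combination of two others, so that their
  smoothness is a single induction.\<close>

definition flat_exp :: "nat \<Rightarrow> real \<Rightarrow> real" where
  "flat_exp j t = (if t > 0 then inverse t ^ j * exp (- inverse t) else 0)"

text \<open>With x = 1/t this is exp x \<ge> x^(j+2) / (j+2)!, a single term of the exponential
  series. The quadratic bound makes the difference quotient at 0 tend to 0.\<close>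

lemma flat_exp_bound: "\<bar>flat_exp j t\<bar> \<le> fact (j + 2) * t\<^sup>2"
proof (cases "t > 0")
  case True
  define x where "x = inverse t"
  have x: "x > 0" "t = inverse x" using True by (auto simp: x_def)
  have "x ^ (j+2) / fact (j+2) \<le> exp x"
  proof -
    have "(\<Sum>i\<in>{j+2}. x ^ i /\<^sub>R fact i) \<le> (\<Sum>i. x ^ i /\<^sub>R fact i)"
      by (rule sum_le_suminf[OF summable_exp_generic]) (use x in auto)
    then show ?thesis by (simp add: exp_def divide_inverse mult_ac)
  qed
  moreover have "x ^ j * exp (- x) \<le> C * (inverse x)\<^sup>2"
    if "x ^ (j+2) / C \<le> exp x" "C > 0" for C :: real
    using that x(1) by (simp add: exp_minus field_simps power_add power2_eq_square)
  ultimately have "x ^ j * exp (- x) \<le> fact (j + 2) * (inverse x)\<^sup>2" by simp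
  then show ?thesis using True x unfolding flat_exp_def x_def by simp
qed (simp add: flat_exp_def)

lemma flat_exp_deriv:
  "(flat_exp j has_real_derivative flat_exp (j + 2) t - of_nat j * flat_exp (j + 1) t) (at t)"
proof -
  consider "t > 0" | "t < 0" | "t = 0" by linarith
  then show ?thesis
  proof cases
    case 1
    have "((\<lambda>t. inverse t ^ j * exp (- inverse t)) has_real_derivative
        inverse t ^ j * (exp (- inverse t) * (inverse t)\<^sup>2) -
        of_nat j * (inverse t ^ (j - 1) * (inverse t)\<^sup>2) * exp (- inverse t)) (at t)"
      by (rule derivative_eq_intros refl | use 1 in force)+ (simp add: power2_eq_square)
    \<comment> \<open>For j = 0 the truncated exponent j - 1 is harmless, since the factor j
      vanishes.\<close>
    also have "of_nat j * (inverse t ^ (j - 1) * (inverse t)\<^sup>2) = of_nat j * inverse t ^ (j + 1)"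
      by (cases j) (simp_all add: power2_eq_square mult_ac)
    finally have "((\<lambda>t. inverse t ^ j * exp (- inverse t)) has_real_derivative
        flat_exp (j + 2) t - of_nat j * flat_exp (j + 1) t) (at t)"
      using 1 by (simp add: flat_exp_def power_add power2_eq_square mult_ac)
    then show ?thesis
      by (rule has_field_derivative_transform_within_open[where S = "{0<..}"])
         (use 1 in \<open>auto simp: flat_exp_def\<close>)
  next
    case 2
    have "((\<lambda>t::real. 0) has_real_derivative
        flat_exp (j + 2) t - of_nat j * flat_exp (j + 1) t) (at t)"
      using 2 by (auto simp: flat_exp_def)
    then show ?thesis
      by (rule has_field_derivative_transform_within_open[where S = "{..<0}"])
         (use 2 in \<open>auto simp: flat_exp_def\<close>)
  next
    case 3
    have "((\<lambda>h. flat_exp j h / h) \<longlongrightarrow> 0) (at 0)"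
    proof (rule Lim_null_comparison)
      show "\<forall>\<^sub>F h in at 0. norm (flat_exp j h / h) \<le> fact (j + 2) * \<bar>h\<bar>"
      proof (rule eventually_at_filter[THEN iffD2], intro always_eventually allI impI)
        fix h :: real assume "h \<noteq> 0"
        then show "norm (flat_exp j h / h) \<le> fact (j + 2) * \<bar>h\<bar>"
          using flat_exp_bound[of j h] by (simp add: divide_le_eq mult.assoc power2_eq_square)
      qed
      show "((\<lambda>h::real. fact (j + 2) * \<bar>h\<bar>) \<longlongrightarrow> 0) (at 0)" by (auto intro!: tendsto_eq_intros)
    qed
    then show ?thesis using 3 by (simp add: DERIV_def flat_exp_def)
  qed
qed

lemma Ck_on_flat_exp: "Ck_on k UNIV (flat_exp j)"
proof (induction k arbitrary: j)
  case 0
  show ?case by (auto intro!: continuous_at_imp_continuous_on DERIV_isCont[OF flat_exp_deriv])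
next
  case (Suc k)
  show ?case
    by (rule Ck_on_SucI[OF open_UNIV flat_exp_deriv[unfolded has_field_derivative_def]])
       (intro Ck_on_mult Ck_on_diff Ck_on_const Suc open_UNIV)
qed

text \<open>The argument r^2 - |a - x|^2 is a polynomial, hence smooth also at the center, and it is
  positive exactly on the open ball.\<close>

lemma smooth_bump_exists:
  fixes a :: "'a::euclidean_space"
  assumes "r > 0"
  obtains \<beta> :: "'a \<Rightarrow> real" where "\<And>k. Ck_on k UNIV \<beta>" "\<beta> a > 0" "\<And>x. \<beta> x \<ge> 0"
    "\<And>x. \<beta> x > 0 \<longleftrightarrow> dist a x < r"
proof
  define \<beta> :: "'a \<Rightarrow> real" where "\<beta> x = flat_exp 0 (r\<^sup>2 - (a - x) \<bullet> (a - x))" for x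
  show "Ck_on k UNIV \<beta>" for k
    unfolding \<beta>_def
    by (rule Ck_on_compose[OF _ _ _ Ck_on_flat_exp])
       (auto intro!: Ck_on_diff Ck_on_inner Ck_on_const Ck_on_id)
  have *: "\<beta> x > 0 \<longleftrightarrow> dist a x < r" for x
  proof -
    have "\<beta> x > 0 \<longleftrightarrow> (dist a x)\<^sup>2 < r\<^sup>2"
      by (simp add: \<beta>_def flat_exp_def dist_norm power2_norm_eq_inner)
    also have "\<dots> \<longleftrightarrow> dist a x < r"
      using power_strict_mono[of "dist a x" r 2] power2_less_imp_less[of "dist a x" r] assms by auto
    finally show ?thesis .
  qed
  then show "\<beta> x > 0 \<longleftrightarrow> dist a x < r" for x .
  show "\<beta> a > 0" using * assms by simp
  show "\<beta> x \<ge> 0" for x by (simp add: \<beta>_def flat_exp_def)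
qed

subsection \<open>Symmetry of second derivatives\<close>

lemma fd_line:
  assumes "f differentiable (at (p + t *\<^sub>R v))"
  shows "((\<lambda>t. f (p + t *\<^sub>R v)) has_vector_derivative fd f (p + t *\<^sub>R v) v) (at t)"
proof -
  have "((\<lambda>t. p + t *\<^sub>R v) has_derivative (\<lambda>h. h *\<^sub>R v)) (at t)"
    by (auto intro!: derivative_eq_intros)
  from has_derivative_compose[OF this fd_works[OF assms]]
  show ?thesis
    by (simp add: has_vector_derivative_def linear_cmul[OF linear_frechet_derivative[OF assms]])
qed

text \<open>The mean value theorem is applied twice: along \<open>v\<close> to the difference of
  \<open>f\<close> on two parallel edges, then along \<open>u\<close> to the derivative in direction
  \<open>v\<close>. The left-hand side is symmetric in \<open>u\<close> and \<open>v\<close>, the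
  right-hand side is not visibly so.\<close>

lemma second_difference:
  fixes f :: "'a::euclidean_space \<Rightarrow> real"
  assumes C: "Ck_on 2 S f" and s: "s > 0"
    and in_S: "\<And>\<sigma> \<tau>. \<sigma> \<in> {0..s} \<Longrightarrow> \<tau> \<in> {0..s} \<Longrightarrow> x + \<sigma> *\<^sub>R u + \<tau> *\<^sub>R v \<in> S"
  obtains \<sigma> \<tau> where "\<sigma> \<in> {0..s}" "\<tau> \<in> {0..s}"
    "f (x + s *\<^sub>R u + s *\<^sub>R v) - f (x + s *\<^sub>R u) - f (x + s *\<^sub>R v) + f x =
       s * s * fd (\<lambda>y. fd f y v) (x + \<sigma> *\<^sub>R u + \<tau> *\<^sub>R v) u"
proof -
  have d1: "f differentiable (at y)" and d2: "(\<lambda>y. fd f y v) differentiable (at y)" if "y \<in> S" for y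
    using C that by (auto simp: numeral_2_eq_2)
  have D1: "((\<lambda>t. f (p + t *\<^sub>R v)) has_real_derivative fd f (p + t *\<^sub>R v) v) (at t)"
    if "p + t *\<^sub>R v \<in> S" for p t
    using fd_line[OF d1[OF that]] by (simp add: has_real_derivative_iff_has_vector_derivative)
  have D2: "((\<lambda>t. fd f (p + t *\<^sub>R u) v) has_real_derivative fd (\<lambda>y. fd f y v) (p + t *\<^sub>R u) u) (at t)"
    if "p + t *\<^sub>R u \<in> S" for p t
    using fd_line[OF d2[OF that]] by (simp add: has_real_derivative_iff_has_vector_derivative)
  have "\<exists>\<tau>>0. \<tau> < s \<and>
      (f (x + s *\<^sub>R u + s *\<^sub>R v) - f (x + s *\<^sub>R v)) - (f (x + s *\<^sub>R u + 0 *\<^sub>R v) - f (x + 0 *\<^sub>R v)) =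
      (s - 0) * (fd f (x + s *\<^sub>R u + \<tau> *\<^sub>R v) v - fd f (x + \<tau> *\<^sub>R v) v)"
  proof (rule MVT2[where f = "\<lambda>t. f (x + s *\<^sub>R u + t *\<^sub>R v) - f (x + t *\<^sub>R v)"])
    fix t assume "0 \<le> t" "t \<le> s"
    then show "((\<lambda>t. f (x + s *\<^sub>R u + t *\<^sub>R v) - f (x + t *\<^sub>R v)) has_real_derivative
        fd f (x + s *\<^sub>R u + t *\<^sub>R v) v - fd f (x + t *\<^sub>R v) v) (at t)"
      using in_S[of s t] in_S[of 0 t] s by (intro DERIV_diff D1) auto
  qed (use s in auto)
  then obtain \<tau> where \<tau>: "0 < \<tau>" "\<tau> < s" and eq1:
      "f (x + s *\<^sub>R u + s *\<^sub>R v) - f (x + s *\<^sub>R u) - f (x + s *\<^sub>R v) + f x =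
      s * (fd f (x + s *\<^sub>R u + \<tau> *\<^sub>R v) v - fd f (x + \<tau> *\<^sub>R v) v)"
    by (auto simp: algebra_simps)
  have "\<exists>\<sigma>>0. \<sigma> < s \<and>
      fd f (x + \<tau> *\<^sub>R v + s *\<^sub>R u) v - fd f (x + \<tau> *\<^sub>R v + 0 *\<^sub>R u) v =
      (s - 0) * fd (\<lambda>y. fd f y v) (x + \<tau> *\<^sub>R v + \<sigma> *\<^sub>R u) u"
  proof (rule MVT2[where f = "\<lambda>t. fd f (x + \<tau> *\<^sub>R v + t *\<^sub>R u) v"])
    fix t assume "0 \<le> t" "t \<le> s"
    then show "((\<lambda>t. fd f (x + \<tau> *\<^sub>R v + t *\<^sub>R u) v) has_real_derivative
        fd (\<lambda>y. fd f y v) (x + \<tau> *\<^sub>R v + t *\<^sub>R u) u) (at t)"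
      using in_S[of t \<tau>] \<tau> by (intro D2) (auto simp: add_ac)
  qed (use s in auto)
  then obtain \<sigma> where \<sigma>: "0 < \<sigma>" "\<sigma> < s" and
      "fd f (x + s *\<^sub>R u + \<tau> *\<^sub>R v) v - fd f (x + \<tau> *\<^sub>R v) v =
      s * fd (\<lambda>y. fd f y v) (x + \<sigma> *\<^sub>R u + \<tau> *\<^sub>R v) u"
    by (auto simp: add_ac)
  then show thesis using that[of \<sigma> \<tau>] eq1 \<sigma> \<tau> by simp
qed

text \<open>The second difference over a small parallelogram, evaluated in both orders, makes the
  two mixed derivatives agree at two points close to \<open>x\<close>. If they differed at
  \<open>x\<close>, continuity would keep them apart there.\<close>

lemma fd_commute_real:
  fixes f :: "'a::euclidean_space \<Rightarrow> real"
  assumes S: "open S" "x \<in> S" and C: "Ck_on 2 S f"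
  shows "fd (\<lambda>y. fd f y v) x u = fd (\<lambda>y. fd f y u) x v"
proof (rule ccontr)
  define A where "A v u y = fd (\<lambda>y. fd f y v) y u" for v u y
  assume "\<not> ?thesis"
  then have e: "\<bar>A v u x - A u v x\<bar> / 2 > 0" by (simp add: A_def)
  have cont: "isCont (A v u) x" for v u
    using C S unfolding A_def by (simp add: numeral_2_eq_2 continuous_on_eq_continuous_at)
  obtain d0 where d0: "d0 > 0" "ball x d0 \<subseteq> S" using S openE by blast
  obtain d1 where d1: "d1 > 0" "\<And>y. dist y x < d1 \<Longrightarrow> dist (A v u y) (A v u x) < \<bar>A v u x - A u v x\<bar> / 2"
    using cont[of v u, unfolded continuous_at_eps_delta, rule_format, OF e] by blast
  obtain d2 where d2: "d2 > 0" "\<And>y. dist y x < d2 \<Longrightarrow> dist (A u v y) (A u v x) < \<bar>A v u x - A u v x\<bar> / 2"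
    using cont[of u v, unfolded continuous_at_eps_delta, rule_format, OF e] by blast
  define d where "d = min d0 (min d1 d2)"
  have d: "d > 0" "d \<le> d0" "d \<le> d1" "d \<le> d2" using d0 d1 d2 by (auto simp: d_def)
  \<comment> \<open>The parallelogram with sides s u and s v then lies in the ball of radius
    \<open>d\<close>; the summand 1 covers u = v = 0.\<close>
  define s where "s = d / (norm u + norm v + 1)"
  have pos: "norm u + norm v + 1 > 0" by (simp add: add_nonneg_pos)
  have s: "s > 0" using d pos by (simp add: s_def)
  have near: "dist (x + \<sigma> *\<^sub>R u + \<tau> *\<^sub>R v) x < d" if "\<sigma> \<in> {0..s}" "\<tau> \<in> {0..s}" for \<sigma> \<tau>
  proof -
    have "dist (x + \<sigma> *\<^sub>R u + \<tau> *\<^sub>R v) x = norm (\<sigma> *\<^sub>R u + \<tau> *\<^sub>R v)" by (simp add: dist_norm add.assoc)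
    also have "\<dots> \<le> \<sigma> * norm u + \<tau> * norm v"
      using norm_triangle_ineq[of "\<sigma> *\<^sub>R u" "\<tau> *\<^sub>R v"] that by simp
    also have "\<dots> \<le> s * norm u + s * norm v"
      using that by (intro add_mono mult_right_mono) auto
    also have "\<dots> < s * (norm u + norm v + 1)" using s by (simp add: algebra_simps)
    also have "\<dots> = d" using pos by (simp add: s_def)
    finally show ?thesis .
  qed
  have in_S: "x + \<sigma> *\<^sub>R u + \<tau> *\<^sub>R v \<in> S" if "\<sigma> \<in> {0..s}" "\<tau> \<in> {0..s}" for \<sigma> \<tau>
    using near[OF that] d d0 by (auto simp: dist_commute)
  obtain \<sigma> \<tau> where 1: "\<sigma> \<in> {0..s}" "\<tau> \<in> {0..s}"
    "f (x + s *\<^sub>R u + s *\<^sub>R v) - f (x + s *\<^sub>R u) - f (x + s *\<^sub>R v) + f x =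
       s * s * fd (\<lambda>y. fd f y v) (x + \<sigma> *\<^sub>R u + \<tau> *\<^sub>R v) u"
    using second_difference[OF C s in_S] by blast
  obtain \<sigma>' \<tau>' where 2: "\<sigma>' \<in> {0..s}" "\<tau>' \<in> {0..s}"
    "f (x + s *\<^sub>R v + s *\<^sub>R u) - f (x + s *\<^sub>R v) - f (x + s *\<^sub>R u) + f x =
       s * s * fd (\<lambda>y. fd f y u) (x + \<sigma>' *\<^sub>R v + \<tau>' *\<^sub>R u) v"
  proof (rule second_difference[OF C s])
    show "x + \<sigma> *\<^sub>R v + \<tau> *\<^sub>R u \<in> S" if "\<sigma> \<in> {0..s}" "\<tau> \<in> {0..s}" for \<sigma> \<tau>
      using in_S[OF that(2,1)] by (simp add: add_ac)
  qed
  have "s * s * A v u (x + \<sigma> *\<^sub>R u + \<tau> *\<^sub>R v) = s * s * A u v (x + \<tau>' *\<^sub>R u + \<sigma>' *\<^sub>R v)"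
  proof -
    have *: "x + s *\<^sub>R v + s *\<^sub>R u = x + s *\<^sub>R u + s *\<^sub>R v" "x + \<sigma>' *\<^sub>R v + \<tau>' *\<^sub>R u = x + \<tau>' *\<^sub>R u + \<sigma>' *\<^sub>R v"
      by (simp_all add: add_ac)
    show ?thesis using 1(3) 2(3) unfolding A_def * by linarith
  qed
  then have eq: "A v u (x + \<sigma> *\<^sub>R u + \<tau> *\<^sub>R v) = A u v (x + \<tau>' *\<^sub>R u + \<sigma>' *\<^sub>R v)" using s by simp
  have "dist (A v u (x + \<sigma> *\<^sub>R u + \<tau> *\<^sub>R v)) (A v u x) < \<bar>A v u x - A u v x\<bar> / 2"
    by (rule d1(2)) (use near[OF 1(1,2)] d in linarith)
  moreover have "dist (A u v (x + \<tau>' *\<^sub>R u + \<sigma>' *\<^sub>R v)) (A u v x) < \<bar>A v u x - A u v x\<bar> / 2"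
    by (rule d2(2)) (use near[OF 2(2,1)] d in linarith)
  ultimately show False using eq by (simp add: dist_real_def abs_if split: if_splits)
qed

lemma fd_commute:
  fixes f :: "'a::euclidean_space \<Rightarrow> 'b::euclidean_space"
  assumes S: "open S" "x \<in> S" and C: "Ck_on 2 S f"
  shows "fd (\<lambda>y. fd f y v) x u = fd (\<lambda>y. fd f y u) x v"
proof (rule euclidean_eqI)
  fix b :: 'b assume "b \<in> Basis"
  have inner: "fd (\<lambda>y. g y \<bullet> b) y w = fd g y w \<bullet> b" if "g differentiable (at y)" for g :: "'a \<Rightarrow> 'b" and y w
    using fd_eqI[OF has_derivative_inner_left[OF fd_works[OF that], of b]] by simp
  have d: "f differentiable (at y)" "(\<lambda>y. fd f y w) differentiable (at y)" if "y \<in> S" for y w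
    using C that by (auto simp: numeral_2_eq_2)
  have "fd (\<lambda>y. fd f y v) x u \<bullet> b = fd (\<lambda>y. fd (\<lambda>y. f y \<bullet> b) y v) x u" for v u
  proof -
    have "fd (\<lambda>y. fd (\<lambda>y. f y \<bullet> b) y v) x = fd (\<lambda>y. fd f y v \<bullet> b) x"
      by (rule differentiable_cong_open(2)[OF S])
         (use inner[OF d(1)] d(2)[OF S(2), of v] in \<open>auto intro!: differentiable_inner\<close>)
    then show ?thesis using inner[OF d(2)[OF S(2), of v], of u] by simp
  qed
  moreover have "Ck_on 2 S (\<lambda>y. f y \<bullet> b)" by (intro Ck_on_inner C Ck_on_const S)
  ultimately show "fd (\<lambda>y. fd f y v) x u \<bullet> b = fd (\<lambda>y. fd f y u) x v \<bullet> b"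
    using fd_commute_real[OF S, of "\<lambda>y. f y \<bullet> b" v u] by simp
qed

subsection \<open>Integration\<close>

lemma integrable_compact_support:
  fixes F :: "'a::euclidean_space \<Rightarrow> real"
  assumes "continuous_on UNIV F" "compact K" "\<And>x. x \<notin> K \<Longrightarrow> F x = 0"
  shows "integrable lborel F"
proof -
  have "integrable lborel (\<lambda>x. indicator K x *\<^sub>R F x)"
    by (rule borel_integrable_compact[OF assms(2) continuous_on_subset[OF assms(1)]]) simp
  also have "(\<lambda>x. indicator K x *\<^sub>R F x) = F" using assms(3) by (auto simp: fun_eq_iff indicator_def)
  finally show ?thesis .
qed

text \<open>The integral of \<open>F (x + t u)\<close> does not depend on \<open>t\<close>; its derivative at \<open>t = 0\<close> is the integral below.\<close>

lemma integral_fd_eq_0: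
  fixes F :: "'a::euclidean_space \<Rightarrow> real"
  assumes C: "Ck_on 1 UNIV F" and K: "compact K" and F0: "\<And>x. x \<notin> K \<Longrightarrow> F x = 0"
  shows "integral\<^sup>L lborel (\<lambda>x. fd F x u) = 0"
proof -
  have cF: "continuous_on UNIV F" using Ck_on_imp_continuous_on[OF C] .
  have dF: "F differentiable (at x)" for x using C by simp
  have cf: "continuous_on UNIV (\<lambda>x. fd F x u)" using C by simp
  have f0: "fd F x u = 0" if "x \<notin> K" for x
    by (rule fd_eq_0[of "- K"]) (use that F0 K compact_imp_closed in auto)
  have "compact ((\<lambda>x. fd F x u) ` K)"
    by (rule compact_continuous_image[OF continuous_on_subset[OF cf] K]) simp
  then obtain C0 where "\<forall>y\<in>(\<lambda>x. fd F x u) ` K. norm y \<le> C0"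
    using compact_imp_bounded bounded_iff by metis
  then have C0: "\<bar>fd F x u\<bar> \<le> C0" if "x \<in> K" for x using that by simp
  define B where "B = max C0 0"
  have B: "\<bar>fd F x u\<bar> \<le> B" for x using C0[of x] f0[of x] by (cases "x \<in> K") (auto simp: B_def)
  obtain R where R: "\<And>x. x \<in> K \<Longrightarrow> norm x \<le> R" using compact_imp_bounded[OF K] by (auto simp: bounded_iff)
  \<comment> \<open>Dominated convergence is a statement about sequences, so the limit t = 0 is
    approached along this one; its values stay at most 1.\<close>
  define s where "s n = 1 / real (Suc n)" for n
  have s: "s n > 0" "s n \<le> 1" for n by (auto simp: s_def)
  define q where "q n x = (F (x + s n *\<^sub>R u) - F x) / s n" for n x
  \<comment> \<open>The ball is larger than the support by |u|: a point outside the support can be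
    moved into it by the translation. On the ball the mean value theorem bounds the quotient, and
    outside of it both values of \<open>F\<close> vanish.\<close>
  have bound: "\<bar>q n x\<bar> \<le> indicator (cball 0 (R + norm u)) x * B" for n x
  proof (cases "norm x \<le> R + norm u")
    case True
    have "\<exists>z>0. z < s n \<and> F (x + s n *\<^sub>R u) - F (x + 0 *\<^sub>R u) = (s n - 0) * fd F (x + z *\<^sub>R u) u"
      by (rule MVT2) (use s fd_line[OF dF] in \<open>auto simp: has_real_derivative_iff_has_vector_derivative\<close>)
    then obtain z where "F (x + s n *\<^sub>R u) - F x = s n * fd F (x + z *\<^sub>R u) u" by auto
    then have "q n x = fd F (x + z *\<^sub>R u) u" using s[of n] by (simp add: q_def)
    then show ?thesis using B True by simp
  next
    case False
    have "norm (s n *\<^sub>R u) \<le> norm u" using s[of n] by (simp add: mult_left_le_one_le)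
    then have "norm (x + s n *\<^sub>R u) > R" using norm_triangle_ineq4[of "x + s n *\<^sub>R u" "s n *\<^sub>R u"] False by simp
    moreover have "norm x > R" using False norm_ge_zero[of u] by linarith
    ultimately have "F (x + s n *\<^sub>R u) = 0" "F x = 0" using F0 R by force+
    then show ?thesis by (simp add: q_def False)
  qed
  have iF: "integrable lborel F" by (rule integrable_compact_support[OF cF K F0])
  have "(\<lambda>n. integral\<^sup>L lborel (q n)) \<longlonglongrightarrow> integral\<^sup>L lborel (\<lambda>x. fd F x u)"
  proof (rule integral_dominated_convergence[where w = "\<lambda>x. indicator (cball 0 (R + norm u)) x * B"])
    show "(\<lambda>x. fd F x u) \<in> borel_measurable lborel"
      using borel_measurable_continuous_onI[OF cf] by simp
    show "q n \<in> borel_measurable lborel" for n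
    proof -
      have "continuous_on UNIV (q n)" unfolding q_def
        by (intro continuous_intros continuous_on_compose2[OF cF]) (use s[of n] in auto)
      then show ?thesis using borel_measurable_continuous_onI by simp
    qed
    show "integrable lborel (\<lambda>x. indicator (cball 0 (R + norm u)) x * B)"
      using borel_integrable_compact[of "cball 0 (R + norm u)" "\<lambda>_. B"] by simp
    show "AE x in lborel. (\<lambda>n. q n x) \<longlonglongrightarrow> fd F x u"
    proof (intro AE_I2)
      fix x
      have "((\<lambda>h. (F (x + h *\<^sub>R u) - F x) / h) \<longlongrightarrow> fd F x u) (at 0)"
        using fd_line[of F x 0 u] dF
        by (simp add: has_real_derivative_iff_has_vector_derivative[symmetric] DERIV_def)
      moreover have "filterlim s (at 0) sequentially"
      proof (rule filterlim_atI)
        show "s \<longlonglongrightarrow> 0"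
          using LIMSEQ_inverse_real_of_nat by (simp add: s_def[abs_def] inverse_eq_divide)
        show "\<forall>\<^sub>F n in sequentially. s n \<noteq> 0" using s(1) by (simp add: less_imp_neq[symmetric])
      qed
      ultimately show "(\<lambda>n. q n x) \<longlonglongrightarrow> fd F x u"
        unfolding q_def by (rule filterlim_compose)
    qed
    show "AE x in lborel. norm (q n x) \<le> indicator (cball 0 (R + norm u)) x * B" for n
      using bound by simp
  qed
  moreover have "integral\<^sup>L lborel (q n) = 0" for n
  proof -
    \<comment> \<open>Translation invariance: each difference quotient integrates to the difference
      of two equal integrals.\<close>
    have *: "integrable lborel (\<lambda>x. F (x + c))" "integral\<^sup>L lborel (\<lambda>x. F (x + c)) = integral\<^sup>L lborel F" for c
    proof -
      have m: "(+) c \<in> measurable lborel borel" "F \<in> borel_measurable borel"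
        using borel_measurable_continuous_onI[OF cF] by auto
      show "integrable lborel (\<lambda>x. F (x + c))"
        using integrable_distr_eq[OF m] iF by (simp add: lborel_distr_plus add.commute)
      show "integral\<^sup>L lborel (\<lambda>x. F (x + c)) = integral\<^sup>L lborel F"
        using integral_distr[OF m] by (simp add: lborel_distr_plus add.commute)
    qed
    show ?thesis unfolding q_def using *[of "s n *\<^sub>R u"] iF by simp
  qed
  ultimately show ?thesis by (simp add: LIMSEQ_const_iff)
qed

subsection \<open>Determinants and change of variables on Euclidean spaces\<close>

text \<open>The library has determinants and the change of variables formula for \<^typ>\<open>real^'n\<close> with a
  well-ordered index type only; indexing by the basis of \<^typ>\<open>'a\<close> makes them available for any
  Euclidean space.\<close>

typedef (overloaded) ('a::euclidean_space) basis_index = "Basis :: 'a set"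
  morphisms bas Abs_basis_index using nonempty_Basis by blast

lemma bas_in_Basis [simp]: "bas i \<in> Basis"
  by (rule bas)

lemma inj_bas: "inj bas"
  by (simp add: bas_inject inj_def)

lemma range_bas: "range bas = Basis"
  by (metis bas_inverse Abs_basis_index_inverse bas_in_Basis rangeI subsetI subset_antisym image_subsetI)

instance basis_index :: (euclidean_space) finite
proof
  have "finite (range (bas :: 'a basis_index \<Rightarrow> 'a))" by (simp add: range_bas)
  then show "finite (UNIV :: 'a basis_index set)" using finite_imageD[OF _ inj_bas] by blast
qed

definition basis_rank :: "'a::euclidean_space basis_index \<Rightarrow> nat" where
  "basis_rank = (SOME f. inj f)"

lemma inj_basis_rank: "inj (basis_rank :: 'a::euclidean_space basis_index \<Rightarrow> nat)"
proof -
  have "\<exists>f :: 'a basis_index \<Rightarrow> nat. inj f"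
    using finite_imp_inj_to_nat_seg[OF finite[of UNIV]] by metis
  then show ?thesis unfolding basis_rank_def by (rule someI_ex)
qed

instantiation basis_index :: (euclidean_space) wellorder
begin

definition less_eq_basis_index :: "'a basis_index \<Rightarrow> 'a basis_index \<Rightarrow> bool" where
  "i \<le> j \<longleftrightarrow> basis_rank i \<le> basis_rank j"

definition less_basis_index :: "'a basis_index \<Rightarrow> 'a basis_index \<Rightarrow> bool" where
  "i < j \<longleftrightarrow> basis_rank i < basis_rank j"

instance
proof
  fix P :: "'a basis_index \<Rightarrow> bool" and i
  assume step: "\<And>i. (\<And>j. j < i \<Longrightarrow> P j) \<Longrightarrow> P i"
  show "P i"
  proof (induction i rule: measure_induct_rule[of basis_rank])
    case (less i)
    show ?case by (rule step) (use less in \<open>simp add: less_basis_index_def\<close>)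
  qed
next
  fix i j :: "'a basis_index"
  show "i \<le> j \<Longrightarrow> j \<le> i \<Longrightarrow> i = j"
    using inj_basis_rank by (auto simp: less_eq_basis_index_def inj_def)
qed (auto simp: less_eq_basis_index_def less_basis_index_def)

end

lemma sum_bas: "(\<Sum>i\<in>UNIV. f (bas i)) = (\<Sum>b\<in>Basis. f b)"
  using sum.reindex[OF inj_bas, of f] by (simp add: range_bas)

lemma prod_bas: "(\<Prod>i\<in>UNIV. f (bas i)) = (\<Prod>b\<in>Basis. f b)"
  using prod.reindex[OF inj_bas, of f] by (simp add: range_bas)

lemma inner_bas: "bas i \<bullet> bas j = (if i = j then 1 else 0)"
  by (simp add: inner_Basis bas_inject)

definition of_vec :: "real ^ 'a::euclidean_space basis_index \<Rightarrow> 'a" where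
  "of_vec z = (\<Sum>i\<in>UNIV. (z $ i) *\<^sub>R bas i)"

definition to_vec :: "'a::euclidean_space \<Rightarrow> real ^ 'a basis_index" where
  "to_vec x = (\<chi> i. x \<bullet> bas i)"

lemma of_vec_inner_bas [simp]: "of_vec z \<bullet> bas i = z $ i"
  by (simp add: of_vec_def inner_sum_left inner_bas if_distrib cong: if_cong)

lemma to_vec_of_vec [simp]: "to_vec (of_vec z) = z"
  by (simp add: to_vec_def)

lemma of_vec_to_vec [simp]: "of_vec (to_vec x) = x"
  using sum_bas[of "\<lambda>b. (x \<bullet> b) *\<^sub>R b"] by (simp add: of_vec_def to_vec_def euclidean_representation)

lemma linear_of_vec: "linear of_vec"
  by (rule linearI) (simp_all add: of_vec_def scaleR_add_left sum.distrib scaleR_sum_right)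

lemma linear_to_vec: "linear to_vec"
  by (rule linearI) (simp_all add: to_vec_def vec_eq_iff inner_add_left)

lemma bounded_linear_of_vec: "bounded_linear of_vec" and bounded_linear_to_vec: "bounded_linear to_vec"
  using linear_of_vec linear_to_vec linear_conv_bounded_linear by blast+

lemma of_vec_axis: "of_vec (axis i 1) = bas i"
  by (simp add: of_vec_def axis_def if_distrib[of "\<lambda>c. c *\<^sub>R _"] cong: if_cong)

lemma measurable_of_vec: "of_vec \<in> measurable lborel borel"
  using borel_measurable_continuous_onI[OF linear_continuous_on[OF bounded_linear_of_vec]] by simp

text \<open>The coordinate map carries boxes to boxes with the same side lengths, and Lebesgue
  measure is determined by its values on boxes.\<close>

lemma lborel_of_vec: "distr lborel borel of_vec = lborel"
proof (rule lborel_eqI[symmetric])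
  fix l u :: 'a
  assume lu: "\<And>b. b \<in> Basis \<Longrightarrow> l \<bullet> b \<le> u \<bullet> b"
  have vim: "of_vec -` box l u = box (to_vec l) (to_vec u)"
  proof -
    have "of_vec z \<in> box l u \<longleftrightarrow> (\<forall>i. l \<bullet> bas i < z $ i \<and> z $ i < u \<bullet> bas i)" for z
      by (simp add: mem_box range_bas[symmetric])
    then show ?thesis by (auto simp: mem_box_cart to_vec_def)
  qed
  have B: "(Basis :: (real ^ 'a basis_index) set) = range (\<lambda>i. axis i 1)"
    by (auto simp: Basis_vec_def)
  have "emeasure lborel (box (to_vec l) (to_vec u)) = (\<Prod>b\<in>Basis. (to_vec u - to_vec l) \<bullet> b)"
    by (rule emeasure_lborel_box) (auto simp: B inner_axis to_vec_def lu)
  also have "(\<Prod>b\<in>Basis. (to_vec u - to_vec l) \<bullet> b) = (\<Prod>i\<in>UNIV. (u - l) \<bullet> bas i)"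
    unfolding B by (subst prod.reindex) (auto simp: inj_def axis_eq_axis inner_axis to_vec_def inner_diff_left)
  also have "\<dots> = (\<Prod>b\<in>Basis. (u - l) \<bullet> b)" by (rule prod_bas)
  finally show "emeasure (distr lborel borel of_vec) (box l u) = (\<Prod>b\<in>Basis. (u - l) \<bullet> b)"
    by (subst emeasure_distr) (use measurable_of_vec in \<open>simp_all add: vim\<close>)
qed simp

lemma integral_of_vec:
  fixes f :: "'a::euclidean_space \<Rightarrow> real"
  assumes "f \<in> borel_measurable borel"
  shows "integral\<^sup>L lborel f = integral\<^sup>L lborel (\<lambda>z. f (of_vec z))"
    and "integrable lborel f \<longleftrightarrow> integrable lborel (\<lambda>z. f (of_vec z))"
proof -
  note m = measurable_of_vec
  show "integral\<^sup>L lborel f = integral\<^sup>L lborel (\<lambda>z. f (of_vec z))"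
    using integral_distr[OF m assms] by (simp add: lborel_of_vec)
  show "integrable lborel f \<longleftrightarrow> integrable lborel (\<lambda>z. f (of_vec z))"
    using integrable_distr_eq[OF m assms] by (simp add: lborel_of_vec)
qed

definition mat_of :: "('a::euclidean_space \<Rightarrow> 'a) \<Rightarrow> real ^ 'a basis_index ^ 'a basis_index" where
  "mat_of f = (\<chi> i j. f (bas j) \<bullet> bas i)"

definition edet :: "('a::euclidean_space \<Rightarrow> 'a) \<Rightarrow> real" where
  "edet f = det (mat_of f)"

lemma matrix_conj: "matrix (to_vec \<circ> f \<circ> of_vec) = mat_of f"
  by (simp add: matrix_def mat_of_def to_vec_def of_vec_axis)

text \<open>The formula for vectors is conjugated by \<open>of_vec\<close>, which preserves the
  measure and turns the Jacobian into \<open>edet\<close>.\<close>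

lemma integral_change_of_variables_eucl:
  fixes f :: "'a::euclidean_space \<Rightarrow> real"
  assumes S: "open S" "open (\<phi> ` S)" and inj: "inj_on \<phi> S"
    and der: "\<And>x. x \<in> S \<Longrightarrow> (\<phi> has_derivative \<phi>' x) (at x)"
    and int: "integrable lborel (\<lambda>y. indicator (\<phi> ` S) y * f y)"
      "(\<lambda>x. indicator S x * (\<bar>edet (\<phi>' x)\<bar> * f (\<phi> x))) \<in> borel_measurable borel"
  shows "integral\<^sup>L lborel (\<lambda>y. indicator (\<phi> ` S) y * f y) =
    integral\<^sup>L lborel (\<lambda>x. indicator S x * (\<bar>edet (\<phi>' x)\<bar> * f (\<phi> x)))"
proof -
  define T where "T = of_vec -` S"
  define g where "g = to_vec \<circ> \<phi> \<circ> of_vec"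
  define g' where "g' z = to_vec \<circ> \<phi>' (of_vec z) \<circ> of_vec" for z
  \<comment> \<open>The library theorem concerns vector-valued integrands, so the scalar integrand
    becomes a vector with one component.\<close>
  define h :: "real ^ 'a basis_index \<Rightarrow> real ^ 1" where "h z = vec (f (of_vec z))" for z
  have openT: "open T" unfolding T_def
    by (rule open_vimage[OF S(1)]) (simp add: linear_continuous_on bounded_linear_of_vec)
  have gT: "g ` T = of_vec -` (\<phi> ` S)"
  proof (intro set_eqI iffI)
    fix z assume "z \<in> of_vec -` (\<phi> ` S)"
    then obtain x where "x \<in> S" "of_vec z = \<phi> x" by auto
    then have "z = g (to_vec x)" "to_vec x \<in> T" by (auto simp: g_def T_def) (metis to_vec_of_vec)
    then show "z \<in> g ` T" by blast
  qed (auto simp: g_def T_def)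
  have opengT: "open (g ` T)" unfolding gT
    by (rule open_vimage[OF S(2)]) (simp add: linear_continuous_on bounded_linear_of_vec)
  have injg: "inj_on g T"
  proof (rule inj_onI)
    fix z w assume zw: "z \<in> T" "w \<in> T" "g z = g w"
    then have "of_vec (to_vec (\<phi> (of_vec z))) = of_vec (to_vec (\<phi> (of_vec w)))" by (simp add: g_def)
    then have "of_vec z = of_vec w" using zw inj by (auto simp: T_def dest: inj_onD)
    then show "z = w" by (metis to_vec_of_vec)
  qed
  have derg: "(g has_derivative g' z) (at z within T)" if "z \<in> T" for z
    unfolding g_def g'_def comp_def
    by (rule has_derivative_at_withinI, rule bounded_linear.has_derivative[OF bounded_linear_to_vec],
        rule has_derivative_compose[OF bounded_linear_imp_has_derivative[OF bounded_linear_of_vec]])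
       (use der that in \<open>simp add: T_def\<close>)
  have det: "det (matrix (g' z)) = edet (\<phi>' (of_vec z))" for z
    unfolding g'_def edet_def matrix_conj ..
  have ind: "indicator (\<phi> ` S) (of_vec z) = indicat_real (g ` T) z" "indicator S (of_vec z) = indicat_real T z" for z
    by (auto simp add: gT indicator_def) (auto simp: T_def)
  have m1: "(\<lambda>y. indicator (\<phi> ` S) y * f y) \<in> borel_measurable borel"
    using int(1) by simp
  have bm: "(\<lambda>z. f' (of_vec z)) \<in> borel_measurable borel" if "f' \<in> borel_measurable borel" for f' :: "'a \<Rightarrow> real"
    using measurable_compose[OF borel_measurable_continuous_onI[OF linear_continuous_on[OF bounded_linear_of_vec]] that] .
  have m1': "(\<lambda>z. indicat_real (g ` T) z * f (of_vec z)) \<in> borel_measurable lborel"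
    using bm[OF m1] by (simp add: ind)
  have m2': "(\<lambda>z. indicat_real T z * (\<bar>det (matrix (g' z))\<bar> * f (of_vec (g z)))) \<in> borel_measurable lborel"
    using bm[OF int(2)] by (simp add: ind det g_def)
  have abs1: "h absolutely_integrable_on (g ` T)"
  proof -
    have "integrable lborel (\<lambda>z. indicat_real (g ` T) z * f (of_vec z))"
      using int(1) integral_of_vec(2)[OF m1] by (simp add: ind)
    then have "(\<lambda>z. h z $ 1) absolutely_integrable_on (g ` T)"
      using integrable_completion[OF m1'] by (simp add: h_def set_integrable_def)
    then show ?thesis by (simp add: absolutely_integrable_on_1_iff)
  qed
  have abs2: "(\<lambda>z. \<bar>det (matrix (g' z))\<bar> *\<^sub>R h (g z)) absolutely_integrable_on T"
    using absolutely_integrable_change_of_variables[OF _ derg injg, of h] abs1 openT by simp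
  have eq: "integral (g ` T) h = integral T (\<lambda>z. \<bar>det (matrix (g' z))\<bar> *\<^sub>R h (g z))"
    by (rule integral_change_of_variables[OF _ derg injg]) (use abs1 openT in auto)
  \<comment> \<open>This passes from the gauge integral to the Lebesgue integral over the completed
    measure and from there to \<open>lborel\<close>. The last passage requires Borel measurability,
    which is why the transformed integrand is assumed measurable.\<close>
  have conv: "integral U k $ 1 = integral\<^sup>L lborel (\<lambda>z. indicat_real U z * (k z $ 1))"
    if "k absolutely_integrable_on U" "(\<lambda>z. indicat_real U z * (k z $ 1)) \<in> borel_measurable lborel"
    for U and k :: "real ^ 'a basis_index \<Rightarrow> real ^ 1"
  proof -
    have a: "(\<lambda>z. k z $ 1) absolutely_integrable_on U" using that(1) absolutely_integrable_on_1_iff by blast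
    have "integral U k $ 1 = integral U (\<lambda>z. k z $ 1)"
      by (simp add: integral_on_1_eq)
    also have "\<dots> = integral\<^sup>L lebesgue (\<lambda>z. indicat_real U z * (k z $ 1))"
      using set_lebesgue_integral_eq_integral(2)[OF a] by (simp add: set_lebesgue_integral_def)
    also have "\<dots> = integral\<^sup>L lborel (\<lambda>z. indicat_real U z * (k z $ 1))"
      using integral_completion[OF that(2)] by simp
    finally show ?thesis .
  qed
  have "integral\<^sup>L lborel (\<lambda>y. indicator (\<phi> ` S) y * f y) = integral\<^sup>L lborel (\<lambda>z. indicat_real (g ` T) z * (h z $ 1))"
    using integral_of_vec(1)[OF m1] by (simp add: ind h_def)
  also have "\<dots> = integral (g ` T) h $ 1"
    by (rule conv[symmetric, OF abs1]) (use m1' in \<open>simp add: h_def\<close>)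
  also have "\<dots> = integral\<^sup>L lborel (\<lambda>z. indicat_real T z * ((\<bar>det (matrix (g' z))\<bar> *\<^sub>R h (g z)) $ 1))"
    unfolding eq by (rule conv[OF abs2]) (use m2' in \<open>simp add: h_def\<close>)
  also have "\<dots> = integral\<^sup>L lborel (\<lambda>x. indicator S x * (\<bar>edet (\<phi>' x)\<bar> * f (\<phi> x)))"
    using integral_of_vec(1)[OF int(2)] by (simp add: ind h_def det g_def)
  finally show ?thesis .
qed

section \<open>Linear and bilinear families applied to moving vectors\<close>

lemma linear_Basis_expand:
  fixes f :: "'a::euclidean_space \<Rightarrow> 'b::real_vector"
  assumes "linear f" shows "f v = (\<Sum>b\<in>Basis. (v \<bullet> b) *\<^sub>R f b)"
proof -
  interpret linear f by (rule assms)
  show ?thesis by (subst euclidean_representation[of v, symmetric]) (simp only: sum scale)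
qed

text \<open>A product rule for coefficients that are known to be differentiable only when applied to
  a fixed vector. Expanding \<open>X\<close> in the basis makes it an instance of the ordinary
  product rule; the first summand differentiates the coefficients with the vector frozen at
  \<open>x\<close>.\<close>

lemma has_derivative_apply_family:
  fixes A :: "'a::euclidean_space \<Rightarrow> 'b::euclidean_space \<Rightarrow> 'c::real_normed_vector"
  assumes S: "open S" "x \<in> S" and lin: "\<And>y. y \<in> S \<Longrightarrow> linear (A y)"
    and dA: "\<And>v. (\<lambda>y. A y v) differentiable (at x)" and dX: "X differentiable (at x)"
  shows "((\<lambda>y. A y (X y)) has_derivative (\<lambda>u. fd (\<lambda>y. A y (X x)) x u + A x (fd X x u))) (at x)"
proof -
  have *: "((\<lambda>y. A y (X y)) has_derivative
      (\<lambda>u. \<Sum>b\<in>Basis. (X x \<bullet> b) *\<^sub>R fd (\<lambda>y. A y b) x u + (fd X x u \<bullet> b) *\<^sub>R A x b)) (at x)"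
    if "X differentiable (at x)" for X
  proof -
    have "((\<lambda>y. \<Sum>b\<in>Basis. (X y \<bullet> b) *\<^sub>R A y b) has_derivative
      (\<lambda>u. \<Sum>b\<in>Basis. (X x \<bullet> b) *\<^sub>R fd (\<lambda>y. A y b) x u + (fd X x u \<bullet> b) *\<^sub>R A x b)) (at x)"
      by (intro has_derivative_sum has_derivative_scaleR has_derivative_inner_left fd_works dA that)
    then show ?thesis
      by (rule has_derivative_transform_within_open[OF _ S]) (simp add: linear_Basis_expand[OF lin, symmetric])
  qed
  have "fd (\<lambda>y. A y (X x)) x u = (\<Sum>b\<in>Basis. (X x \<bullet> b) *\<^sub>R fd (\<lambda>y. A y b) x u)" for u
    using fd_eqI[OF *[of "\<lambda>_. X x"]] by simp
  moreover have "A x (fd X x u) = (\<Sum>b\<in>Basis. (fd X x u \<bullet> b) *\<^sub>R A x b)" for u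
    by (rule linear_Basis_expand[OF lin[OF S(2)]])
  ultimately show ?thesis using *[OF dX] by (simp add: sum.distrib)
qed

lemma Ck_on_apply_family:
  fixes A :: "'a::euclidean_space \<Rightarrow> 'b::euclidean_space \<Rightarrow> 'c::real_normed_vector"
  assumes S: "open S" and lin: "\<And>y. y \<in> S \<Longrightarrow> linear (A y)"
    and "\<And>v. Ck_on k S (\<lambda>y. A y v)" "Ck_on k S X"
  shows "Ck_on k S (\<lambda>y. A y (X y))"
proof -
  have "Ck_on k S (\<lambda>y. \<Sum>b\<in>Basis. (X y \<bullet> b) *\<^sub>R A y b)"
    by (intro Ck_on_sum[OF S] Ck_on_scaleR[OF S] Ck_on_inner[OF S] Ck_on_const[OF S] assms)
  then show ?thesis by (subst Ck_on_cong[OF S linear_Basis_expand[OF lin]])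
qed

lemma has_derivative_apply_family2:
  fixes G :: "'a::euclidean_space \<Rightarrow> 'b::euclidean_space \<Rightarrow> 'c::euclidean_space \<Rightarrow> 'd::real_normed_vector"
  assumes S: "open S" "x \<in> S" and bil: "\<And>y. y \<in> S \<Longrightarrow> bilinear (G y)"
    and dG: "\<And>u v. (\<lambda>y. G y u v) differentiable (at x)"
    and dX: "X differentiable (at x)" and dY: "Y differentiable (at x)"
  shows "((\<lambda>y. G y (X y) (Y y)) has_derivative
    (\<lambda>u. fd (\<lambda>y. G y (X x) (Y x)) x u + G x (fd X x u) (Y x) + G x (X x) (fd Y x u))) (at x)"
proof -
  have l1: "linear (G y w)" and l2: "linear (\<lambda>v. G y v w')" if "y \<in> S" for y w w'
    using bil[OF that] by (simp_all add: bilinear_def)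
  have *: "((\<lambda>y. G y (X y) w) has_derivative
      (\<lambda>u. fd (\<lambda>y. G y (X x) w) x u + G x (fd X x u) w)) (at x)" for w
    by (rule has_derivative_apply_family[OF S l2 dG dX])
  then have "(\<lambda>y. G y (X y) w) differentiable (at x)" for w by (auto simp: differentiable_def)
  from has_derivative_apply_family[OF S l1 this dY]
  show ?thesis unfolding fd_eqI[OF *] .
qed

lemma Ck_on_apply_family2:
  fixes G :: "'a::euclidean_space \<Rightarrow> 'b::euclidean_space \<Rightarrow> 'c::euclidean_space \<Rightarrow> 'd::real_normed_vector"
  assumes S: "open S" and bil: "\<And>y. y \<in> S \<Longrightarrow> bilinear (G y)"
    and "\<And>u v. Ck_on k S (\<lambda>y. G y u v)" "Ck_on k S X" "Ck_on k S Y"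
  shows "Ck_on k S (\<lambda>y. G y (X y) (Y y))"
proof -
  have l1: "linear (G y w)" and l2: "linear (\<lambda>v. G y v w')" if "y \<in> S" for y w w'
    using bil[OF that] by (simp_all add: bilinear_def)
  have *: "Ck_on k S (\<lambda>y. G y (X y) w)" for w
    by (rule Ck_on_apply_family[OF S l2 assms(3,4)])
  show ?thesis by (rule Ck_on_apply_family[where A = "\<lambda>y. G y (X y)", OF S l1 * assms(5)])
qed

section \<open>Traces\<close>

lemma linear_trace_add: "linear_trace (\<lambda>u. f u + g u) = linear_trace f + linear_trace g"
  and linear_trace_diff: "linear_trace (\<lambda>u. f u - g u) = linear_trace f - linear_trace g"
  and linear_trace_scaleR: "linear_trace (\<lambda>u. c *\<^sub>R f u) = c * linear_trace f"
  and linear_trace_id: "linear_trace (\<lambda>u::'a::euclidean_space. u) = DIM('a)"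
  by (simp_all add: linear_trace_def inner_add_left inner_diff_left sum.distrib sum_subtractf sum_distrib_left)

lemma linear_trace_scale_fixed: "linear l \<Longrightarrow> linear_trace (\<lambda>u. l u *\<^sub>R v) = (l v :: real)"
  by (subst linear_Basis_expand[of l v]) (simp_all add: linear_trace_def mult.commute)

lemma linear_trace_commute:
  fixes f g :: "'a::euclidean_space \<Rightarrow> 'a"
  assumes "linear f" "linear g"
  shows "linear_trace (\<lambda>u. f (g u)) = linear_trace (\<lambda>u. g (f u))"
proof -
  have *: "linear_trace (\<lambda>u. f (g u)) = (\<Sum>b\<in>Basis. \<Sum>c\<in>Basis. (g b \<bullet> c) * (f c \<bullet> b))"
    if "linear f" for f g :: "'a \<Rightarrow> 'a"
    unfolding linear_trace_def
    by (subst linear_Basis_expand[OF that]) (simp add: inner_sum_left)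
  show ?thesis
    unfolding *[OF assms(1)] *[OF assms(2)] by (subst sum.swap) (simp add: mult.commute)
qed

subsection \<open>Metrics on open subsets of Euclidean space\<close>

lemma Ck_on_det:
  fixes A :: "'a::euclidean_space \<Rightarrow> real ^ 'n ^ 'n::finite"
  assumes "open S" "\<And>i j. Ck_on k S (\<lambda>x. A x $ i $ j)"
  shows "Ck_on k S (\<lambda>x. det (A x))"
  unfolding det_def by (intro Ck_on_sum Ck_on_mult Ck_on_const Ck_on_prod assms)

section \<open>Gram matrices and the derivative of a determinant\<close>

definition gram :: "('a::euclidean_space \<Rightarrow> 'a \<Rightarrow> real) \<Rightarrow> real ^ 'a basis_index ^ 'a basis_index" where
  "gram B = (\<chi> i j. B (bas i) (bas j))"

lemma linear_bas_expand:
  fixes f :: "'a::euclidean_space \<Rightarrow> 'b::real_vector"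
  assumes "linear f" shows "f v = (\<Sum>i\<in>UNIV. (v \<bullet> bas i) *\<^sub>R f (bas i))"
  unfolding sum_bas[of "\<lambda>b. (v \<bullet> b) *\<^sub>R f b"] by (rule linear_Basis_expand[OF assms])

lemma gram_mult_vec:
  assumes "bilinear B"
  shows "(gram B *v to_vec w) $ i = B (bas i) w"
proof -
  have "linear (B (bas i))" using assms by (simp add: bilinear_def)
  from linear_bas_expand[OF this, of w] show ?thesis
    by (simp add: matrix_vector_mult_def gram_def to_vec_def mult.commute)
qed

lemma gram_compose:
  assumes "bilinear B" "linear T"
  shows "gram (\<lambda>u v. B (T u) (T v)) = transpose (mat_of T) ** gram B ** mat_of T"
proof -
  have l: "linear (B w)" "linear (\<lambda>u. B u w)" for w using assms(1) by (simp_all add: bilinear_def)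
  have "B (T (bas i)) (T (bas j)) = (\<Sum>k\<in>UNIV. \<Sum>m\<in>UNIV. (T (bas i) \<bullet> bas m) * B (bas m) (bas k) * (T (bas j) \<bullet> bas k))" for i j
    by (subst linear_bas_expand[OF l(1)], subst linear_bas_expand[OF l(2)])
       (simp add: sum_distrib_left mult_ac)
  then show ?thesis
    by (simp add: vec_eq_iff gram_def mat_of_def matrix_matrix_mult_def transpose_def sum_distrib_right)
qed

lemma det_gram_compose:
  assumes "bilinear B" "linear T"
  shows "det (gram (\<lambda>u v. B (T u) (T v))) = (edet T)\<^sup>2 * det (gram B)"
  unfolding gram_compose[OF assms] by (simp add: det_mul det_transpose edet_def power2_eq_square)

text \<open>Row \<open>i\<close> of B A is the combination of the rows of A with coefficients from
  row \<open>i\<close> of B. In the expanded determinant every term except the diagonal one has a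
  repeated row. With \<open>has_derivative_det\<close> this is Jacobi's formula for the derivative
  of a determinant.\<close>

lemma det_replace_rows_mult:
  fixes A B :: "real ^ 'n ^ 'n::finite"
  shows "(\<Sum>i\<in>UNIV. det (\<chi> r. if r = i then (B ** A) $ i else A $ r)) = trace B * det A"
proof -
  have "det (\<chi> r. if r = i then (B ** A) $ i else A $ r) = B $ i $ i * det A" for i
  proof -
    have "(B ** A) $ i = (\<Sum>k\<in>UNIV. B $ i $ k *s A $ k)"
      by (simp add: vec_eq_iff matrix_matrix_mult_def sum_component)
    then have "det (\<chi> r. if r = i then (B ** A) $ i else A $ r) =
        (\<Sum>k\<in>UNIV. det (\<chi> r. if r = i then B $ i $ k *s A $ k else A $ r))"
      using det_linear_row_sum[of UNIV i "\<lambda>_ k. B $ i $ k *s A $ k" "\<lambda>r. A $ r"] by (simp cong: if_cong)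
    also have "\<dots> = (\<Sum>k\<in>UNIV. B $ i $ k * det (\<chi> r. if r = i then A $ k else A $ r))"
      by (simp add: det_row_mul)
    also have "\<dots> = (\<Sum>k\<in>UNIV. if k = i then B $ i $ i * det A else 0)"
    proof (rule sum.cong[OF refl])
      fix k
      show "B $ i $ k * det (\<chi> r. if r = i then A $ k else A $ r) = (if k = i then B $ i $ i * det A else 0)"
      proof (cases "k = i")
        case True
        then have "(\<chi> r. if r = i then A $ k else A $ r) = A" by (simp add: vec_eq_iff)
        then show ?thesis using True by simp
      next
        case False
        then have "det (\<chi> r. if r = i then A $ k else A $ r) = 0"
          by (intro det_identical_rows[of k i]) (auto simp: row_def vec_eq_iff)
        then show ?thesis using False by simp
      qed
    qed
    finally show ?thesis by simp
  qed
  then show ?thesis by (simp add: trace_def sum_distrib_right)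
qed

lemma has_derivative_det:
  fixes A :: "'a::euclidean_space \<Rightarrow> real ^ 'n ^ 'n::finite"
  assumes "\<And>i j. ((\<lambda>x. A x $ i $ j) has_derivative (\<lambda>u. A' u $ i $ j)) (at x)"
  shows "((\<lambda>x. det (A x)) has_derivative (\<lambda>u. \<Sum>i\<in>UNIV. det (\<chi> r. if r = i then A' u $ i else A x $ r))) (at x)"
proof -
  have "((\<lambda>x. det (A x)) has_derivative (\<lambda>u. \<Sum>p | p permutes UNIV. of_int (sign p) *
      (\<Sum>i\<in>UNIV. A' u $ i $ p i * (\<Prod>j\<in>UNIV - {i}. A x $ j $ p j)))) (at x)"
    unfolding det_def
    by (intro has_derivative_sum has_derivative_mult_right has_derivative_prod assms)
  also have "(\<lambda>u. \<Sum>p | p permutes UNIV. of_int (sign p) *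
      (\<Sum>i\<in>UNIV. A' u $ i $ p i * (\<Prod>j\<in>UNIV - {i}. A x $ j $ p j))) =
      (\<lambda>u. \<Sum>i\<in>UNIV. det (\<chi> r. if r = i then A' u $ i else A x $ r))"
  proof
    fix u
    have "(\<Prod>r\<in>UNIV. (if r = i then A' u $ i else A x $ r) $ p r) =
        A' u $ i $ p i * (\<Prod>j\<in>UNIV - {i}. A x $ j $ p j)" for i and p :: "'n \<Rightarrow> 'n"
      by (subst prod.remove[of _ i]) (auto intro!: prod.cong)
    then show "(\<Sum>p | p permutes UNIV. of_int (sign p) *
      (\<Sum>i\<in>UNIV. A' u $ i $ p i * (\<Prod>j\<in>UNIV - {i}. A x $ j $ p j))) =
      (\<Sum>i\<in>UNIV. det (\<chi> r. if r = i then A' u $ i else A x $ r))"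
      by (simp add: det_def sum_distrib_left) (rule sum.swap)
  qed
  finally show ?thesis .
qed

text \<open>Only nondegeneracy is assumed, so that the locale covers both the Lorentz metric in a
  chart of the manifold and the induced metric in a chart of the leaf.\<close>

locale metric_domain =
  fixes S :: "'a::euclidean_space set" and G :: "'a \<Rightarrow> 'a \<Rightarrow> 'a \<Rightarrow> real"
  assumes open_S: "open S"
    and bilinear: "x \<in> S \<Longrightarrow> bilinear (G x)"
    and sym: "x \<in> S \<Longrightarrow> G x u v = G x v u"
    and nondegenerate: "x \<in> S \<Longrightarrow> (\<And>z. G x w z = 0) \<Longrightarrow> w = 0"
    and Ck: "Ck_on k S (\<lambda>x. G x u v)"
begin

abbreviation "\<Gamma> \<equiv> christoffel G"

lemma G_linear: "x \<in> S \<Longrightarrow> linear (G x w)" "x \<in> S \<Longrightarrow> linear (\<lambda>v. G x v w)"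
  using bilinear by (simp_all add: bilinear_def)

lemma G_inject: "x \<in> S \<Longrightarrow> (\<And>z. G x w z = G x w' z) \<Longrightarrow> w = w'"
  using nondegenerate[of x "w - w'"] bilinear_lsub[OF bilinear, of x] by simp

lemma differentiable: "x \<in> S \<Longrightarrow> (\<lambda>y. G y u v) differentiable (at x)"
  using Ck[of "Suc 0"] Ck_on_imp_differentiable by blast

definition "DG x u v w = fd (\<lambda>y. G y v w) x u"

lemma DG_linear:
  assumes x: "x \<in> S"
  shows "linear (\<lambda>u. DG x u v w)" "linear (\<lambda>v. DG x u v w)" and DG_sym: "DG x u v w = DG x u w v"
proof -
  show "linear (\<lambda>u. DG x u v w)"
    unfolding DG_def using linear_frechet_derivative[OF differentiable[OF x]] .
  show "DG x u v w = DG x u w v"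
    unfolding DG_def
    using differentiable_cong_open(2)[where g = "\<lambda>y. G y v w", OF open_S x _ differentiable[OF x, of w v]]
    by (simp add: sym)
  have 1: "fd (\<lambda>y. G y (v + v') w) x = (\<lambda>u. fd (\<lambda>y. G y v w) x u + fd (\<lambda>y. G y v' w) x u)" for v v'
  proof (rule fd_eqI)
    have "((\<lambda>y. G y v w + G y v' w) has_derivative (\<lambda>u. fd (\<lambda>y. G y v w) x u + fd (\<lambda>y. G y v' w) x u)) (at x)"
      by (intro has_derivative_add fd_works differentiable x)
    then show "((\<lambda>y. G y (v + v') w) has_derivative (\<lambda>u. fd (\<lambda>y. G y v w) x u + fd (\<lambda>y. G y v' w) x u)) (at x)"
      by (rule has_derivative_transform_within_open[OF _ open_S x]) (simp add: bilinear_ladd[OF bilinear])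
  qed
  have 2: "fd (\<lambda>y. G y (c *\<^sub>R v) w) x = (\<lambda>u. c * fd (\<lambda>y. G y v w) x u)" for c v
  proof (rule fd_eqI)
    have "((\<lambda>y. c * G y v w) has_derivative (\<lambda>u. c * fd (\<lambda>y. G y v w) x u)) (at x)"
      by (intro has_derivative_mult_right fd_works differentiable x)
    then show "((\<lambda>y. G y (c *\<^sub>R v) w) has_derivative (\<lambda>u. c * fd (\<lambda>y. G y v w) x u)) (at x)"
      by (rule has_derivative_transform_within_open[OF _ open_S x]) (simp add: bilinear_lmul[OF bilinear])
  qed
  show "linear (\<lambda>v. DG x u v w)"
    by (rule linearI) (simp_all add: DG_def 1 2)
qed

lemma christoffel_ex1:
  assumes x: "x \<in> S"
  shows "\<exists>!\<Gamma>. bilinear \<Gamma> \<and> (\<forall>u v. \<Gamma> u v = \<Gamma> v u) \<and>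
           (\<forall>u v w. fd (\<lambda>y. G y v w) x u = G x (\<Gamma> u v) w + G x v (\<Gamma> u w))"
  using christoffel_well_defined[of "G x" "DG x"] bilinear[OF x] sym[OF x] nondegenerate[OF x]
    DG_linear[OF x] DG_sym[OF x] unfolding DG_def by blast

lemma christoffel:
  assumes x: "x \<in> S"
  shows christoffel_bilinear: "bilinear (\<Gamma> x)" and christoffel_sym: "\<Gamma> x u v = \<Gamma> x v u"
    and christoffel_metric: "fd (\<lambda>y. G y v w) x u = G x (\<Gamma> x u v) w + G x v (\<Gamma> x u w)"
  using theI'[OF christoffel_ex1[OF x]] unfolding christoffel_def by blast+

lemma christoffel_unique:
  assumes "x \<in> S" "bilinear \<Gamma>'" "\<And>u v. \<Gamma>' u v = \<Gamma>' v u"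
    "\<And>u v w. fd (\<lambda>y. G y v w) x u = G x (\<Gamma>' u v) w + G x v (\<Gamma>' u w)"
  shows "\<Gamma> x = \<Gamma>'"
  unfolding christoffel_def by (rule the1_equality[OF christoffel_ex1]) (use assms in auto)

lemma christoffel_linear: "x \<in> S \<Longrightarrow> linear (\<Gamma> x w)" "x \<in> S \<Longrightarrow> linear (\<lambda>v. \<Gamma> x v w)"
  using christoffel_bilinear by (simp_all add: bilinear_def)

text \<open>In the alternating sum of the three cyclic metric equations all but one pair of terms
  cancels by symmetry. The symbols are thereby expressed through first derivatives of the metric,
  which yields their smoothness and the comparison of the leaf with the ambient space.\<close>

lemma koszul:
  assumes x: "x \<in> S"
  shows "G x (\<Gamma> x u v) z = (DG x u v z + DG x v u z - DG x z u v) / 2"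
  unfolding DG_def christoffel_metric[OF x]
  by (simp add: sym[OF x, of v "\<Gamma> x u z"] christoffel_sym[OF x, of v u]
      christoffel_sym[OF x, of z u] christoffel_sym[OF x, of z v])

lemma gram_det_nonzero:
  assumes x: "x \<in> S" shows "det (gram (G x)) \<noteq> 0"
proof
  assume "det (gram (G x)) = 0"
  then obtain z where z: "z \<noteq> 0" "gram (G x) *v z = 0"
    using det_nz_iff_inj[of "(*v) (gram (G x))"] matrix_vector_mul_linear[of "gram (G x)"]
    by (auto simp: matrix_of_matrix_vector_mul linear_injective_0)
  have "G x (bas i) (of_vec z) = 0" for i
    using gram_mult_vec[OF bilinear[OF x], of "of_vec z" i] z(2) by simp
  then have "G x u (of_vec z) = 0" for u
    by (subst linear_bas_expand[OF G_linear(2)[OF x]]) simp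
  then have "of_vec z = 0" using nondegenerate[OF x] sym[OF x] by simp
  then show False using z(1) by (metis linear_0 linear_to_vec to_vec_of_vec)
qed

lemma Ck_gram: "Ck_on k S (\<lambda>x. gram (G x) $ i $ j)"
  using Ck by (simp add: gram_def)

text \<open>By Cramer's rule, applied to the Koszul formula.\<close>

lemma Ck_christoffel: "Ck_on k S (\<lambda>x. \<Gamma> x u v)"
proof (rule Ck_on_components[OF open_S])
  fix b :: 'a assume "b \<in> Basis"
  then obtain j where b: "b = bas j" using range_bas by blast
  define \<kappa> where "\<kappa> x i = (DG x u v (bas i) + DG x v u (bas i) - DG x (bas i) u v) / 2" for x i
  define M where "M x = (\<chi> i m. if m = j then \<kappa> x i else gram (G x) $ i $ m)" for x
  have C\<kappa>: "Ck_on k S (\<lambda>x. \<kappa> x i)" for i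
    unfolding \<kappa>_def DG_def
    by (intro Ck_on_divide Ck_on_diff Ck_on_add Ck_on_const open_S Ck_on_fd[OF Ck]) auto
  have "Ck_on k S (\<lambda>x. M x $ i $ m)" for i m
    by (cases "m = j") (simp_all add: M_def C\<kappa> Ck_gram)
  then have "Ck_on k S (\<lambda>x. det (M x) / det (gram (G x)))"
    by (intro Ck_on_divide Ck_on_det open_S Ck_gram gram_det_nonzero)
  moreover have "\<Gamma> x u v \<bullet> b = det (M x) / det (gram (G x))" if x: "x \<in> S" for x
  proof -
    have "gram (G x) *v to_vec (\<Gamma> x u v) = (\<chi> i. \<kappa> x i)"
      using koszul[OF x] sym[OF x] by (simp add: vec_eq_iff gram_mult_vec[OF bilinear[OF x]] \<kappa>_def)
    then have "to_vec (\<Gamma> x u v) $ j = det (M x) / det (gram (G x))"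
      unfolding cramer[OF gram_det_nonzero[OF x]] by (simp add: M_def cong: if_cong)
    then show ?thesis by (simp add: to_vec_def b)
  qed
  ultimately show "Ck_on k S (\<lambda>x. \<Gamma> x u v \<bullet> b)"
    using Ck_on_cong[OF open_S, of "\<lambda>x. \<Gamma> x u v \<bullet> b"] by simp
qed

lemma G_derivative:
  assumes "x \<in> S" "X differentiable (at x)" "Y differentiable (at x)"
  shows "((\<lambda>y. G y (X y) (Y y)) has_derivative
    (\<lambda>u. G x (cov_deriv G X x u) (Y x) + G x (X x) (cov_deriv G Y x u))) (at x)"
proof -
  have "((\<lambda>y. G y (X y) (Y y)) has_derivative
    (\<lambda>u. fd (\<lambda>y. G y (X x) (Y x)) x u + G x (fd X x u) (Y x) + G x (X x) (fd Y x u))) (at x)"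
    by (rule has_derivative_apply_family2[OF open_S assms(1) bilinear differentiable assms(2,3)])
       (use assms in auto)
  then show ?thesis
    by (simp add: christoffel_metric[OF assms(1)] cov_deriv_def algebra_simps
         bilinear_ladd[OF bilinear[OF assms(1)]] bilinear_radd[OF bilinear[OF assms(1)]])
qed

lemma Ck_G: "Ck_on k S X \<Longrightarrow> Ck_on k S Y \<Longrightarrow> Ck_on k S (\<lambda>y. G y (X y) (Y y))"
  by (rule Ck_on_apply_family2[OF open_S bilinear Ck])

lemma cov_deriv_linear: "x \<in> S \<Longrightarrow> X differentiable (at x) \<Longrightarrow> linear (cov_deriv G X x)"
  unfolding cov_deriv_def[abs_def]
  by (intro linear_compose_add linear_frechet_derivative christoffel_linear)

lemma Ck_cov_deriv:
  assumes "Ck_on (Suc k) S X" shows "Ck_on k S (\<lambda>y. cov_deriv G X y u)"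
  unfolding cov_deriv_def
  by (intro Ck_on_add open_S Ck_on_fd assms
        Ck_on_apply_family[where A = "\<lambda>y. \<Gamma> y u", OF open_S christoffel_linear(1) Ck_christoffel Ck_on_pred])

end

context metric_domain
begin

text \<open>The term \<open>(tr E) V\<close> cancels the derivative of the trace, so that only the curvature and terms
  algebraic in \<open>E\<close> remain.\<close>

lemma bochner_identity:
  assumes x: "x \<in> S" and V: "Ck_on 2 S V"
  defines "E \<equiv> cov_deriv G V"
  defines "h \<equiv> \<lambda>y. linear_trace (E y)"
  shows "divergence G (\<lambda>y. E y (V y) - h y *\<^sub>R V y) x =
    ricci G x (V x) (V x) + linear_trace (\<lambda>u. E x (E x u)) - (h x)\<^sup>2"
proof -
  have V1: "Ck_on (Suc 0) S V" and V2: "Ck_on (Suc (Suc 0)) S V"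
    using V Ck_on_le[OF V, of 1] by (simp_all add: numeral_2_eq_2)
  have dV: "V differentiable (at y)" if "y \<in> S" for y
    using Ck_on_imp_differentiable[OF V1 that] .
  have CE: "Ck_on (Suc 0) S (\<lambda>y. E y v)" for v
    unfolding E_def by (rule Ck_cov_deriv[OF V2])
  have dE: "(\<lambda>y. E y v) differentiable (at x)" for v
    using Ck_on_imp_differentiable[OF CE x] .
  have d\<Gamma>: "(\<lambda>y. \<Gamma> y u v) differentiable (at x)" for u v
    using Ck_on_imp_differentiable[OF Ck_christoffel[of "Suc 0"] x] .
  have linE: "linear (E y)" if "y \<in> S" for y
    unfolding E_def by (rule cov_deriv_linear[OF that dV[OF that]])
  have linG: "linear (\<Gamma> x w)" for w by (rule christoffel_linear(1)[OF x])
  \<comment> \<open>\<open>T u v\<close> is the covariant derivative of the endomorphism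
    \<open>E\<close> along \<open>u\<close>, applied to \<open>v\<close>, that is, the second
    covariant derivative of \<open>V\<close>.\<close>
  define T where "T u v = fd (\<lambda>y. E y v) x u + \<Gamma> x u (E x v) - E x (\<Gamma> x u v)" for u v
  have fdE: "fd (\<lambda>y. E y v) x u = fd (\<lambda>y. fd V y v) x u + (fd (\<lambda>y. \<Gamma> y v (V x)) x u + \<Gamma> x v (fd V x u))" for u v
  proof -
    have "((\<lambda>y. fd V y v + \<Gamma> y v (V y)) has_derivative
        (\<lambda>u. fd (\<lambda>y. fd V y v) x u + (fd (\<lambda>y. \<Gamma> y v (V x)) x u + \<Gamma> x v (fd V x u)))) (at x)"
    proof (rule has_derivative_add)
      show "((\<lambda>y. fd V y v) has_derivative fd (\<lambda>y. fd V y v) x) (at x)"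
        using Ck_on_fd[OF V2, of v] x by (intro fd_works) auto
      show "((\<lambda>y. \<Gamma> y v (V y)) has_derivative (\<lambda>u. fd (\<lambda>y. \<Gamma> y v (V x)) x u + \<Gamma> x v (fd V x u))) (at x)"
        by (rule has_derivative_apply_family[where A = "\<lambda>y. \<Gamma> y v", OF open_S x christoffel_linear(1) d\<Gamma> dV[OF x]])
    qed
    then show ?thesis unfolding E_def cov_deriv_def by (simp add: fd_eqI)
  qed
  \<comment> \<open>The Ricci identity. Second partial derivatives of \<open>V\<close> cancel by
    their symmetry, and the terms \<Gamma>(u, v) cancel by the symmetry of \<Gamma>.\<close>
  have comm: "T u v - T v u = curvature G x u v (V x)" for u v
  proof -
    have "cov_deriv G (\<lambda>y. cov_deriv G (\<lambda>_. w) y v) x u = fd (\<lambda>y. \<Gamma> y v w) x u + \<Gamma> x u (\<Gamma> x v w)" for u v w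
      by (simp add: cov_deriv_def)
    then have "curvature G x u v (V x) = fd (\<lambda>y. \<Gamma> y v (V x)) x u + \<Gamma> x u (\<Gamma> x v (V x))
        - (fd (\<lambda>y. \<Gamma> y u (V x)) x v + \<Gamma> x v (\<Gamma> x u (V x)))"
      by (simp add: curvature_def)
    moreover have "\<Gamma> x u (E x v) = \<Gamma> x u (fd V x v) + \<Gamma> x u (\<Gamma> x v (V x))" for u v
      by (simp add: E_def cov_deriv_def linear_add[OF linG])
    ultimately show ?thesis
      by (simp add: T_def fdE fd_commute[OF open_S x V, of v u] christoffel_sym[OF x, of v u])
  qed
  have h': "fd h x u = linear_trace (\<lambda>v. fd (\<lambda>y. E y v) x u)" and dh: "h differentiable (at x)" for u
  proof -
    have "(h has_derivative (\<lambda>u. \<Sum>b\<in>Basis. fd (\<lambda>y. E y b) x u \<bullet> b)) (at x)"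
      unfolding h_def linear_trace_def
      by (intro has_derivative_sum has_derivative_inner_left fd_works dE)
    then show "fd h x u = linear_trace (\<lambda>v. fd (\<lambda>y. E y v) x u)" "h differentiable (at x)"
      by (auto simp: fd_eqI linear_trace_def differentiable_def)
  qed
  define W where "W y = E y (V y) - h y *\<^sub>R V y" for y
  have "(W has_derivative (\<lambda>u. (fd (\<lambda>y. E y (V x)) x u + E x (fd V x u))
      - (h x *\<^sub>R fd V x u + fd h x u *\<^sub>R V x))) (at x)"
    unfolding W_def
    by (intro has_derivative_diff has_derivative_scaleR fd_works dh dV x
        has_derivative_apply_family[OF open_S x linE dE])
  then have "cov_deriv G W x u = (fd (\<lambda>y. E y (V x)) x u + E x (fd V x u))
      - (h x *\<^sub>R fd V x u + fd h x u *\<^sub>R V x) + \<Gamma> x u (W x)" for u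
    by (simp add: cov_deriv_def fd_eqI)
  moreover have "E x u = fd V x u + \<Gamma> x u (V x)" for u
    by (simp add: E_def cov_deriv_def)
  then have "E x (fd V x u) = E x (E x u) - E x (\<Gamma> x u (V x))" for u
    by (metis add_diff_cancel_right' linear_diff[OF linE[OF x]])
  ultimately have covW: "cov_deriv G W x u = T u (V x) + E x (E x u) - fd h x u *\<^sub>R V x - h x *\<^sub>R E x u" for u
    by (simp add: T_def W_def linear_diff[OF linG] linear_cmul[OF linG] \<open>\<And>u. E x u = fd V x u + \<Gamma> x u (V x)\<close>[of u]
        scaleR_add_right)
  \<comment> \<open>Exchanging the two arguments of \<open>T\<close> costs a curvature term, whose
    trace is the Ricci curvature.\<close>
  have "linear_trace (\<lambda>u. T u (V x)) = linear_trace (\<lambda>u. curvature G x u (V x) (V x) + T (V x) u)"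
    unfolding comm[symmetric] by simp
  also have "\<dots> = ricci G x (V x) (V x) + linear_trace (T (V x))"
    by (simp add: linear_trace_add ricci_def)
  \<comment> \<open>The trace commutes with covariant differentiation: the two Christoffel terms
    form a commutator, which has trace zero.\<close>
  also have "linear_trace (T (V x)) = fd h x (V x)"
    unfolding T_def using linear_trace_commute[OF linG linE[OF x], of "V x"]
    by (simp add: linear_trace_add linear_trace_diff h')
  finally have "linear_trace (\<lambda>u. T u (V x)) = ricci G x (V x) (V x) + fd h x (V x)" .
  moreover have "linear_trace (\<lambda>u. fd h x u *\<^sub>R V x) = fd h x (V x)"
    by (rule linear_trace_scale_fixed[OF linear_frechet_derivative[OF dh]])
  ultimately have "linear_trace (cov_deriv G W x) = ricci G x (V x) (V x) + linear_trace (\<lambda>u. E x (E x u)) - (h x)\<^sup>2"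
    unfolding covW[abs_def] by (simp add: linear_trace_add linear_trace_diff linear_trace_scaleR h_def power2_eq_square)
  then show ?thesis by (simp add: divergence_def W_def[abs_def])
qed

end

text \<open>Isometries preserve the Levi-Civita connection. The symbols of \<open>G'\<close>, pulled
  back with a correction by the second derivative of \<phi>, satisfy the properties that determine
  the symbols of \<open>G\<close>; uniqueness identifies them, and the correction cancels against
  the derivative of the transformed field.\<close>

lemma cov_deriv_natural:
  fixes S S' :: "'a::euclidean_space set"
  assumes G: "metric_domain S G" and G': "metric_domain S' G'"
    and T: "open T" "T \<subseteq> S" "x \<in> T" and \<phi>: "Ck_on 2 T \<phi>" "\<And>y. y \<in> T \<Longrightarrow> \<phi> y \<in> S'"
    and iso: "\<And>y u v. y \<in> T \<Longrightarrow> G y u v = G' (\<phi> y) (fd \<phi> y u) (fd \<phi> y v)"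
    and V: "\<And>y. y \<in> T \<Longrightarrow> V' (\<phi> y) = fd \<phi> y (V y)"
    and dV: "V differentiable (at x)" "V' differentiable (at (\<phi> x))"
  shows "cov_deriv G' V' (\<phi> x) (fd \<phi> x u) = fd \<phi> x (cov_deriv G V x u)"
proof -
  interpret G: metric_domain S G by fact
  interpret G': metric_domain S' G' by fact
  have xS: "x \<in> S" and xS': "\<phi> x \<in> S'" using T \<phi>(2) by auto
  have C2: "Ck_on (Suc (Suc 0)) T \<phi>" and C1: "Ck_on (Suc 0) T \<phi>"
    using \<phi>(1) Ck_on_le[OF \<phi>(1), of 1] by (simp_all add: numeral_2_eq_2)
  have d\<phi>: "\<phi> differentiable (at y)" if "y \<in> T" for y using Ck_on_imp_differentiable[OF C1 that] .
  have dd\<phi>: "(\<lambda>y. fd \<phi> y v) differentiable (at x)" for v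
    using Ck_on_imp_differentiable[OF Ck_on_fd[OF C2] T(3)] .
  define D where "D = fd \<phi> x"
  define H where "H u v = fd (\<lambda>y. fd \<phi> y v) x u" for u v
  have linD: "linear D" unfolding D_def by (rule linear_frechet_derivative[OF d\<phi>[OF T(3)]])
  have Hsym: "H u v = H v u" for u v
    unfolding H_def by (rule fd_commute[OF T(1,3) \<phi>(1)])
  have linH1: "linear (\<lambda>u. H u v)" for v unfolding H_def by (rule linear_frechet_derivative[OF dd\<phi>])
  have linH2: "linear (H u)" for u
  proof -
    have "H u = (\<lambda>v. H v u)" by (rule ext) (rule Hsym)
    then show ?thesis using linH1 by simp
  qed
  \<comment> \<open>A vector in the kernel of the derivative of an isometry is orthogonal to
    everything.\<close>
  have "inj D"
  proof (rule linear_injective_0[OF linD, THEN iffD2], intro allI impI)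
    fix w assume "D w = 0"
    then have "G x w z = 0" for z
      using iso[OF T(3)] bilinear_lzero[OF G'.bilinear[OF xS']] by (simp add: D_def)
    then show "w = 0" using G.nondegenerate[OF xS] by blast
  qed
  then obtain D' where D': "linear D'" "D' \<circ> D = id" "D \<circ> D' = id"
    using linear_injective_isomorphism[OF linD] by (auto simp: fun_eq_iff)
  then have DD': "D (D' w) = w" "D' (D w) = w" for w by (metis comp_apply id_apply)+
  \<comment> \<open>The transformation law of Christoffel symbols; the inhomogeneous term is the
    Hessian \<open>H\<close> of \<phi>.\<close>
  define \<Gamma> where "\<Gamma> u v = D' (christoffel G' (\<phi> x) (D u) (D v) + H u v)" for u v
  note b' = bilinear_ladd[OF G'.christoffel_bilinear[OF xS']] bilinear_radd[OF G'.christoffel_bilinear[OF xS']]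
    bilinear_lmul[OF G'.christoffel_bilinear[OF xS']] bilinear_rmul[OF G'.christoffel_bilinear[OF xS']]
  have "christoffel G x = \<Gamma>"
  proof (rule G.christoffel_unique[OF xS])
    show "bilinear \<Gamma>"
      unfolding bilinear_def \<Gamma>_def
      by (intro conjI allI linearI)
        (simp_all add: b' linear_add[OF linD] linear_cmul[OF linD] linear_add[OF D'(1)] linear_cmul[OF D'(1)]
          linear_add[OF linH1] linear_cmul[OF linH1] linear_add[OF linH2] linear_cmul[OF linH2] algebra_simps)
    show "\<Gamma> u v = \<Gamma> v u" for u v
      by (simp add: \<Gamma>_def G'.christoffel_sym[OF xS', of "D u"] Hsym[of u])
    fix u v w
    have Gx: "G x a b = G' (\<phi> x) (D a) (D b)" for a b using iso[OF T(3)] by (simp add: D_def)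
    have comp: "((\<lambda>y. G' (\<phi> y) a b) has_derivative (\<lambda>u. fd (\<lambda>z. G' z a b) (\<phi> x) (D u))) (at x)" for a b
      unfolding D_def
      by (rule has_derivative_compose[OF fd_works[OF d\<phi>[OF T(3)]] fd_works[OF G'.differentiable[OF xS']]])
    then have dcomp: "(\<lambda>y. G' (\<phi> y) a b) differentiable (at x)" for a b
      unfolding differentiable_def by blast
    have "((\<lambda>y. G' (\<phi> y) (fd \<phi> y v) (fd \<phi> y w)) has_derivative
       (\<lambda>u. fd (\<lambda>y. G' (\<phi> y) (D v) (D w)) x u + G' (\<phi> x) (H u v) (D w) + G' (\<phi> x) (D v) (H u w))) (at x)"
      unfolding D_def H_def
      by (rule has_derivative_apply_family2[where G = "\<lambda>y. G' (\<phi> y)", OF T(1,3) _ dcomp dd\<phi> dd\<phi>])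
         (use \<phi>(2) G'.bilinear in auto)
    then have "((\<lambda>y. G y v w) has_derivative
       (\<lambda>u. fd (\<lambda>y. G' (\<phi> y) (D v) (D w)) x u + G' (\<phi> x) (H u v) (D w) + G' (\<phi> x) (D v) (H u w))) (at x)"
      by (rule has_derivative_transform_within_open[OF _ T(1,3)]) (simp add: iso)
    then have "fd (\<lambda>y. G y v w) x u = fd (\<lambda>z. G' z (D v) (D w)) (\<phi> x) (D u)
        + G' (\<phi> x) (H u v) (D w) + G' (\<phi> x) (D v) (H u w)"
      by (simp add: fd_eqI fd_eqI[OF comp])
    also have "\<dots> = G x (\<Gamma> u v) w + G x v (\<Gamma> u w)"
      by (simp add: G'.christoffel_metric[OF xS'] Gx \<Gamma>_def DD' bilinear_ladd[OF G'.bilinear[OF xS']]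
          bilinear_radd[OF G'.bilinear[OF xS']])
    finally show "fd (\<lambda>y. G y v w) x u = G x (\<Gamma> u v) w + G x v (\<Gamma> u w)" .
  qed
  then have 1: "D (christoffel G x u (V x)) = christoffel G' (\<phi> x) (D u) (D (V x)) + H u (V x)"
    by (simp add: \<Gamma>_def DD')
  have "((\<lambda>y. fd \<phi> y (V y)) has_derivative (\<lambda>u. H u (V x) + D (fd V x u))) (at x)"
    unfolding H_def D_def
    by (rule has_derivative_apply_family[OF T(1,3) linear_frechet_derivative[OF d\<phi>] dd\<phi> dV(1)])
  then have "((\<lambda>y. V' (\<phi> y)) has_derivative (\<lambda>u. H u (V x) + D (fd V x u))) (at x)"
    by (rule has_derivative_transform_within_open[OF _ T(1,3)]) (simp add: V)
  moreover have "((\<lambda>y. V' (\<phi> y)) has_derivative (\<lambda>u. fd V' (\<phi> x) (D u))) (at x)"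
    unfolding D_def by (rule has_derivative_compose[OF fd_works[OF d\<phi>[OF T(3)]] fd_works[OF dV(2)]])
  ultimately have "(\<lambda>u. H u (V x) + D (fd V x u)) = (\<lambda>u. fd V' (\<phi> x) (D u))"
    by (rule has_derivative_unique)
  then have "fd V' (\<phi> x) (D u) = H u (V x) + D (fd V x u)" by metis
  then show ?thesis
    using 1 by (simp add: cov_deriv_def V[OF T(3)] D_def[symmetric] linear_add[OF linD])
qed

subsection \<open>Positive definite forms\<close>

locale inner_form =
  fixes B :: "'a::euclidean_space \<Rightarrow> 'a \<Rightarrow> real"
  assumes bilinear: "bilinear B" and sym: "B u v = B v u" and pos: "u \<noteq> 0 \<Longrightarrow> B u u > 0"
begin

lemma B_linear: "linear (B w)" "linear (\<lambda>v. B v w)"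
  using bilinear by (simp_all add: bilinear_def)

lemma B_nonneg: "B u u \<ge> 0"
  using pos[of u] bilinear_lzero[OF bilinear, of 0] by (cases "u = 0") auto

text \<open>Gram-Schmidt for \<open>B\<close>. As long as fewer than \<open>DIM('a)\<close> vectors
  are chosen, some vector lies outside their span, and its component orthogonal to them is nonzero
  and can be normalized.\<close>

lemma ex_orthonormal:
  "k \<le> DIM('a) \<Longrightarrow> \<exists>f::nat \<Rightarrow> 'a. \<forall>i<k. \<forall>j<k. B (f i) (f j) = (if i = j then 1 else 0)"
proof (induction k)
  case (Suc k)
  then obtain f :: "nat \<Rightarrow> 'a" where f: "B (f i) (f j) = (if i = j then 1 else 0)" if "i < k" "j < k" for i j
    by auto
  have "dim (span (f ` {..<k})) \<le> k"
    using dim_le_card'[of "f ` {..<k}"] card_image_le[of "{..<k}" f] by (simp add: dim_span)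
  then have "span (f ` {..<k}) \<noteq> UNIV" using Suc.prems dim_UNIV[where 'a = 'a] by (metis Suc_le_lessD not_le)
  then obtain v where v: "v \<notin> span (f ` {..<k})" by blast
  define w where "w = v - (\<Sum>i<k. B v (f i) *\<^sub>R f i)"
  have "w \<noteq> 0"
  proof
    assume "w = 0"
    then have "v = (\<Sum>i<k. B v (f i) *\<^sub>R f i)" by (simp add: w_def)
    also have "\<dots> \<in> span (f ` {..<k})" by (intro span_sum span_scale span_base) auto
    finally show False using v by simp
  qed
  then have Bw: "B w w > 0" by (rule pos)
  have orth: "B w (f j) = 0" if "j < k" for j
  proof -
    have "B (\<Sum>i<k. B v (f i) *\<^sub>R f i) (f j) = (\<Sum>i<k. B v (f i) * B (f i) (f j))"
      by (simp add: linear_sum[OF B_linear(2)] bilinear_lmul[OF bilinear])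
    also have "\<dots> = (\<Sum>i<k. if i = j then B v (f j) else 0)"
      by (rule sum.cong) (use f that in auto)
    also have "\<dots> = B v (f j)" using that by simp
    finally show ?thesis by (simp add: w_def bilinear_lsub[OF bilinear])
  qed
  define c where "c = 1 / sqrt (B w w)"
  have c: "c * (c * B w w) = 1" using Bw by (simp add: c_def field_simps)
  have "B ((f(k := c *\<^sub>R w)) i) ((f(k := c *\<^sub>R w)) j) = (if i = j then 1 else 0)"
    if "i < Suc k" "j < Suc k" for i j
    using that f orth sym[of "f i" w] c
    by (auto simp: less_Suc_eq bilinear_lmul[OF bilinear] bilinear_rmul[OF bilinear])
  then show ?case by blast
qed simp

lemma orthonormal_frame: "\<exists>T :: 'a \<Rightarrow> 'a. linear T \<and> (\<forall>u v. B (T u) (T v) = u \<bullet> v)"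
proof -
  obtain f :: "nat \<Rightarrow> 'a" where f: "B (f i) (f j) = (if i = j then 1 else 0)" if "i < DIM('a)" "j < DIM('a)" for i j
    using ex_orthonormal[of "DIM('a)"] by auto
  obtain e :: "'a \<Rightarrow> nat" where e: "bij_betw e Basis {0..<DIM('a)}"
    using ex_bij_betw_finite_nat[OF finite_Basis] by blast
  have lt: "e b < DIM('a)" if "b \<in> Basis" for b using e that by (auto simp: bij_betw_def)
  have inj: "e b = e c \<longleftrightarrow> b = c" if "b \<in> Basis" "c \<in> Basis" for b c
    using e that by (auto simp: bij_betw_def inj_on_def)
  define T where "T u = (\<Sum>b\<in>Basis. (u \<bullet> b) *\<^sub>R f (e b))" for u
  have "B (T u) (T v) = u \<bullet> v" for u v
  proof -
    have "B (T u) (T v) = (\<Sum>b\<in>Basis. \<Sum>c\<in>Basis. (u \<bullet> b) * ((v \<bullet> c) * B (f (e b)) (f (e c))))"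
      by (simp add: T_def linear_sum[OF B_linear(1)] linear_sum[OF B_linear(2)] bilinear_lmul[OF bilinear]
          bilinear_rmul[OF bilinear] sum_distrib_left)
        (subst sum.swap, simp add: mult_ac)
    also have "\<dots> = (\<Sum>b\<in>Basis. \<Sum>c\<in>Basis. if b = c then (u \<bullet> b) * (v \<bullet> b) else 0)"
      by (intro sum.cong refl) (simp add: f lt inj)
    also have "\<dots> = u \<bullet> v" by (simp add: euclidean_inner[of u v])
    finally show ?thesis .
  qed
  moreover have "linear T"
    by (rule linearI) (simp_all add: T_def inner_add_left scaleR_add_left sum.distrib scaleR_sum_right)
  ultimately show ?thesis by blast
qed

text \<open>In an orthonormal frame the Gram matrix is the identity, so the determinant times a
  square equals 1.\<close>

lemma det_gram_pos: "det (gram B) > 0"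
proof -
  obtain T :: "'a \<Rightarrow> 'a" where T: "linear T" "\<And>u v. B (T u) (T v) = u \<bullet> v" using orthonormal_frame by blast
  have "gram (\<lambda>u v. B (T u) (T v)) = mat 1"
    by (simp add: gram_def T(2) inner_bas mat_def vec_eq_iff)
  then have "(edet T)\<^sup>2 * det (gram B) = 1"
    using det_gram_compose[OF bilinear T(1)] by simp
  then show ?thesis
    using mult_nonneg_nonpos[of "(edet T)\<^sup>2" "det (gram B)"] by (cases "det (gram B) > 0") auto
qed

text \<open>Computed in a \<open>B\<close>-orthonormal frame, the trace of P^2 is the sum of the
  squared lengths of the images of the frame vectors.\<close>

lemma trace_square_selfadjoint:
  assumes P: "linear P" "\<And>u v. B (P u) v = B u (P v)"
  shows "linear_trace (\<lambda>u. P (P u)) \<ge> 0"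
    and "linear_trace (\<lambda>u. P (P u)) = 0 \<Longrightarrow> P u = 0"
proof -
  obtain T :: "'a \<Rightarrow> 'a" where T: "linear T" "\<And>u v. B (T u) (T v) = u \<bullet> v" using orthonormal_frame by blast
  have "inj T"
  proof (rule linear_injective_0[OF T(1), THEN iffD2], intro allI impI)
    fix u assume "T u = 0"
    then have "u \<bullet> u = 0" using T(2)[of u u] bilinear_lzero[OF bilinear] by simp
    then show "u = 0" by simp
  qed
  then obtain T' where T': "linear T'" "T' \<circ> T = id" "T \<circ> T' = id"
    using linear_injective_isomorphism[OF T(1)] by (auto simp: fun_eq_iff)
  then have TT': "T (T' w) = w" "T' (T w) = w" for w by (metis comp_apply id_apply)+
  have "linear (\<lambda>u. P (P (T u)))"
    using linear_compose[OF linear_compose[OF T(1) P(1)] P(1)] by (simp add: o_def)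
  from linear_trace_commute[OF this T'(1)]
  have "linear_trace (\<lambda>u. P (P u)) = linear_trace (\<lambda>u. T' (P (P (T u))))" by (simp add: TT')
  also have "\<dots> = (\<Sum>b\<in>Basis. B (P (T b)) (P (T b)))"
  proof -
    have "T' w \<bullet> v = B w (T v)" for w v using T(2)[of "T' w" v] TT' by simp
    then show ?thesis by (simp add: linear_trace_def P(2))
  qed
  finally have tr: "linear_trace (\<lambda>u. P (P u)) = (\<Sum>b\<in>Basis. B (P (T b)) (P (T b)))" .
  then show "linear_trace (\<lambda>u. P (P u)) \<ge> 0" by (simp add: sum_nonneg B_nonneg)
  assume "linear_trace (\<lambda>u. P (P u)) = 0"
  then have "\<forall>b\<in>Basis. B (P (T b)) (P (T b)) = 0"
    using sum_nonneg_eq_0_iff[of Basis "\<lambda>b. B (P (T b)) (P (T b))"] B_nonneg tr by simp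
  then have "P (T b) = 0" if "b \<in> Basis" for b using pos that by force
  moreover have "linear (\<lambda>u. P (T u))"
    using linear_compose[OF T(1) P(1)] by (simp add: o_def)
  ultimately have "P (T v) = 0" for v using linear_Basis_expand[of "\<lambda>u. P (T u)" v] by simp
  then show "P u = 0" using TT'(1) by metis
qed

text \<open>The defect in this inequality is the trace of the square of the trace-free part P = E -
  (tr E / n) I. It is nonnegative and vanishes only for P = 0, which gives the equality case as
  well.\<close>

lemma selfadjoint_trace_inequality:
  assumes E: "linear E" "\<And>u v. B (E u) v = B u (E v)"
  shows "linear_trace (\<lambda>u. E (E u)) \<ge> (linear_trace E)\<^sup>2 / DIM('a)"
    and "linear_trace (\<lambda>u. E (E u)) = (linear_trace E)\<^sup>2 / DIM('a) \<Longrightarrow> E u = (linear_trace E / DIM('a)) *\<^sub>R u"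
proof -
  define c where "c = linear_trace E / DIM('a)"
  define P where "P u = E u - c *\<^sub>R u" for u
  have P: "linear P" "B (P u) v = B u (P v)" for u v
  proof -
    show "linear P" unfolding P_def using linear_compose_sub[OF E(1) linear_scale_self[of c]] by simp
    show "B (P u) v = B u (P v)"
      by (simp add: P_def bilinear_lsub[OF bilinear] bilinear_rsub[OF bilinear] E(2)
          bilinear_lmul[OF bilinear] bilinear_rmul[OF bilinear])
  qed
  have "P (P u) = E (E u) - c *\<^sub>R E u - c *\<^sub>R E u + (c * c) *\<^sub>R u" for u
    by (simp add: P_def linear_diff[OF E(1)] linear_cmul[OF E(1)] algebra_simps)
  then have "linear_trace (\<lambda>u. P (P u)) = linear_trace (\<lambda>u. E (E u)) - 2 * c * linear_trace E + c * c * DIM('a)"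
    by (simp add: linear_trace_add linear_trace_diff linear_trace_scaleR linear_trace_id)
  also have "\<dots> = linear_trace (\<lambda>u. E (E u)) - (linear_trace E)\<^sup>2 / DIM('a)"
    by (simp add: c_def power2_eq_square field_simps)
  finally have tr: "linear_trace (\<lambda>u. P (P u)) = linear_trace (\<lambda>u. E (E u)) - (linear_trace E)\<^sup>2 / DIM('a)" .
  show "linear_trace (\<lambda>u. E (E u)) \<ge> (linear_trace E)\<^sup>2 / DIM('a)"
    using trace_square_selfadjoint(1)[OF P] tr by simp
  assume "linear_trace (\<lambda>u. E (E u)) = (linear_trace E)\<^sup>2 / DIM('a)"
  then have "P u = 0" using trace_square_selfadjoint(2)[OF P] tr by simp
  then show "E u = (linear_trace E / DIM('a)) *\<^sub>R u" by (simp add: P_def c_def)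
qed

end

subsection \<open>Volume density\<close>

definition volume_density :: "('a::euclidean_space \<Rightarrow> 'a \<Rightarrow> 'a \<Rightarrow> real) \<Rightarrow> 'a \<Rightarrow> real" where
  "volume_density G x = sqrt (det (gram (G x)))"

locale riemannian_domain = metric_domain +
  assumes pos: "x \<in> S \<Longrightarrow> u \<noteq> 0 \<Longrightarrow> G x u u > 0"
begin

lemma inner_form: "x \<in> S \<Longrightarrow> inner_form (G x)"
  by unfold_locales (use bilinear sym pos in auto)

lemma det_gram_pos: "x \<in> S \<Longrightarrow> det (gram (G x)) > 0"
  using inner_form.det_gram_pos inner_form by blast

lemma density_pos: "x \<in> S \<Longrightarrow> volume_density G x > 0"
  using det_gram_pos by (simp add: volume_density_def)

lemma Ck_density: "Ck_on k S (volume_density G)"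
  unfolding volume_density_def[abs_def] by (intro Ck_on_sqrt Ck_on_det Ck_gram open_S det_gram_pos)

text \<open>Metric compatibility writes the derivative of the Gram matrix \<open>A\<close> as M^T A
  + A M, where M is the matrix of \<Gamma>(u, -). Jacobi's formula gives 2 tr M as the logarithmic
  derivative of det A, and the square root removes the factor 2.\<close>

lemma density_derivative:
  assumes x: "x \<in> S"
  shows "(volume_density G has_derivative (\<lambda>u. volume_density G x * linear_trace (\<Gamma> x u))) (at x)"
proof -
  define A where "A = gram (G x)"
  define M where "M u = mat_of (\<Gamma> x u)" for u
  define A' where "A' u = (\<chi> i j. fd (\<lambda>y. G y (bas i) (bas j)) x u)" for u
  have inv: "invertible A" unfolding A_def invertible_det_nz by (rule gram_det_nonzero[OF x])
  then obtain Ai where Ai: "A ** Ai = mat 1" "Ai ** A = mat 1" unfolding invertible_def by blast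
  have A'_eq: "A' u = transpose (M u) ** A + A ** M u" for u
  proof -
    have "G x (\<Gamma> x u (bas i)) (bas j) = (\<Sum>k\<in>UNIV. (\<Gamma> x u (bas i) \<bullet> bas k) * G x (bas k) (bas j))" for i j
      by (subst linear_bas_expand[OF G_linear(2)[OF x]]) simp
    moreover have "G x (bas i) (\<Gamma> x u (bas j)) = (\<Sum>k\<in>UNIV. G x (bas i) (bas k) * (\<Gamma> x u (bas j) \<bullet> bas k))" for i j
      by (subst linear_bas_expand[OF G_linear(1)[OF x]]) (simp add: mult.commute)
    ultimately show ?thesis
      by (simp add: A'_def A_def M_def vec_eq_iff christoffel_metric[OF x] matrix_matrix_mult_def
          transpose_def mat_of_def gram_def)
  qed
  have "((\<lambda>y. det (gram (G y))) has_derivative (\<lambda>u. \<Sum>i\<in>UNIV. det (\<chi> r. if r = i then A' u $ i else gram (G x) $ r))) (at x)"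
    by (rule has_derivative_det) (simp add: gram_def A'_def fd_works[OF differentiable[OF x]])
  moreover have "(\<Sum>i\<in>UNIV. det (\<chi> r. if r = i then A' u $ i else gram (G x) $ r)) = 2 * linear_trace (\<Gamma> x u) * det A" for u
  proof -
    have "(transpose (M u) + A ** M u ** Ai) ** A = transpose (M u) ** A + A ** M u ** Ai ** A"
      by (simp add: matrix_matrix_mult_def vec_eq_iff sum.distrib distrib_right)
    then have A': "A' u = (transpose (M u) + A ** M u ** Ai) ** A"
      by (simp add: A'_eq matrix_mul_assoc[symmetric] Ai)
    have "trace (transpose (M u) + A ** M u ** Ai) = trace (M u) + trace (A ** (M u ** Ai))"
      by (simp add: trace_def transpose_def sum.distrib matrix_mul_assoc)
    also have "trace (A ** (M u ** Ai)) = trace (M u)"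
      by (subst trace_mul_sym) (simp add: matrix_mul_assoc[symmetric] Ai)
    also have "trace (M u) = linear_trace (\<Gamma> x u)"
      using sum_bas[of "\<lambda>b. \<Gamma> x u b \<bullet> b"] by (simp add: trace_def M_def mat_of_def linear_trace_def)
    finally show ?thesis
      using det_replace_rows_mult[of "transpose (M u) + A ** M u ** Ai" A] by (simp only: A'[symmetric] A_def[symmetric] mult_2)
  qed
  ultimately have der: "((\<lambda>y. det (gram (G y))) has_derivative (\<lambda>u. 2 * linear_trace (\<Gamma> x u) * det A)) (at x)"
    by simp
  have pos: "det A > 0" using det_gram_pos[OF x] by (simp add: A_def)
  have "inverse s / 2 * (2 * t * (s * s)) = s * t" if "s > 0" for s t :: real
    using that by (simp add: field_simps)
  from this[of "sqrt (det A)"]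
  have *: "inverse (sqrt (det (gram (G x)))) / 2 * (2 * t * det A) = sqrt (det (gram (G x))) * t" for t
    using pos by (simp add: A_def)
  show ?thesis
    using has_derivative_compose[OF der DERIV_real_sqrt[OF det_gram_pos[OF x], unfolded has_field_derivative_def]]
    unfolding volume_density_def[abs_def] * .
qed

text \<open>This is the classical coordinate formula for the divergence. The derivative of the
  density contributes the trace of \<Gamma>(W, -), which by the symmetry of \<Gamma> is the
  zeroth-order part of the divergence.\<close>

lemma divergence_density:
  assumes x: "x \<in> S" and W: "W differentiable (at x)"
  shows "(\<Sum>b\<in>Basis. fd (\<lambda>y. volume_density G y * (W y \<bullet> b)) x b) = volume_density G x * divergence G W x"
proof -
  have "fd (\<lambda>y. volume_density G y * (W y \<bullet> b)) x u =
      volume_density G x * (fd W x u \<bullet> b) + volume_density G x * linear_trace (\<Gamma> x u) * (W x \<bullet> b)" for b u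
    using fd_eqI[OF has_derivative_mult[OF density_derivative[OF x] has_derivative_inner_left[OF fd_works[OF W], of b]]]
    by simp
  then have "(\<Sum>b\<in>Basis. fd (\<lambda>y. volume_density G y * (W y \<bullet> b)) x b) =
      volume_density G x * (linear_trace (fd W x) + (\<Sum>b\<in>Basis. linear_trace (\<Gamma> x b) * (W x \<bullet> b)))"
    by (simp add: sum.distrib sum_distrib_left linear_trace_def algebra_simps)
  also have "(\<Sum>b\<in>Basis. linear_trace (\<Gamma> x b) * (W x \<bullet> b)) = linear_trace (\<Gamma> x (W x))"
  proof -
    have "linear (\<lambda>v. linear_trace (\<Gamma> x v))"
    proof (rule linearI)
      fix v w and c :: real
      have "\<Gamma> x (v + w) = (\<lambda>u. \<Gamma> x v u + \<Gamma> x w u)" "\<Gamma> x (c *\<^sub>R v) = (\<lambda>u. c *\<^sub>R \<Gamma> x v u)"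
        using christoffel_bilinear[OF x] by (auto simp: bilinear_ladd bilinear_lmul)
      then show "linear_trace (\<Gamma> x (v + w)) = linear_trace (\<Gamma> x v) + linear_trace (\<Gamma> x w)"
        "linear_trace (\<Gamma> x (c *\<^sub>R v)) = c *\<^sub>R linear_trace (\<Gamma> x v)"
        by (simp_all add: linear_trace_add linear_trace_scaleR)
    qed
    from linear_Basis_expand[OF this, of "W x"] show ?thesis by (simp add: mult.commute)
  qed
  also have "linear_trace (fd W x) + linear_trace (\<Gamma> x (W x)) = divergence G W x"
    unfolding divergence_def cov_deriv_def[abs_def] christoffel_sym[OF x, of "W x"] by (simp add: linear_trace_add)
  finally show ?thesis .
qed

end

lemma density_natural:
  assumes "riemannian_domain S G" "riemannian_domain S' G'" "x \<in> S" "y \<in> S'" "linear D"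
    "\<And>u v. G x u v = G' y (D u) (D v)"
  shows "volume_density G x = volume_density G' y * \<bar>edet D\<bar>"
proof -
  interpret G': riemannian_domain S' G' by fact
  have "gram (G x) = gram (\<lambda>u v. G' y (D u) (D v))" using assms(6) by (simp add: gram_def)
  then have "det (gram (G x)) = (edet D)\<^sup>2 * det (gram (G' y))"
    using det_gram_compose[OF G'.bilinear[OF assms(4)] assms(5)] by simp
  then show ?thesis by (simp add: volume_density_def real_sqrt_mult mult.commute)
qed

subsection \<open>The divergence theorem on a compact set covered by charts\<close>

text \<open>\<open>U\<close> and the complement of \<open>K\<close> are open and cover the space,
  and on the latter the extension is zero.\<close>

lemma Ck_on_extend_by_0:
  assumes "open U" "compact K" "K \<subseteq> U" "Ck_on k U F" "\<And>x. x \<in> U \<Longrightarrow> x \<notin> K \<Longrightarrow> F x = 0"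
  shows "Ck_on k UNIV (\<lambda>x. if x \<in> U then F x else 0)"
proof (rule Ck_on_local)
  fix x
  have "Ck_on k U (\<lambda>x. if x \<in> U then F x else 0)"
    using assms(4) by (subst Ck_on_cong[OF assms(1), of _ F]) auto
  moreover have K: "open (- K)" using assms(2) compact_imp_closed by blast
  then have "Ck_on k (- K) (\<lambda>x. if x \<in> U then F x else 0)"
    using assms(5) by (subst Ck_on_cong[of _ _ "\<lambda>_. 0"]) (auto intro: Ck_on_const)
  ultimately show "\<exists>T. open T \<and> x \<in> T \<and> Ck_on k T (\<lambda>x. if x \<in> U then F x else 0)"
    using assms(1,3) K by (cases "x \<in> K") blast+
qed

text \<open>The set where \<open>F\<close> is nonzero is an open null set, hence empty.\<close>

lemma nonneg_continuous_integral_0: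
  fixes F :: "'a::euclidean_space \<Rightarrow> real"
  assumes "continuous_on UNIV F" "\<And>x. F x \<ge> 0" "integrable lborel F" "integral\<^sup>L lborel F = 0"
  shows "F x = 0"
proof -
  have "AE x in lborel. F x = 0"
    using integral_nonneg_eq_0_iff_AE[OF assms(3)] assms(2,4) by simp
  moreover have op: "open {x. F x \<noteq> 0}"
    by (rule open_Collect_neq[OF assms(1) continuous_on_const])
  ultimately have "{x. F x \<noteq> 0} \<in> null_sets lborel"
    by (subst AE_iff_null_sets) auto
  then have "negligible {x. F x \<noteq> 0}"
    by (simp add: negligible_iff_null_sets null_sets_completionI)
  then show ?thesis using open_not_negligible[OF op] by blast
qed

text \<open>The manifold is the union of the images of the parametrizations \<open>h i\<close>, with transition maps
  \<open>\<phi> i j\<close>, a volume density \<open>w\<close> and a vector field \<open>W\<close>. That the divergence of \<open>W\<close> is a function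
  on the manifold is not needed: since its sign is known in each chart, it suffices that its integrals,
  weighted by a partition of unity, add up to zero.\<close>

locale compact_atlas =
  fixes I :: "'i set" and U :: "'i \<Rightarrow> 'a::euclidean_space set" and h :: "'i \<Rightarrow> 'a \<Rightarrow> 'm::t2_space"
    and c :: "'i \<Rightarrow> 'a" and r :: "'i \<Rightarrow> real"
    and \<phi> :: "'i \<Rightarrow> 'i \<Rightarrow> 'a \<Rightarrow> 'a"
    and w :: "'i \<Rightarrow> 'a \<Rightarrow> real" and W :: "'i \<Rightarrow> 'a \<Rightarrow> 'a"
  assumes finite_I: "finite I"
    and open_U: "i \<in> I \<Longrightarrow> open (U i)"
    and inj_h: "i \<in> I \<Longrightarrow> inj_on (h i) (U i)"
    and cont_h: "i \<in> I \<Longrightarrow> continuous_on (U i) (h i)"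
    and r_pos: "i \<in> I \<Longrightarrow> r i > 0"
    and cball_sub: "i \<in> I \<Longrightarrow> cball (c i) (r i) \<subseteq> U i"
    and cover: "i \<in> I \<Longrightarrow> x \<in> U i \<Longrightarrow> \<exists>j\<in>I. h i x \<in> h j ` ball (c j) (r j)"
    and open_overlap: "i \<in> I \<Longrightarrow> j \<in> I \<Longrightarrow> open {x \<in> U i. h i x \<in> h j ` U j}"
    and trans: "i \<in> I \<Longrightarrow> j \<in> I \<Longrightarrow> x \<in> U i \<Longrightarrow> h i x \<in> h j ` U j \<Longrightarrow> \<phi> i j x \<in> U j \<and> h j (\<phi> i j x) = h i x"
    and Ck_trans: "i \<in> I \<Longrightarrow> j \<in> I \<Longrightarrow> Ck_on 1 {x \<in> U i. h i x \<in> h j ` U j} (\<phi> i j)"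
    and w_pos: "i \<in> I \<Longrightarrow> x \<in> U i \<Longrightarrow> w i x > 0"
    and Ck_w: "i \<in> I \<Longrightarrow> Ck_on 1 (U i) (w i)"
    and w_trans: "i \<in> I \<Longrightarrow> j \<in> I \<Longrightarrow> x \<in> U i \<Longrightarrow> h i x \<in> h j ` U j \<Longrightarrow>
      w i x = w j (\<phi> i j x) * \<bar>edet (fd (\<phi> i j) x)\<bar>"
    and Ck_W: "i \<in> I \<Longrightarrow> Ck_on 1 (U i) (W i)"
    and W_trans: "i \<in> I \<Longrightarrow> j \<in> I \<Longrightarrow> x \<in> U i \<Longrightarrow> h i x \<in> h j ` U j \<Longrightarrow>
      W j (\<phi> i j x) = fd (\<phi> i j) x (W i x)"
begin

definition "overlap i j = {x \<in> U i. h i x \<in> h j ` U j}"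

definition \<beta> :: "'i \<Rightarrow> 'a \<Rightarrow> real" where
  "\<beta> i = (SOME f. (\<forall>k. Ck_on k UNIV f) \<and> (\<forall>x. f x \<ge> 0) \<and> (\<forall>x. f x > 0 \<longleftrightarrow> dist (c i) x < r i))"

lemma \<beta>:
  assumes "i \<in> I"
  shows "Ck_on k UNIV (\<beta> i)" "\<beta> i x \<ge> 0" "\<beta> i x > 0 \<longleftrightarrow> x \<in> ball (c i) (r i)"
proof -
  have "\<exists>f::'a \<Rightarrow> real. (\<forall>k. Ck_on k UNIV f) \<and> (\<forall>x. f x \<ge> 0) \<and> (\<forall>x. f x > 0 \<longleftrightarrow> dist (c i) x < r i)"
    using smooth_bump_exists[OF r_pos[OF assms], of "c i"] by metis
  from someI_ex[OF this, folded \<beta>_def]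
  show "Ck_on k UNIV (\<beta> i)" "\<beta> i x \<ge> 0" "\<beta> i x > 0 \<longleftrightarrow> x \<in> ball (c i) (r i)" by auto
qed

definition "\<psi> i p = (if p \<in> h i ` U i then \<beta> i (inv_into (U i) (h i) p) else 0)"

lemma \<psi>_h: "i \<in> I \<Longrightarrow> x \<in> U i \<Longrightarrow> \<psi> i (h i x) = \<beta> i x"
  by (simp add: \<psi>_def inv_into_f_f inj_h)

lemma \<psi>_nonneg: "i \<in> I \<Longrightarrow> \<psi> i p \<ge> 0"
  by (simp add: \<psi>_def \<beta>)

lemma \<psi>_pos: "i \<in> I \<Longrightarrow> \<psi> i p > 0 \<longleftrightarrow> p \<in> h i ` ball (c i) (r i)"
proof
  assume i: "i \<in> I" and "p \<in> h i ` ball (c i) (r i)"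
  then obtain x where x: "x \<in> ball (c i) (r i)" "p = h i x" by auto
  then have "x \<in> U i" using cball_sub[OF i] by auto
  then show "\<psi> i p > 0" using x i \<psi>_h \<beta>(3) by simp
next
  assume i: "i \<in> I" and "\<psi> i p > 0"
  then obtain x where "x \<in> U i" "p = h i x" by (auto simp: \<psi>_def split: if_splits)
  then show "p \<in> h i ` ball (c i) (r i)" using \<open>\<psi> i p > 0\<close> \<psi>_h[OF i] \<beta>(3)[OF i] by auto
qed

text \<open>The Hausdorff property enters here: the image of a closed ball is compact, therefore
  closed. On these sets the bump functions vanish in a whole neighborhood of each point.\<close>

lemma open_outside:
  assumes "i \<in> I" "j \<in> I"
  shows "open {y \<in> U j. h j y \<notin> h i ` cball (c i) (r i)}"
proof -
  have "compact (h i ` cball (c i) (r i))"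
    by (rule compact_continuous_image[OF continuous_on_subset[OF cont_h cball_sub]]) (use assms in auto)
  then have "open (- (h i ` cball (c i) (r i)))" using compact_imp_closed by blast
  then have "open (U j \<inter> h j -` (- (h i ` cball (c i) (r i))))"
    using continuous_open_preimage[OF cont_h[OF assms(2)] open_U[OF assms(2)]] by blast
  then show ?thesis by (simp add: Int_def vimage_def)
qed

lemma \<psi>_zero: "i \<in> I \<Longrightarrow> p \<notin> h i ` cball (c i) (r i) \<Longrightarrow> \<psi> i p = 0"
  using \<psi>_pos[of i p] \<psi>_nonneg[of i p] ball_subset_cball[of "c i" "r i"] by force

text \<open>Around a point in the image of the closed ball, \<psi> is the Euclidean bump composed
  with a transition map. Around any other point it is zero. These neighborhoods cover the chart,
  also where it leaves the domain of chart \<open>i\<close>.\<close>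

lemma Ck_\<psi>:
  assumes i: "i \<in> I" and j: "j \<in> I"
  shows "Ck_on 1 (U j) (\<lambda>x. \<psi> i (h j x))"
proof (rule Ck_on_local)
  fix x assume x: "x \<in> U j"
  show "\<exists>T. open T \<and> x \<in> T \<and> Ck_on 1 T (\<lambda>x. \<psi> i (h j x))"
  proof (cases "h j x \<in> h i ` cball (c i) (r i)")
    case True
    let ?T = "{x \<in> U j. h j x \<in> h i ` U i}"
    have T: "open ?T" by (rule open_overlap[OF j i])
    have "Ck_on 1 ?T (\<lambda>x. \<beta> i (\<phi> j i x))"
      by (rule Ck_on_compose[OF T open_UNIV Ck_trans[OF j i] \<beta>(1)[OF i]]) auto
    moreover have "\<beta> i (\<phi> j i y) = \<psi> i (h j y)" if "y \<in> ?T" for y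
      using trans[OF j i, of y] that \<psi>_h[OF i, of "\<phi> j i y"] by simp
    ultimately have "Ck_on 1 ?T (\<lambda>x. \<psi> i (h j x))"
      by (rule iffD1[OF Ck_on_cong[OF T], rotated])
    moreover have "x \<in> ?T" using x True cball_sub[OF i] by auto
    ultimately show ?thesis using T by blast
  next
    case False
    let ?T = "{y \<in> U j. h j y \<notin> h i ` cball (c i) (r i)}"
    have T: "open ?T" by (rule open_outside[OF i j])
    have "Ck_on 1 ?T (\<lambda>x. \<psi> i (h j x))"
      using Ck_on_cong[OF T, of "\<lambda>x. \<psi> i (h j x)" "\<lambda>x. 0"] \<psi>_zero[OF i] Ck_on_const[OF T] by simp
    then show ?thesis using T x False by blast
  qed
qed

definition "\<rho> i p = \<psi> i p / (\<Sum>k\<in>I. \<psi> k p)"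

lemma \<psi>_sum_pos:
  assumes "j \<in> I" "x \<in> U j" shows "(\<Sum>k\<in>I. \<psi> k (h j x)) > 0"
  using cover[OF assms] by (auto intro!: sum_pos2[OF finite_I] simp: \<psi>_pos \<psi>_nonneg)

lemma Ck_\<rho>: "i \<in> I \<Longrightarrow> j \<in> I \<Longrightarrow> Ck_on 1 (U j) (\<lambda>x. \<rho> i (h j x))"
  unfolding \<rho>_def
  by (intro Ck_on_divide Ck_on_sum open_U Ck_\<psi>) (use \<psi>_sum_pos in force)+

lemma \<rho>_sum: "j \<in> I \<Longrightarrow> x \<in> U j \<Longrightarrow> (\<Sum>i\<in>I. \<rho> i (h j x)) = 1"
  using \<psi>_sum_pos[of j x] by (simp add: \<rho>_def sum_divide_distrib[symmetric])

lemma \<rho>_zero: "i \<in> I \<Longrightarrow> p \<notin> h i ` cball (c i) (r i) \<Longrightarrow> \<rho> i p = 0"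
  by (simp add: \<rho>_def \<psi>_zero)

lemma \<rho>_nonneg: "i \<in> I \<Longrightarrow> \<rho> i p \<ge> 0"
  by (simp add: \<rho>_def \<psi>_nonneg sum_nonneg)

lemma \<rho>_pos: "i \<in> I \<Longrightarrow> x \<in> ball (c i) (r i) \<Longrightarrow> \<rho> i (h i x) > 0"
  unfolding \<rho>_def using cball_sub[of i] ball_subset_cball[of "c i" "r i"]
  by (intro divide_pos_pos \<psi>_sum_pos) (auto simp: \<psi>_pos)

lemma h_cball: "i \<in> I \<Longrightarrow> x \<in> U i \<Longrightarrow> h i x \<in> h i ` cball (c i) (r i) \<longleftrightarrow> x \<in> cball (c i) (r i)"
  by (rule inj_on_image_mem_iff[OF inj_h _ cball_sub])

lemma d\<rho>: "i \<in> I \<Longrightarrow> j \<in> I \<Longrightarrow> x \<in> U j \<Longrightarrow> (\<lambda>x. \<rho> i (h j x)) differentiable (at x)"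
  using Ck_\<rho>[of i j] by simp

section \<open>Derivatives of the partition of unity along the field\<close>

definition "\<theta> i j x = fd (\<lambda>x. \<rho> i (h j x)) x (W j x)"

lemma cont_\<theta>:
  assumes "i \<in> I" "j \<in> I" shows "continuous_on (U j) (\<theta> i j)"
proof -
  have "Ck_on 0 (U j) (\<lambda>x. fd (\<lambda>x. \<rho> i (h j x)) x (W j x))"
    by (rule Ck_on_fd_comp[OF open_U open_U _ Ck_on_id])
       (use assms Ck_\<rho> open_U Ck_on_imp_continuous_on[OF Ck_W] in auto)
  then show ?thesis by (simp add: \<theta>_def[abs_def])
qed

lemma \<theta>_zero:
  assumes "i \<in> I" "j \<in> I" "x \<in> U j" "h j x \<notin> h i ` cball (c i) (r i)"
  shows "\<theta> i j x = 0"
  unfolding \<theta>_def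
  by (rule fd_eq_0[OF open_outside[OF assms(1,2)]]) (use assms \<rho>_zero in auto)

lemma \<theta>_sum:
  assumes "j \<in> I" "x \<in> U j" shows "(\<Sum>i\<in>I. \<theta> i j x) = 0"
proof -
  have "((\<lambda>x. \<Sum>i\<in>I. \<rho> i (h j x)) has_derivative (\<lambda>u. \<Sum>i\<in>I. fd (\<lambda>x. \<rho> i (h j x)) x u)) (at x)"
    by (intro has_derivative_sum fd_works d\<rho> assms)
  then have "((\<lambda>x. 1) has_derivative (\<lambda>u. \<Sum>i\<in>I. fd (\<lambda>x. \<rho> i (h j x)) x u)) (at x)"
    by (rule has_derivative_transform_within_open[OF _ open_U[OF assms(1)] assms(2)]) (simp add: \<rho>_sum[OF assms(1)])
  then have "(\<lambda>u. \<Sum>i\<in>I. fd (\<lambda>x. \<rho> i (h j x)) x u) = (\<lambda>u. 0)"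
    by (rule has_derivative_unique[OF _ has_derivative_const])
  then show ?thesis unfolding \<theta>_def by metis
qed

lemma \<theta>_trans:
  assumes ijk: "i \<in> I" "j \<in> I" "k \<in> I" and x: "x \<in> overlap j k"
  shows "\<theta> i j x = \<theta> i k (\<phi> j k x)"
proof -
  have O: "open (overlap j k)" unfolding overlap_def by (rule open_overlap[OF ijk(2,3)])
  have t: "\<phi> j k y \<in> U k" "h k (\<phi> j k y) = h j y" if "y \<in> overlap j k" for y
    using trans[OF ijk(2,3), of y] that by (auto simp: overlap_def)
  have d: "\<phi> j k differentiable (at x)"
    using Ck_trans[OF ijk(2,3)] x by (simp add: overlap_def)
  have "((\<lambda>x. \<rho> i (h k (\<phi> j k x))) has_derivative (\<lambda>u. fd (\<lambda>x. \<rho> i (h k x)) (\<phi> j k x) (fd (\<phi> j k) x u))) (at x)"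
    by (rule has_derivative_compose[OF fd_works[OF d] fd_works[OF d\<rho>]]) (use ijk t(1)[OF x] in auto)
  then have "((\<lambda>x. \<rho> i (h j x)) has_derivative (\<lambda>u. fd (\<lambda>x. \<rho> i (h k x)) (\<phi> j k x) (fd (\<phi> j k) x u))) (at x)"
    by (rule has_derivative_transform_within_open[OF _ O x]) (simp add: t)
  then show ?thesis
    unfolding \<theta>_def using W_trans[OF ijk(2,3)] x by (simp add: fd_eqI overlap_def)
qed

text \<open>Integration is over the whole space, whereas the data exist only on \<open>U i\<close>.
  For functions vanishing off the closed ball, extension by zero keeps continuity and
  differentiability.\<close>

definition "ext i F x = (if x \<in> U i then F x else (0::real))"

lemma ext_in: "x \<in> U i \<Longrightarrow> ext i F x = F x"
  by (simp add: ext_def)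

lemma Ck_ext:
  assumes "i \<in> I" "Ck_on k (U i) F" "\<And>x. x \<in> U i \<Longrightarrow> x \<notin> cball (c i) (r i) \<Longrightarrow> F x = 0"
  shows "Ck_on k UNIV (ext i F)"
  unfolding ext_def[abs_def]
  by (rule Ck_on_extend_by_0[OF open_U _ cball_sub]) (use assms in auto)

lemma integrable_ext:
  assumes "i \<in> I" "continuous_on (U i) F" "\<And>x. x \<in> U i \<Longrightarrow> x \<notin> cball (c i) (r i) \<Longrightarrow> F x = 0"
  shows "continuous_on UNIV (ext i F)" "integrable lborel (ext i F)"
proof -
  show c: "continuous_on UNIV (ext i F)" using Ck_ext[of i 0 F] assms by simp
  show "integrable lborel (ext i F)"
    by (rule integrable_compact_support[OF c compact_cball[of "c i" "r i"]])
       (use assms in \<open>auto simp: ext_def\<close>)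
qed

definition "J i F = integral\<^sup>L lborel (ext i F)"

text \<open>In the application this is the volume density times the Riemannian divergence, by
  \<open>divergence_density\<close>. The atlas itself knows only the density and the field.\<close>

definition "div_density i x = (\<Sum>b\<in>Basis. fd (\<lambda>y. w i y * (W i y \<bullet> b)) x b)"

lemma cont_div_density: "i \<in> I \<Longrightarrow> continuous_on (U i) (div_density i)"
proof -
  assume i: "i \<in> I"
  have "Ck_on 1 (U i) (\<lambda>y. w i y * (W i y \<bullet> b))" for b
    by (intro Ck_on_mult Ck_on_inner Ck_on_const open_U Ck_w Ck_W i)
  then show ?thesis unfolding div_density_def[abs_def] by (intro continuous_on_sum) simp
qed

lemmas cont_\<rho> = Ck_on_imp_continuous_on[OF Ck_\<rho>]
lemmas cont_w = Ck_on_imp_continuous_on[OF Ck_w]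

text \<open>The functions \<rho> w (W \<bullet> b) have compact support in the chart, so their
  derivatives along \<open>b\<close> integrate to zero. The product rule splits the sum of these
  derivatives into the two integrands.\<close>

lemma integration_by_parts:
  assumes i: "i \<in> I"
  shows "J i (\<lambda>x. \<rho> i (h i x) * div_density i x) = - J i (\<lambda>x. w i x * \<theta> i i x)"
proof -
  define F where "F b x = \<rho> i (h i x) * (w i x * (W i x \<bullet> b))" for b x
  have zero: "\<rho> i (h i x) = 0" "\<theta> i i x = 0" if "x \<in> U i" "x \<notin> cball (c i) (r i)" for x
    using that h_cball[OF i] \<rho>_zero[OF i] \<theta>_zero[OF i i] by auto
  have CwW: "Ck_on 1 (U i) (\<lambda>y. w i y * (W i y \<bullet> b))" for b
    by (intro Ck_on_mult Ck_on_inner Ck_on_const open_U Ck_w Ck_W i)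
  have "Ck_on 1 (U i) (F b)" for b
    unfolding F_def by (intro Ck_on_mult open_U Ck_\<rho> CwW i)
  then have CF: "Ck_on 1 UNIV (ext i (F b))" for b
    by (rule Ck_ext[OF i]) (simp_all add: F_def zero)
  have int: "integrable lborel (\<lambda>x. fd (ext i (F b)) x b)" for b
  proof (rule integrable_compact_support[OF _ compact_cball[of "c i" "r i"]])
    show "continuous_on UNIV (\<lambda>x. fd (ext i (F b)) x b)" using CF by simp
    fix x assume x: "x \<notin> cball (c i) (r i)"
    show "fd (ext i (F b)) x b = 0"
      by (rule fd_eq_0[of "- cball (c i) (r i)"]) (use x zero in \<open>auto simp: ext_def F_def\<close>)
  qed
  have sum: "(\<Sum>b\<in>Basis. fd (ext i (F b)) x b) =
      ext i (\<lambda>x. \<rho> i (h i x) * div_density i x) x + ext i (\<lambda>x. w i x * \<theta> i i x) x" for x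
  proof (cases "x \<in> U i")
    case True
    have wW: "(\<lambda>y. w i y * (W i y \<bullet> b)) differentiable (at x)" for b
      using CwW True by simp
    have "(F b has_derivative (\<lambda>u. \<rho> i (h i x) * fd (\<lambda>y. w i y * (W i y \<bullet> b)) x u +
        fd (\<lambda>x. \<rho> i (h i x)) x u * (w i x * (W i x \<bullet> b)))) (at x)" for b
      unfolding F_def by (intro has_derivative_mult fd_works d\<rho> wW i True)
    then have "(ext i (F b) has_derivative (\<lambda>u. \<rho> i (h i x) * fd (\<lambda>y. w i y * (W i y \<bullet> b)) x u +
        fd (\<lambda>x. \<rho> i (h i x)) x u * (w i x * (W i x \<bullet> b)))) (at x)" for b
      by (rule has_derivative_transform_within_open[OF _ open_U[OF i] True]) (simp add: ext_def)
    note fd_eqI[OF this]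
    then have "(\<Sum>b\<in>Basis. fd (ext i (F b)) x b) = \<rho> i (h i x) * div_density i x +
        w i x * (\<Sum>b\<in>Basis. (W i x \<bullet> b) * fd (\<lambda>x. \<rho> i (h i x)) x b)"
      by (simp add: sum.distrib div_density_def sum_distrib_left mult_ac)
    also have "(\<Sum>b\<in>Basis. (W i x \<bullet> b) * fd (\<lambda>x. \<rho> i (h i x)) x b) = \<theta> i i x"
      unfolding \<theta>_def fd_Basis_sum[OF d\<rho>[OF i i True], of "W i x"] by simp
    finally show ?thesis unfolding ext_in[OF True] .
  next
    case False
    then have x: "x \<in> - cball (c i) (r i)" using cball_sub[OF i] by auto
    have "fd (ext i (F b)) x b = 0" for b
      by (rule fd_eq_0[of "- cball (c i) (r i)"]) (use x zero in \<open>auto simp: ext_def F_def\<close>)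
    then show ?thesis using False by (simp add: ext_def)
  qed
  have "(\<Sum>b\<in>Basis. integral\<^sup>L lborel (\<lambda>x. fd (ext i (F b)) x b)) = 0"
    using integral_fd_eq_0[OF CF compact_cball[of "c i" "r i"]] zero by (simp add: ext_def F_def)
  then have "integral\<^sup>L lborel (\<lambda>x. \<Sum>b\<in>Basis. fd (ext i (F b)) x b) = 0"
    using int by (simp add: Bochner_Integration.integral_sum)
  moreover have "integrable lborel (ext i (\<lambda>x. \<rho> i (h i x) * div_density i x))"
    by (rule integrable_ext[OF i]) (use zero in \<open>auto intro!: continuous_intros cont_\<rho> cont_div_density i\<close>)
  moreover have "integrable lborel (ext i (\<lambda>x. w i x * \<theta> i i x))"
    by (rule integrable_ext[OF i]) (use zero in \<open>auto intro!: continuous_intros cont_w cont_\<theta> i\<close>)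
  ultimately show ?thesis unfolding sum J_def by simp
qed

text \<open>The product of \<rho> k and \<theta> i lives on the overlap only. In chart
  \<open>k\<close> the factor \<theta> i vanishes off the overlap, in chart \<open>i\<close> the
  factor \<rho> k does. On the overlap \<theta> is invariant and the density absorbs the
  Jacobian.\<close>

lemma J_change_chart:
  assumes i: "i \<in> I" and k: "k \<in> I"
  shows "J i (\<lambda>x. \<rho> k (h i x) * (w i x * \<theta> i i x)) = J k (\<lambda>x. \<rho> k (h k x) * (w k x * \<theta> i k x))"
proof -
  let ?f = "\<lambda>x. \<rho> k (h k x) * (w k x * \<theta> i k x)"
  let ?g = "\<lambda>x. \<rho> k (h i x) * (w i x * \<theta> i i x)"
  have t: "\<phi> a b x \<in> U b" "h b (\<phi> a b x) = h a x" if "x \<in> overlap a b" "a \<in> I" "b \<in> I" for a b x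
    using trans[of a b x] that by (auto simp: overlap_def)
  have inv: "\<phi> a b x \<in> overlap b a" "\<phi> b a (\<phi> a b x) = x" if "x \<in> overlap a b" "a \<in> I" "b \<in> I" for a b x
  proof -
    show 1: "\<phi> a b x \<in> overlap b a" using t[OF that] that by (auto simp: overlap_def)
    have "h a (\<phi> b a (\<phi> a b x)) = h a x" using t[OF 1] t[OF that] that by simp
    moreover have "\<phi> b a (\<phi> a b x) \<in> U a" "x \<in> U a" using t(1)[OF 1] that by (auto simp: overlap_def)
    ultimately show "\<phi> b a (\<phi> a b x) = x" using inj_h[OF that(2)] by (auto dest: inj_onD)
  qed
  have img: "\<phi> i k ` overlap i k = overlap k i"
  proof (intro set_eqI iffI)
    fix y assume "y \<in> overlap k i"
    then show "y \<in> \<phi> i k ` overlap i k" using inv[OF _ k i, of y] by (metis imageI)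
  qed (use inv[OF _ i k] in auto)
  have ext_f: "ext k ?f = (\<lambda>y. indicator (\<phi> i k ` overlap i k) y * ?f y)"
  proof
    fix y
    have "\<theta> i k y = 0" if "y \<in> U k" "y \<notin> overlap k i"
      using \<theta>_zero[OF i k that(1)] cball_sub[OF i] that by (auto simp: overlap_def)
    then show "ext k ?f y = indicator (\<phi> i k ` overlap i k) y * ?f y"
      unfolding img by (auto simp: ext_def overlap_def indicator_def)
  qed
  have ext_g: "ext i ?g = (\<lambda>x. indicator (overlap i k) x * (\<bar>edet (fd (\<phi> i k) x)\<bar> * ?f (\<phi> i k x)))"
  proof
    fix x
    have "\<rho> k (h i x) = 0" if "x \<in> U i" "x \<notin> overlap i k"
      using \<rho>_zero[OF k, of "h i x"] cball_sub[OF k] that by (auto simp: overlap_def)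
    moreover have "?g x = \<bar>edet (fd (\<phi> i k) x)\<bar> * ?f (\<phi> i k x)" if "x \<in> overlap i k"
      using t[OF that i k] \<theta>_trans[OF i i k that] w_trans[OF i k, of x] that
      by (simp add: overlap_def)
    ultimately show "ext i ?g x = indicator (overlap i k) x * (\<bar>edet (fd (\<phi> i k) x)\<bar> * ?f (\<phi> i k x))"
      by (cases "x \<in> overlap i k") (auto simp: ext_def overlap_def)
  qed
  have zero: "\<rho> k (h k x) = 0" if "x \<in> U k" "x \<notin> cball (c k) (r k)" for x
    using that h_cball[OF k] \<rho>_zero[OF k] by auto
  have zero': "\<theta> i i x = 0" if "x \<in> U i" "x \<notin> cball (c i) (r i)" for x
    using that h_cball[OF i] \<theta>_zero[OF i i] by auto
  have "integral\<^sup>L lborel (\<lambda>y. indicator (\<phi> i k ` overlap i k) y * ?f y) =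
    integral\<^sup>L lborel (\<lambda>x. indicator (overlap i k) x * (\<bar>edet (fd (\<phi> i k) x)\<bar> * ?f (\<phi> i k x)))"
  proof (rule integral_change_of_variables_eucl)
    show "open (overlap i k)" "open (\<phi> i k ` overlap i k)"
      unfolding img unfolding overlap_def by (intro open_overlap i k)+
    show "inj_on (\<phi> i k) (overlap i k)" using inv(2)[OF _ i k] by (metis inj_onI)
    show "(\<phi> i k has_derivative fd (\<phi> i k) x) (at x)" if "x \<in> overlap i k" for x
      using Ck_trans[OF i k] that by (intro fd_works) (simp add: overlap_def)
    show "integrable lborel (\<lambda>y. indicator (\<phi> i k ` overlap i k) y * ?f y)"
      unfolding ext_f[symmetric]
      by (rule integrable_ext[OF k]) (use zero in \<open>auto intro!: continuous_intros cont_w cont_\<theta> cont_\<rho> i k\<close>)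
    show "(\<lambda>x. indicator (overlap i k) x * (\<bar>edet (fd (\<phi> i k) x)\<bar> * ?f (\<phi> i k x))) \<in> borel_measurable borel"
      unfolding ext_g[symmetric]
      by (rule borel_measurable_continuous_onI, rule integrable_ext[OF i])
         (use zero' in \<open>auto intro!: continuous_intros cont_w cont_\<theta> cont_\<rho> i k\<close>)
  qed
  then show ?thesis unfolding J_def ext_f ext_g by simp
qed

lemma ext_sum: "ext i (\<lambda>x. \<Sum>k\<in>A. F k x) = (\<lambda>x. \<Sum>k\<in>A. ext i (F k) x)"
  by (auto simp: ext_def)

lemma J_sum:
  assumes "\<And>k. k \<in> A \<Longrightarrow> integrable lborel (ext i (F k))"
  shows "J i (\<lambda>x. \<Sum>k\<in>A. F k x) = (\<Sum>k\<in>A. J i (F k))"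
  unfolding J_def ext_sum by (intro Bochner_Integration.integral_sum assms)

lemma J_cong: "(\<And>x. x \<in> U i \<Longrightarrow> F x = F' x) \<Longrightarrow> J i F = J i F'"
  unfolding J_def ext_def[abs_def] by (metis (no_types, lifting))

text \<open>Here \<open>\<theta> i j\<close> is the derivative along \<open>W\<close> of the \<open>i\<close>-th function \<open>\<rho> i\<close> of the partition of unity, in the
  chart \<open>j\<close>. After integration by parts, the \<open>i\<close>-th integrand is split by the partition of unity and its
  \<open>k\<close>-th part is moved to the chart \<open>k\<close>, where the \<open>\<theta> i k\<close> add up to the derivative of the constant 1.\<close>

theorem total_divergence: "(\<Sum>i\<in>I. J i (\<lambda>x. \<rho> i (h i x) * div_density i x)) = 0"
proof -
  have i1: "integrable lborel (ext i (\<lambda>x. \<rho> k (h i x) * (w i x * \<theta> i i x)))" if "i \<in> I" "k \<in> I" for i k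
    by (rule integrable_ext[OF that(1)])
       (use that h_cball \<theta>_zero in \<open>auto intro!: continuous_intros cont_w cont_\<theta> cont_\<rho>\<close>)
  have i2: "integrable lborel (ext k (\<lambda>x. \<rho> k (h k x) * (w k x * \<theta> i k x)))" if "i \<in> I" "k \<in> I" for i k
    by (rule integrable_ext[OF that(2)])
       (use that h_cball \<rho>_zero in \<open>auto intro!: continuous_intros cont_w cont_\<theta> cont_\<rho>\<close>)
  have "(\<Sum>i\<in>I. J i (\<lambda>x. w i x * \<theta> i i x)) = (\<Sum>i\<in>I. \<Sum>k\<in>I. J i (\<lambda>x. \<rho> k (h i x) * (w i x * \<theta> i i x)))"
  proof (rule sum.cong[OF refl])
    fix i assume i: "i \<in> I"
    have "J i (\<lambda>x. w i x * \<theta> i i x) = J i (\<lambda>x. \<Sum>k\<in>I. \<rho> k (h i x) * (w i x * \<theta> i i x))"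
      by (rule J_cong) (simp add: sum_distrib_right[symmetric] \<rho>_sum[OF i])
    also have "\<dots> = (\<Sum>k\<in>I. J i (\<lambda>x. \<rho> k (h i x) * (w i x * \<theta> i i x)))"
      by (rule J_sum) (use i1 i in auto)
    finally show "J i (\<lambda>x. w i x * \<theta> i i x) = (\<Sum>k\<in>I. J i (\<lambda>x. \<rho> k (h i x) * (w i x * \<theta> i i x)))" .
  qed
  also have "\<dots> = (\<Sum>i\<in>I. \<Sum>k\<in>I. J k (\<lambda>x. \<rho> k (h k x) * (w k x * \<theta> i k x)))"
    by (intro sum.cong refl J_change_chart)
  also have "\<dots> = (\<Sum>k\<in>I. \<Sum>i\<in>I. J k (\<lambda>x. \<rho> k (h k x) * (w k x * \<theta> i k x)))"
    by (rule sum.swap)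
  also have "\<dots> = (\<Sum>k\<in>I. J k (\<lambda>x. \<Sum>i\<in>I. \<rho> k (h k x) * (w k x * \<theta> i k x)))"
    by (intro sum.cong refl J_sum[symmetric] i2)
  also have "\<dots> = (\<Sum>k\<in>I. J k (\<lambda>x. 0))"
    by (intro sum.cong refl J_cong) (simp add: sum_distrib_left[symmetric] \<theta>_sum)
  also have "\<dots> = 0" by (simp add: J_def ext_def[abs_def])
  finally show ?thesis by (simp add: integration_by_parts sum_negf)
qed

text \<open>Nonnegative integrals with sum zero vanish one by one, so each continuous nonnegative
  integrand is zero. On the open ball the weight \<rho> is positive and can be divided off.\<close>

corollary nonneg_divergence_zero:
  assumes "\<And>i x. i \<in> I \<Longrightarrow> x \<in> U i \<Longrightarrow> div_density i x \<ge> 0"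
    and i: "i \<in> I" and x: "x \<in> ball (c i) (r i)"
  shows "div_density i x = 0"
proof -
  let ?F = "\<lambda>i. ext i (\<lambda>x. \<rho> i (h i x) * div_density i x)"
  have int: "continuous_on UNIV (?F i)" "integrable lborel (?F i)" if "i \<in> I" for i
    by (rule integrable_ext[OF that];
        use that h_cball \<rho>_zero in \<open>auto intro!: continuous_intros cont_div_density cont_\<rho>\<close>)+
  have nn: "?F i y \<ge> 0" if "i \<in> I" for i y
    using assms(1) \<rho>_nonneg that by (auto simp: ext_def)
  have "integral\<^sup>L lborel (?F i) = 0"
  proof -
    have "integral\<^sup>L lborel (?F i) \<ge> 0" if "i \<in> I" for i
      by (rule integral_nonneg_AE, rule AE_I2, rule nn[OF that])
    from sum_nonneg_0[OF finite_I this total_divergence[unfolded J_def] i] show ?thesis .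
  qed
  then have F0: "?F i x = 0"
    using nonneg_continuous_integral_0[OF int(1)[OF i] nn[OF i] int(2)[OF i]] by blast
  have "x \<in> U i" using x cball_sub[OF i] ball_subset_cball[of "c i" "r i"] by blast
  then show ?thesis using F0 \<rho>_pos[OF i x] by (simp add: ext_def)
qed

end

subsection \<open>Charts and extension of tangent vectors\<close>

lemma smooth_on_Ck_on: "smooth_on S f \<Longrightarrow> Ck_on k S f"
  by (simp add: smooth_on_def)

lemma is_chart:
  assumes "is_chart c"
  shows chart_inv_map: "p \<in> chart_dom c \<Longrightarrow> chart_inv c (chart_map c p) = p"
    and chart_map_inv: "y \<in> chart_img c \<Longrightarrow> chart_map c (chart_inv c y) = y"
    and chart_inv_dom: "y \<in> chart_img c \<Longrightarrow> chart_inv c y \<in> chart_dom c"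
    and chart_map_img: "p \<in> chart_dom c \<Longrightarrow> chart_map c p \<in> chart_img c"
    and open_chart_img: "open (chart_img c)" and open_chart_dom: "open (chart_dom c)"
    and continuous_chart_map: "continuous_on (chart_dom c) (chart_map c)"
    and continuous_chart_inv: "continuous_on (chart_img c) (chart_inv c)"
  using assms unfolding is_chart_def homeomorphism_def by blast+

lemma chart_image_eq:
  assumes "is_chart c" "W \<subseteq> chart_dom c"
  shows "chart_map c ` W = {y \<in> chart_img c. chart_inv c y \<in> W}"
proof (intro set_eqI iffI)
  fix y assume "y \<in> {y \<in> chart_img c. chart_inv c y \<in> W}"
  then show "y \<in> chart_map c ` W" using chart_map_inv[OF assms(1)] by (metis (mono_tags) imageI mem_Collect_eq)
qed (use assms chart_inv_map[OF assms(1)] chart_map_img[OF assms(1)] in auto)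

lemma open_chart_image:
  assumes "is_chart c" "open W" "W \<subseteq> chart_dom c"
  shows "open (chart_map c ` W)"
  unfolding chart_image_eq[OF assms(1,3)]
  using continuous_open_preimage[OF continuous_chart_inv open_chart_img assms(2)] assms(1)
  by (simp add: vimage_def Int_def)

lemma open_chart_preimage:
  assumes "is_chart c" "open B"
  shows "open {q \<in> chart_dom c. chart_map c q \<in> B}"
  using continuous_open_preimage[OF continuous_chart_map open_chart_dom assms(2)] assms(1)
  by (simp add: vimage_def Int_def)

context
  fixes A :: "('m::{t2_space, second_countable_topology}, 'e::euclidean_space) chart set"
  assumes A: "smooth_structure A"
begin

lemma chart_of: "c \<in> A \<Longrightarrow> is_chart c"
  using A by (simp add: smooth_structure_def)

lemma Ck_transition:
  "c \<in> A \<Longrightarrow> d \<in> A \<Longrightarrow> Ck_on k (chart_map c ` (chart_dom c \<inter> chart_dom d)) (transition c d)"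
  using A unfolding smooth_structure_def compatible_def smooth_on_def by blast

lemma transition_chart:
  "c \<in> A \<Longrightarrow> p \<in> chart_dom c \<Longrightarrow> transition c d (chart_map c p) = chart_map d p"
  by (simp add: transition_def chart_inv_map[OF chart_of])

lemma open_overlap_image:
  "c \<in> A \<Longrightarrow> d \<in> A \<Longrightarrow> open (chart_map c ` (chart_dom c \<inter> chart_dom d))"
  by (rule open_chart_image[OF chart_of]) (auto intro: open_chart_dom chart_of)

lemma transition_differentiable:
  "c \<in> A \<Longrightarrow> d \<in> A \<Longrightarrow> p \<in> chart_dom c \<Longrightarrow> p \<in> chart_dom d \<Longrightarrow>
    transition c d differentiable (at (chart_map c p))"
  by (rule Ck_on_imp_differentiable[OF Ck_transition[of _ _ "Suc 0"]]) auto

lemma fd_transition_chain: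
  assumes cde: "c \<in> A" "d \<in> A" "e \<in> A" and p: "p \<in> chart_dom c" "p \<in> chart_dom d" "p \<in> chart_dom e"
  shows "fd (transition c e) (chart_map c p) u =
    fd (transition d e) (chart_map d p) (fd (transition c d) (chart_map c p) u)"
proof -
  let ?T = "chart_map c ` (chart_dom c \<inter> (chart_dom d \<inter> chart_dom e))"
  have "open ?T"
    by (rule open_chart_image[OF chart_of[OF cde(1)]])
       (use open_chart_dom[OF chart_of] cde in \<open>blast intro: open_Int\<close>)+
  moreover have "chart_map c p \<in> ?T" using p by auto
  moreover have "transition d e (transition c d y) = transition c e y" if "y \<in> ?T" for y
    using that transition_chart[OF cde(1), of _ d] transition_chart[OF cde(1), of _ e] transition_chart[OF cde(2), of _ e]
    by auto
  moreover have "((\<lambda>y. transition d e (transition c d y)) has_derivative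
      (\<lambda>u. fd (transition d e) (transition c d (chart_map c p)) (fd (transition c d) (chart_map c p) u))) (at (chart_map c p))"
    by (rule has_derivative_compose[OF fd_works fd_works])
       (use transition_differentiable cde p transition_chart in auto)
  ultimately have "(transition c e has_derivative
      (\<lambda>u. fd (transition d e) (transition c d (chart_map c p)) (fd (transition c d) (chart_map c p) u))) (at (chart_map c p))"
    by (rule has_derivative_transform_within_open[rotated 1])
  then show ?thesis using transition_chart[OF cde(1) p(1), of d] by (simp add: fd_eqI)
qed

lemma fd_transition_self:
  assumes "c \<in> A" "p \<in> chart_dom c" shows "fd (transition c c) (chart_map c p) u = u"
proof -
  have "(transition c c has_derivative (\<lambda>u. u)) (at (chart_map c p))"
    by (rule has_derivative_transform_within_open[OF has_derivative_ident open_chart_img[OF chart_of[OF assms(1)]]])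
       (use chart_map_img[OF chart_of[OF assms(1)] assms(2)] chart_map_inv[OF chart_of[OF assms(1)]] in
          \<open>simp_all add: transition_def\<close>)
  then show ?thesis by (simp add: fd_eqI)
qed

text \<open>\<open>closed_conformal\<close> quantifies over global fields. To use it for a single
  tangent vector, the vector is extended as a constant field in the chart \<open>c\<close>, cut off
  by a bump function and carried to the other charts by the transition maps.\<close>

lemma vector_field_extension:
  assumes c: "c \<in> A" and p: "p \<in> chart_dom c"
  shows "\<exists>X. vector_field A X \<and> X c (chart_map c p) = v"
proof -
  note ch = chart_of[OF c]
  obtain r where r: "r > 0" "cball (chart_map c p) r \<subseteq> chart_img c"
    using open_chart_img[OF ch] chart_map_img[OF ch p] open_contains_cball by blast
  obtain \<beta> :: "'e \<Rightarrow> real" where \<beta>: "\<And>k. Ck_on k UNIV \<beta>" "\<beta> (chart_map c p) > 0" "\<And>x. \<beta> x \<ge> 0"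
      "\<And>x. \<beta> x > 0 \<longleftrightarrow> dist (chart_map c p) x < r"
    using smooth_bump_exists[OF r(1), of "chart_map c p"] by blast
  \<comment> \<open>The bump function need not be 1 at the point; this scaling compensates for its
    value there.\<close>
  define v' where "v' = (1 / \<beta> (chart_map c p)) *\<^sub>R v"
  define X where "X d y = (if y \<in> chart_img d \<and> chart_inv d y \<in> chart_dom c
      then \<beta> (transition d c y) *\<^sub>R fd (transition c d) (transition d c y) v' else 0)" for d :: "('m, 'e) chart" and y
  have X_in: "X d (chart_map d q) = \<beta> (chart_map c q) *\<^sub>R fd (transition c d) (chart_map c q) v'"
    if "d \<in> A" "q \<in> chart_dom d" "q \<in> chart_dom c" for d q
    using that chart_map_img[OF chart_of] chart_inv_map[OF chart_of] by (simp add: X_def transition_chart)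
  have X_out: "X d (chart_map d q) = 0" if "d \<in> A" "q \<in> chart_dom d" "q \<notin> chart_dom c" for d q
    using that chart_inv_map[OF chart_of] by (simp add: X_def)
  \<comment> \<open>\<open>X\<close> vanishes outside the compact set \<open>C\<close>, which is
    closed because the manifold is Hausdorff. Hence the domain of \<open>c\<close> and the
    complement of \<open>C\<close> are open and cover the manifold, and smoothness is checked on
    each.\<close>
  define C where "C = chart_inv c ` cball (chart_map c p) r"
  have "compact C" unfolding C_def
    by (rule compact_continuous_image[OF continuous_on_subset[OF continuous_chart_inv[OF ch] r(2)]]) simp
  then have openC: "open (- C)" using compact_imp_closed by blast
  have CX: "Ck_on k (chart_img d) (X d)" if d: "d \<in> A" for d k
  proof (rule Ck_on_local)
    note chd = chart_of[OF d]
    fix y assume y: "y \<in> chart_img d"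
    define q where "q = chart_inv d y"
    have q: "q \<in> chart_dom d" "y = chart_map d q" using y chart_inv_dom[OF chd] chart_map_inv[OF chd] by (auto simp: q_def)
    show "\<exists>T. open T \<and> y \<in> T \<and> Ck_on k T (X d)"
    proof (cases "q \<in> chart_dom c")
      case True
      define T where "T = chart_map d ` (chart_dom d \<inter> chart_dom c)"
      have T: "open T" unfolding T_def by (rule open_overlap_image[OF d c])
      have T': "open (chart_map c ` (chart_dom c \<inter> chart_dom d))" by (rule open_overlap_image[OF c d])
      have tr: "Ck_on k T (transition d c)" unfolding T_def by (rule Ck_transition[OF d c])
      have map: "transition d c z \<in> chart_map c ` (chart_dom c \<inter> chart_dom d)" if "z \<in> T" for z
        using that transition_chart[OF d, of _ c] by (auto simp: T_def)
      have "Ck_on k T (\<lambda>z. \<beta> (transition d c z) *\<^sub>R fd (transition c d) (transition d c z) v')"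
        by (intro Ck_on_scaleR[OF T] Ck_on_compose[OF T open_UNIV tr \<beta>(1)]
            Ck_on_fd_comp[OF T T' Ck_transition[OF c d] tr map Ck_on_const[OF T]]) auto
      then have "Ck_on k T (X d)"
        by (rule iffD1[OF Ck_on_cong[OF T], rotated])
           (use X_in[OF d] transition_chart[OF d, of _ c] in \<open>auto simp: T_def\<close>)
      then show ?thesis using T True q by (auto simp: T_def)
    next
      case False
      define T where "T = chart_map d ` (chart_dom d \<inter> - C)"
      have T: "open T" unfolding T_def
        by (rule open_chart_image[OF chd]) (use openC open_chart_dom[OF chd] in auto)
      have "X d z = 0" if z: "z \<in> T" for z
      proof -
        obtain q' where q': "z = chart_map d q'" "q' \<in> chart_dom d" "q' \<notin> C" using z by (auto simp: T_def)
        have "\<beta> (chart_map c q') = 0" if "q' \<in> chart_dom c"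
        proof -
          have "chart_map c q' \<notin> cball (chart_map c p) r"
            using q'(3) chart_inv_map[OF ch that] unfolding C_def by (metis imageI)
          then show ?thesis using \<beta>(3,4)[of "chart_map c q'"] by (simp add: not_le order.strict_implies_order less_le)
        qed
        then show ?thesis using X_in[OF d q'(2)] X_out[OF d q'(2)] q'(1) by (cases "q' \<in> chart_dom c") auto
      qed
      then have "Ck_on k T (X d)" using Ck_on_cong[OF T, of "X d" "\<lambda>_. 0"] Ck_on_const[OF T] by auto
      moreover have "q \<notin> C" using False r(2) chart_inv_dom[OF ch] by (auto simp: C_def)
      ultimately show ?thesis using T q by (auto simp: T_def)
    qed
  qed
  have "vector_field A X"
    unfolding vector_field_def
  proof (intro conjI ballI)
    fix d assume "d \<in> A" then show "smooth_on (chart_img d) (X d)" using CX by (simp add: smooth_on_def)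
  next
    fix d e q assume de: "d \<in> A" "e \<in> A" and q: "q \<in> chart_dom d \<inter> chart_dom e"
    have lin: "linear (fd (transition d e) (chart_map d q))"
      by (rule linear_frechet_derivative, rule transition_differentiable) (use de q in auto)
    show "X e (chart_map e q) = fd (transition d e) (chart_map d q) (X d (chart_map d q))"
    proof (cases "q \<in> chart_dom c")
      case True
      then show ?thesis
        using X_in[of d q] X_in[of e q] de q fd_transition_chain[OF c de, of q v'] by (simp add: linear_cmul[OF lin])
    next
      case False
      then show ?thesis using X_out[of d q] X_out[of e q] de q by (simp add: linear_0[OF lin])
    qed
  qed
  moreover have "X c (chart_map c p) = v"
    using X_in[OF c p p] \<beta>(2) by (simp add: fd_transition_self[OF c p] v'_def)
  ultimately show ?thesis by blast
qed

lemma closed_conformal_pointwise: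
  assumes "closed_conformal A g \<xi>"
  obtains \<sigma> where "\<And>c p v. c \<in> A \<Longrightarrow> p \<in> chart_dom c \<Longrightarrow>
    cov_deriv (g c) (\<xi> c) (chart_map c p) v = \<sigma> p *\<^sub>R v"
proof -
  obtain \<sigma> where \<sigma>: "\<And>X c p. vector_field A X \<Longrightarrow> c \<in> A \<Longrightarrow> p \<in> chart_dom c \<Longrightarrow>
     cov_deriv (g c) (\<xi> c) (chart_map c p) (X c (chart_map c p)) = \<sigma> p *\<^sub>R X c (chart_map c p)"
    using assms unfolding closed_conformal_def by blast
  have "cov_deriv (g c) (\<xi> c) (chart_map c p) v = \<sigma> p *\<^sub>R v" if "c \<in> A" "p \<in> chart_dom c" for c p v
    using vector_field_extension[OF that, of v] \<sigma>[OF _ that] by blast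
  then show thesis using that by blast
qed

end

subsection \<open>The leaf topology\<close>

lemma foliation_chart: "smooth_structure A \<Longrightarrow> foliation A F \<Longrightarrow> c \<in> F \<Longrightarrow> c \<in> A \<and> is_chart c"
  using chart_of[of A c] by (meson foliation_def subsetD)

text \<open>Along a plaque of \<open>c\<close> the last coordinate of \<open>d\<close> is locally
  constant. This makes the parametrization of a plaque continuous into the leaf topology and the
  overlaps of leaf charts open.\<close>

lemma foliation_locally_constant:
  fixes A F :: "('m::{t2_space, second_countable_topology}, 'e::euclidean_space \<times> real) chart set"
  assumes A: "smooth_structure A" and F: "foliation A F"
    and cd: "c \<in> F" "d \<in> F" and V: "open V" "V \<subseteq> chart_dom d"
  shows "open {x. (x, t) \<in> chart_img c \<and> chart_inv c (x, t) \<in> V \<and> snd (chart_map d (chart_inv c (x, t))) = s}"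
    (is "open ?S")
proof -
  have cA: "is_chart c" using foliation_chart[OF A F cd(1)] by simp
  show ?thesis
  proof (rule topological_space_class.openI)
    fix x assume x: "x \<in> ?S"
    let ?p = "chart_inv c (x, t)"
    have p: "?p \<in> chart_dom c \<inter> chart_dom d" using x V chart_inv_dom[OF cA] by auto
    obtain W where W: "open W" "?p \<in> W" "W \<subseteq> chart_dom c \<inter> chart_dom d"
        and const: "\<forall>q\<in>W. \<forall>r\<in>W. snd (chart_map c q) = snd (chart_map c r) \<longrightarrow> snd (chart_map d q) = snd (chart_map d r)"
      using F cd p unfolding foliation_def by blast
    define T where "T = (\<lambda>x. (x, t)) -` (chart_map c ` (W \<inter> V))"
    have "open (chart_map c ` (W \<inter> V))" by (rule open_chart_image[OF cA]) (use W V in auto)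
    then have "open T" unfolding T_def by (rule open_vimage) (auto intro!: continuous_intros)
    moreover have Teq: "x' \<in> T \<longleftrightarrow> (x', t) \<in> chart_img c \<and> chart_inv c (x', t) \<in> W \<inter> V" for x'
      unfolding T_def using W by (subst chart_image_eq[OF cA]) auto
    moreover have "x \<in> T" using x W Teq by auto
    moreover have "T \<subseteq> ?S"
    proof
      fix x' assume "x' \<in> T"
      then have x': "(x', t) \<in> chart_img c" "chart_inv c (x', t) \<in> W" "chart_inv c (x', t) \<in> V" using Teq by auto
      have "snd (chart_map c (chart_inv c (x', t))) = snd (chart_map c ?p)"
        using x x' chart_map_inv[OF cA] by simp
      then have "snd (chart_map d (chart_inv c (x', t))) = snd (chart_map d ?p)" using const x'(2) W(2) by blast
      then show "x' \<in> ?S" using x x' by simp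
    qed
    ultimately show "\<exists>T. open T \<and> x \<in> T \<and> T \<subseteq> ?S" by (intro exI[of _ T] conjI)
  qed
qed

lemma topspace_leaf_topology:
  assumes "foliation A F" "\<And>c. c \<in> F \<Longrightarrow> open (chart_dom c)"
  shows "topspace (leaf_topology F) = UNIV"
proof -
  have "p \<in> \<Union> {{p \<in> W. snd (chart_map c p) = t} |c W t. c \<in> F \<and> open W \<and> W \<subseteq> chart_dom c}" for p
  proof -
    have "p \<in> (\<Union>c\<in>F. chart_dom c)" using assms(1) by (simp add: foliation_def)
    then obtain c where c: "c \<in> F" "p \<in> chart_dom c" by blast
    show ?thesis
    proof (rule UnionI)
      show "{q \<in> chart_dom c. snd (chart_map c q) = snd (chart_map c p)}
          \<in> {{p \<in> W. snd (chart_map c p) = t} |c W t. c \<in> F \<and> open W \<and> W \<subseteq> chart_dom c}"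
        using c(1) assms(2) by blast
    qed (simp add: c)
  qed
  then show ?thesis unfolding leaf_topology_def topology_generated_by_topspace by blast
qed

text \<open>A small ball in a slice is mapped continuously into the leaf topology, so its image is
  connected. As it meets the component \<open>L\<close>, it lies in \<open>L\<close>.\<close>

lemma open_leaf_slice:
  fixes A F :: "('m::{t2_space, second_countable_topology}, 'e::euclidean_space \<times> real) chart set"
  assumes A: "smooth_structure A" and F: "foliation A F" and L: "L \<in> leaves F" and c: "c \<in> F"
  shows "open {x. (x, t) \<in> chart_img c \<and> chart_inv c (x, t) \<in> L}"
  unfolding open_contains_ball
proof
  have cA: "is_chart c" if "c \<in> F" for c using foliation_chart[OF A F that] by simp
  fix x assume x: "x \<in> {x. (x, t) \<in> chart_img c \<and> chart_inv c (x, t) \<in> L}"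
  have "open ((\<lambda>x. (x, t)) -` chart_img c)"
    by (rule open_vimage[OF open_chart_img[OF cA[OF c]]]) (auto intro!: continuous_intros)
  then obtain e where e: "e > 0" "ball x e \<subseteq> (\<lambda>x. (x, t)) -` chart_img c"
    using x by (metis (no_types, lifting) mem_Collect_eq openE vimageI)
  let ?h = "\<lambda>x. chart_inv c (x, t)"
  have "continuous_map (top_of_set (ball x e)) (leaf_topology F) ?h"
    unfolding leaf_topology_def
  proof (rule continuous_on_generated_topo)
    fix V assume "V \<in> {{p \<in> W. snd (chart_map c p) = t} |c W t. c \<in> F \<and> open W \<and> W \<subseteq> chart_dom c}"
    then obtain d W s where V: "V = {p \<in> W. snd (chart_map d p) = s}" "d \<in> F" "open W" "W \<subseteq> chart_dom d" by blast
    have "?h -` V \<inter> topspace (top_of_set (ball x e)) = ball x e \<inter>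
        {x. (x, t) \<in> chart_img c \<and> ?h x \<in> W \<and> snd (chart_map d (?h x)) = s}"
      using e(2) V(1) by auto
    then show "openin (top_of_set (ball x e)) (?h -` V \<inter> topspace (top_of_set (ball x e)))"
      using foliation_locally_constant[OF A F c V(2-4), of t s] by (auto simp: openin_open)
  next
    have "?h x' \<in> \<Union> {{p \<in> W. snd (chart_map c p) = t} |c W t. c \<in> F \<and> open W \<and> W \<subseteq> chart_dom c}" for x'
      using topspace_leaf_topology[OF F open_chart_dom[OF cA]]
      unfolding leaf_topology_def topology_generated_by_topspace by blast
    then show "?h ` topspace (top_of_set (ball x e)) \<subseteq> \<Union> {{p \<in> W. snd (chart_map c p) = t} |c W t. c \<in> F \<and> open W \<and> W \<subseteq> chart_dom c}"
      by blast
  qed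
  then have "connectedin (leaf_topology F) (?h ` ball x e)"
    by (rule connectedin_continuous_map_image) (simp add: connectedin_subtopology)
  moreover have "?h x \<in> ?h ` ball x e" using e(1) by simp
  ultimately have "?h ` ball x e \<subseteq> L"
    using connected_components_of_maximal[OF L[unfolded leaves_def], of "?h ` ball x e"] x by (auto simp: disjnt_def)
  then show "\<exists>e>0. ball x e \<subseteq> {x. (x, t) \<in> chart_img c \<and> chart_inv c (x, t) \<in> L}"
    using e by (intro exI[of _ e]) auto
qed

text \<open>Such an image is itself a generator of the leaf topology, cut out of a box over
  \<open>B\<close> by fixing the height. It provides the open cover to which the compactness of the
  leaf applies.\<close>

lemma openin_leaf_ball:
  fixes A F :: "('m::{t2_space, second_countable_topology}, 'e::euclidean_space \<times> real) chart set"
  assumes A: "smooth_structure A" and F: "foliation A F" and c: "c \<in> F"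
    and B: "open B" "\<And>x. x \<in> B \<Longrightarrow> (x, t) \<in> chart_img c"
  shows "openin (leaf_topology F) ((\<lambda>x. chart_inv c (x, t)) ` B)"
proof -
  have ch: "is_chart c" using foliation_chart[OF A F c] by simp
  define W where "W = {q \<in> chart_dom c. chart_map c q \<in> fst -` B}"
  have "open W" unfolding W_def
    by (rule open_chart_preimage[OF ch]) (auto intro!: open_vimage_fst B)
  moreover have "(\<lambda>x. chart_inv c (x, t)) ` B = {p \<in> W. snd (chart_map c p) = t}"
  proof (intro set_eqI iffI)
    fix p assume p: "p \<in> {p \<in> W. snd (chart_map c p) = t}"
    then have "p = chart_inv c (fst (chart_map c p), t)"
      using chart_inv_map[OF ch, of p] prod.collapse[of "chart_map c p"] by (simp add: W_def)
    then show "p \<in> (\<lambda>x. chart_inv c (x, t)) ` B" using p by (auto simp: W_def)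
  qed (auto simp: W_def B chart_map_inv[OF ch] chart_inv_dom[OF ch])
  ultimately have "(\<lambda>x. chart_inv c (x, t)) ` B \<in> {{p \<in> W. snd (chart_map c p) = t} |c W t. c \<in> F \<and> open W \<and> W \<subseteq> chart_dom c}"
    using c W_def by blast
  then show ?thesis unfolding leaf_topology_def by (rule topology_generated_by_Basis)
qed

subsection \<open>The geometry of a leaf\<close>

lemma slice_derivative:
  assumes "Q differentiable (at (x, t))"
  shows "((\<lambda>x. Q (x, t)) has_derivative (\<lambda>u. fd Q (x, t) (u, 0))) (at x)"
proof -
  have "((\<lambda>x. (x, t)) has_derivative (\<lambda>u. (u, 0))) (at x)"
    by (auto intro!: derivative_eq_intros)
  from has_derivative_compose[OF this fd_works[OF assms]] show ?thesis .
qed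

lemma Ck_on_slice:
  fixes Q :: "'a::euclidean_space \<times> real \<Rightarrow> 'b::real_normed_vector"
  assumes "open S" "open U" "Ck_on k U Q" "\<And>x. x \<in> S \<Longrightarrow> (x, t) \<in> U"
  shows "Ck_on k S (\<lambda>x. Q (x, t))"
proof -
  have "Ck_on k S (\<lambda>x::'a. (x, 0::real) + (0, t))"
    by (intro Ck_on_add Ck_on_const Ck_on_linear assms(1) bounded_linear_Pair bounded_linear_ident bounded_linear_zero)
  then have "Ck_on k S (\<lambda>x::'a. (x, t))" by simp
  then show ?thesis by (rule Ck_on_compose[OF assms(1,2) _ assms(3,4)])
qed

lemma linear_trace_conj:
  fixes D E E' :: "'a::euclidean_space \<Rightarrow> 'a"
  assumes "linear D" "inj D" "linear E" "\<And>u. E' (D u) = D (E u)"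
  shows "linear_trace E' = linear_trace E"
proof -
  obtain D' where D': "linear D'" "\<And>x. D' (D x) = x" "\<And>x. D (D' x) = x"
    using linear_injective_isomorphism[OF assms(1,2)] by blast
  have "E' v = D (E (D' v))" for v using assms(4)[of "D' v"] D'(3) by simp
  moreover have "linear (\<lambda>v. E (D' v))" using linear_compose[OF D'(1) assms(3)] by (simp add: o_def)
  ultimately have "linear_trace E' = linear_trace (\<lambda>v. E (D' (D v)))"
    using linear_trace_commute[OF assms(1), of "\<lambda>v. E (D' v)"] by (metis (no_types, lifting) ext)
  then show ?thesis by (simp add: D'(2))
qed

lemma lorentz_form_nondegenerate:
  assumes "lorentz_form B" "\<And>z. B w z = 0" shows "w = 0"
proof -
  obtain T :: "'a \<times> real \<Rightarrow> 'a \<times> real" where T: "linear T" "bij T" "\<And>u v. B (T u) (T v) = fst u \<bullet> fst v - snd u * snd v"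
    using assms(1) unfolding lorentz_form_def by blast
  obtain w' where w': "w = T w'" using T(2) by (meson bij_pointE)
  \<comment> \<open>Testing against the reflection of the vector in the time direction turns the
    Lorentz form into a Euclidean norm.\<close>
  have "fst w' \<bullet> fst w' + snd w' * snd w' = 0"
    using assms(2)[of "T (fst w', - snd w')"] T(3)[of w' "(fst w', - snd w')"] w' by simp
  then have "w' = 0" by (metis add_nonneg_eq_0_iff inner_ge_zero inner_eq_zero_iff mult_eq_0_iff prod.collapse zero_le_square zero_prod_def)
  then show ?thesis using w' linear_0[OF T(1)] by simp
qed

locale conformal_leaf =
  fixes A F :: "('m::{t2_space, second_countable_topology}, 'e::euclidean_space \<times> real) chart set"
    and g :: "('m, 'e \<times> real) tensor2" and \<xi> N :: "('m, 'e \<times> real) vfield"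
    and \<sigma> :: "'m \<Rightarrow> real" and L :: "'m set"
  assumes A: "smooth_structure A" and g: "lorentz_metric A g" and \<xi>: "vector_field A \<xi>"
    and conformal: "\<And>c p v. c \<in> A \<Longrightarrow> p \<in> chart_dom c \<Longrightarrow>
      cov_deriv (g c) (\<xi> c) (chart_map c p) v = \<sigma> p *\<^sub>R v"
    and F: "foliation A F" and N: "unit_timelike_normal A F g N"
    and L: "L \<in> leaves F" and compact_L: "compact_leaf F L" and spacelike: "spacelike_leaf F g L"
    and transversal: "\<And>p. \<not> tangent_at_leaf F \<xi> p"
begin

abbreviation (input) "G \<equiv> induced_metric g"
abbreviation (input) "V \<equiv> leaf_tangential_part g N \<xi>"

lemma FA: "c \<in> F \<Longrightarrow> c \<in> A" and F_chart: "c \<in> F \<Longrightarrow> is_chart c"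
  using foliation_chart[OF A F] by blast+

text \<open>A level set of the last coordinate may meet several leaves. The slice consists of the
  coordinates of its points in \<open>L\<close> and is the domain of one chart of the leaf.\<close>

definition "slice c t = {x. (x, t) \<in> chart_img c \<and> chart_inv c (x, t) \<in> L}"

lemma open_slice: "c \<in> F \<Longrightarrow> open (slice c t)"
  unfolding slice_def by (rule open_leaf_slice[OF A F L])

lemma slice_point:
  assumes "c \<in> F" "x \<in> slice c t"
  shows "(x, t) \<in> chart_img c" "chart_inv c (x, t) \<in> L" "chart_inv c (x, t) \<in> chart_dom c"
    "chart_map c (chart_inv c (x, t)) = (x, t)"
  using assms chart_map_inv[OF F_chart] chart_inv_dom[OF F_chart] by (auto simp: slice_def)

lemma ambient: "c \<in> F \<Longrightarrow> metric_domain (chart_img c) (g c)"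
proof
  assume c: "c \<in> F"
  show "open (chart_img c)" by (rule open_chart_img[OF F_chart[OF c]])
  have lf: "lorentz_form (g c y)" if "y \<in> chart_img c" for y
    using g FA[OF c] that unfolding lorentz_metric_def by blast
  show "bilinear (g c y)" "g c y u v = g c y v u" if "y \<in> chart_img c" for y u v
    using lf[OF that] unfolding lorentz_form_def by blast+
  show "w = 0" if "y \<in> chart_img c" "\<And>z. g c y w z = 0" for y w
    using lorentz_form_nondegenerate[OF lf[OF that(1)] that(2)] .
  show "Ck_on k (chart_img c) (\<lambda>y. g c y u v)" for k u v
    using g FA[OF c] unfolding lorentz_metric_def by (blast intro: smooth_on_Ck_on)
qed

lemma riemannian:
  assumes c: "c \<in> F" shows "riemannian_domain (slice c t) (G c t)"
proof -
  interpret M: metric_domain "chart_img c" "g c" by (rule ambient[OF c])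
  have pos: "G c t x u u > 0" if "x \<in> slice c t" "u \<noteq> 0" for x u
  proof -
    have "let (x, t) = chart_map c (chart_inv c (x, t)) in \<forall>u. u \<noteq> 0 \<longrightarrow> G c t x u u > 0"
      using spacelike c slice_point[OF c that(1)] unfolding spacelike_leaf_def by blast
    then show ?thesis using slice_point(4)[OF c that(1)] that(2) by simp
  qed
  show ?thesis
  proof
    show "open (slice c t)" by (rule open_slice[OF c])
    fix x assume x: "x \<in> slice c t"
    note y = slice_point(1)[OF c x]
    have 1: "linear (\<lambda>v. g c (x, t) w (v, 0))" and 2: "linear (\<lambda>v. g c (x, t) (v, 0) w)" for w
    proof -
      have pair: "(u + v, 0 :: real) = (u, 0) + (v, 0)" "(r *\<^sub>R u, 0 :: real) = r *\<^sub>R (u, 0)" for u v :: 'e and r :: real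
        by simp_all
      show "linear (\<lambda>v. g c (x, t) w (v, 0))" "linear (\<lambda>v. g c (x, t) (v, 0) w)"
        by (rule linearI; simp only: pair bilinear_radd[OF M.bilinear[OF y]] bilinear_rmul[OF M.bilinear[OF y]]
            bilinear_ladd[OF M.bilinear[OF y]] bilinear_lmul[OF M.bilinear[OF y]] real_scaleR_def)+
    qed
    show "bilinear (G c t x)"
      unfolding bilinear_def induced_metric_def using 1 2 by blast
    show "G c t x u v = G c t x v u" for u v
      unfolding induced_metric_def by (rule M.sym[OF y])
    show "w = 0" if "\<And>z. G c t x w z = 0" for w
      using pos[OF x, of w] that[of w] by force
    show "0 < G c t x u u" if "u \<noteq> 0" for u using pos[OF x that] .
  next
    show "Ck_on k (slice c t) (\<lambda>x. G c t x u v)" for k u v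
      unfolding induced_metric_def
      by (rule Ck_on_slice[OF open_slice[OF c] M.open_S M.Ck slice_point(1)[OF c]])
  qed
qed

section \<open>Decomposition along the unit normal\<close>

definition "f c y = - g c y (\<xi> c y) (N c y)"

lemma vfN: "vector_field A N"
  using N by (simp add: unit_timelike_normal_def)

lemma Ck_field: "vector_field A X \<Longrightarrow> c \<in> F \<Longrightarrow> Ck_on k (chart_img c) (X c)"
  using FA unfolding vector_field_def by (blast intro: smooth_on_Ck_on)

lemma N_unit: "c \<in> F \<Longrightarrow> y \<in> chart_img c \<Longrightarrow> g c y (N c y) (N c y) = -1"
  and N_normal: "c \<in> F \<Longrightarrow> y \<in> chart_img c \<Longrightarrow> g c y (N c y) (u, 0) = 0"
  using N unfolding unit_timelike_normal_def by blast+

text \<open>\<open>N\<close> has a nonzero last component, since a tangential \<open>N\<close> would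
  be orthogonal to itself while g(N, N) = -1. So \<open>w\<close> is a tangential vector plus k N,
  and pairing with \<open>N\<close> gives k = 0.\<close>

lemma normal_complement:
  assumes c: "c \<in> F" and y: "y \<in> chart_img c" and w: "g c y w (N c y) = 0"
  shows "snd w = 0"
proof -
  interpret M: metric_domain "chart_img c" "g c" by (rule ambient[OF c])
  have s: "snd (N c y) \<noteq> 0"
  proof
    assume "snd (N c y) = 0"
    then have "N c y = (fst (N c y), 0)" by (simp add: prod_eq_iff)
    then show False using N_unit[OF c y] N_normal[OF c y, of "fst (N c y)"] by (metis zero_neq_neg_one)
  qed
  define k where "k = snd w / snd (N c y)"
  have "w = (fst w - k *\<^sub>R fst (N c y), 0) + k *\<^sub>R N c y"
    using s by (simp add: prod_eq_iff k_def)
  from arg_cong[OF this, of "\<lambda>w. g c y w (N c y)"]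
  have "g c y w (N c y) = g c y (fst w - k *\<^sub>R fst (N c y), 0) (N c y) + k * g c y (N c y) (N c y)"
    unfolding bilinear_ladd[OF M.bilinear[OF y]] bilinear_lmul[OF M.bilinear[OF y]] real_scaleR_def .
  moreover have "g c y (fst w - k *\<^sub>R fst (N c y), 0) (N c y) = 0"
    by (subst M.sym[OF y]) (rule N_normal[OF c y])
  ultimately have "k = 0" using w N_unit[OF c y] by simp
  then show ?thesis using s by (simp add: k_def)
qed

lemma tangential_part_snd:
  assumes c: "c \<in> F" and y: "y \<in> chart_img c"
  shows "snd (tangential_part g N \<xi> c y) = 0"
proof (rule normal_complement[OF c y])
  interpret M: metric_domain "chart_img c" "g c" by (rule ambient[OF c])
  show "g c y (tangential_part g N \<xi> c y) (N c y) = 0"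
    by (simp add: tangential_part_def bilinear_ladd[OF M.bilinear[OF y]] bilinear_lmul[OF M.bilinear[OF y]] N_unit[OF c y])
qed

lemma tangential_part_eq:
  "c \<in> F \<Longrightarrow> (x, t) \<in> chart_img c \<Longrightarrow>
    tangential_part g N \<xi> c (x, t) = (V c t x, 0)"
  using tangential_part_snd[of c "(x, t)"] by (simp add: leaf_tangential_part_def prod_eq_iff)

lemma Ck_tangential_part:
  assumes c: "c \<in> F" shows "Ck_on k (chart_img c) (tangential_part g N \<xi> c)"
proof -
  interpret M: metric_domain "chart_img c" "g c" by (rule ambient[OF c])
  show ?thesis
    unfolding tangential_part_def[abs_def]
    by (intro Ck_on_diff Ck_on_scaleR Ck_on_minus M.open_S M.Ck_G Ck_field[OF \<xi> c] Ck_field[OF vfN c])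
qed

lemma Ck_leaf_tangential_part:
  assumes c: "c \<in> F" shows "Ck_on k (slice c t) (V c t)"
proof -
  have "Ck_on k (slice c t) (\<lambda>x. tangential_part g N \<xi> c (x, t))"
    by (rule Ck_on_slice[OF open_slice[OF c] open_chart_img[OF F_chart[OF c]] Ck_tangential_part[OF c] slice_point(1)[OF c]])
  from Ck_on_bounded_linear[OF open_slice[OF c] bounded_linear_fst this]
  show ?thesis by (simp add: leaf_tangential_part_def[abs_def])
qed

abbreviation "E c t \<equiv> cov_deriv (G c t) (V c t)"

text \<open>The connection of the leaf is the tangential part of the ambient one. For vectors
  tangent to the slice the Koszul formula contains only derivatives along the slice, which are the
  same for both metrics.\<close>

lemma leaf_christoffel:
  assumes c: "c \<in> F" and x: "x \<in> slice c t"
  shows "G c t x (christoffel (G c t) x u v) z =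
    g c (x, t) (christoffel (g c) (x, t) (u, 0) (v, 0)) (z, 0)"
proof -
  interpret M: metric_domain "chart_img c" "g c" by (rule ambient[OF c])
  interpret R: riemannian_domain "slice c t" "G c t" by (rule riemannian[OF c])
  have "R.DG x u v w = M.DG (x, t) (u, 0) (v, 0) (w, 0)" for u v w
    unfolding R.DG_def M.DG_def induced_metric_def
    using fd_eqI[OF slice_derivative[OF M.differentiable[OF slice_point(1)[OF c x]]], of "(v, 0)" "(w, 0)"] by simp
  then show ?thesis by (simp add: R.koszul[OF x] M.koszul[OF slice_point(1)[OF c x]])
qed

text \<open>Differentiating g(N, N) = -1 shows that the derivative of \<open>N\<close> is
  tangential. Differentiating g(N, v) = 0 for a constant tangential \<open>v\<close> expresses the
  shape operator through g(N, \<Gamma>(u, v)), which is symmetric.\<close>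

lemma normal_derivative:
  assumes c: "c \<in> F" and y: "y \<in> chart_img c"
  shows shape_tangent: "snd (shape_operator g N c y u) = 0"
    and shape_sym: "g c y (shape_operator g N c y (u', 0)) (v', 0) = g c y (shape_operator g N c y (v', 0)) (u', 0)"
proof -
  interpret M: metric_domain "chart_img c" "g c" by (rule ambient[OF c])
  note b = bilinear_lneg[OF M.bilinear[OF y]] bilinear_rneg[OF M.bilinear[OF y]]
  have dN: "N c differentiable (at y)"
    using Ck_on_imp_differentiable[OF Ck_field[OF vfN c, of "Suc 0"] y] .
  have "((\<lambda>y. g c y (N c y) (N c y)) has_derivative (\<lambda>_. 0)) (at y)"
    by (rule has_derivative_transform_within_open[OF has_derivative_const[of "-1"] M.open_S y])
       (simp add: N_unit[OF c])
  from fun_cong[OF has_derivative_unique[OF M.G_derivative[OF y dN dN] this], of u]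
  have "g c y (cov_deriv (g c) (N c) y u) (N c y) + g c y (N c y) (cov_deriv (g c) (N c) y u) = 0" .
  then have "g c y (shape_operator g N c y u) (N c y) = 0"
    using M.sym[OF y, of "N c y"] by (simp add: shape_operator_def b)
  then show "snd (shape_operator g N c y u) = 0" by (rule normal_complement[OF c y])
  have *: "g c y (shape_operator g N c y (u, 0)) (v, 0) = g c y (N c y) (christoffel (g c) y (u, 0) (v, 0))" for u v
  proof -
    have "((\<lambda>y. g c y (N c y) (v, 0)) has_derivative (\<lambda>_. 0)) (at y)"
      by (rule has_derivative_transform_within_open[OF has_derivative_const[of 0] M.open_S y])
         (simp add: N_normal[OF c])
    from fun_cong[OF has_derivative_unique[OF M.G_derivative[OF y dN differentiable_const] this], of "(u, 0)"]
    have "g c y (cov_deriv (g c) (N c) y (u, 0)) (v, 0) + g c y (N c y) (cov_deriv (g c) (\<lambda>_. (v, 0)) y (u, 0)) = 0" .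
    moreover have "cov_deriv (g c) (\<lambda>_. (v, 0)) y (u, 0) = christoffel (g c) y (u, 0) (v, 0)"
      by (simp add: cov_deriv_def)
    ultimately show ?thesis by (simp add: shape_operator_def b)
  qed
  show "g c y (shape_operator g N c y (u', 0)) (v', 0) = g c y (shape_operator g N c y (v', 0)) (u', 0)"
    unfolding * by (simp add: M.christoffel_sym[OF y, of "(u', 0)"])
qed

text \<open>This is \<open>\<nabla>\<^sub>u \<xi>\<^sup>\<top> = \<sigma> u + f A u\<close>.\<close>

lemma leaf_derivative:
  assumes c: "c \<in> F" and x: "x \<in> slice c t"
  shows "G c t x (E c t x u) z =
    \<sigma> (chart_inv c (x, t)) * G c t x u z + f c (x, t) * g c (x, t) (shape_operator g N c (x, t) (u, 0)) (z, 0)"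
proof -
  interpret M: metric_domain "chart_img c" "g c" by (rule ambient[OF c])
  interpret R: riemannian_domain "slice c t" "G c t" by (rule riemannian[OF c])
  let ?y = "(x, t)" and ?P = "tangential_part g N \<xi> c" and ?V = "V c t"
  note y = slice_point(1)[OF c x]
  note bl = bilinear_ladd[OF M.bilinear[OF y]] bilinear_lmul[OF M.bilinear[OF y]] bilinear_lneg[OF M.bilinear[OF y]]
    bilinear_lsub[OF M.bilinear[OF y]]
  have dP: "?P differentiable (at ?y)" using Ck_on_imp_differentiable[OF Ck_tangential_part[OF c, of "Suc 0"] y] .
  have d\<xi>: "\<xi> c differentiable (at ?y)" using Ck_on_imp_differentiable[OF Ck_field[OF \<xi> c, of "Suc 0"] y] .
  have dN: "N c differentiable (at ?y)" using Ck_on_imp_differentiable[OF Ck_field[OF vfN c, of "Suc 0"] y] .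
  have "((\<lambda>x. fst (?P (x, t))) has_derivative (\<lambda>u. fst (fd ?P ?y (u, 0)))) (at x)"
    by (rule has_derivative_fst[OF slice_derivative[OF dP]])
  then have fdV: "fd ?V x u = fst (fd ?P ?y (u, 0))"
    by (simp add: leaf_tangential_part_def[abs_def] fd_eqI)
  \<comment> \<open>The last component of the tangential part vanishes on the whole chart and not
    just at the point, so it can be differentiated.\<close>
  have "snd (fd ?P ?y (u, 0)) = 0"
  proof -
    have "((\<lambda>y. snd (?P y)) has_derivative (\<lambda>u. snd (fd ?P ?y u))) (at ?y)"
      by (rule has_derivative_snd[OF fd_works[OF dP]])
    moreover have "fd (\<lambda>y. snd (?P y)) ?y (u, 0) = 0"
      by (rule fd_eq_0[OF M.open_S y]) (rule tangential_part_snd[OF c])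
    ultimately show ?thesis by (simp add: fd_eqI)
  qed
  then have fdP: "fd ?P ?y (u, 0) = (fd ?V x u, 0)" using fdV by (simp add: prod_eq_iff)
  have "G c t x (E c t x u) z = G c t x (fd ?V x u) z
      + G c t x (christoffel (G c t) x u (?V x)) z"
    by (simp add: cov_deriv_def bilinear_ladd[OF R.bilinear[OF x]])
  also have "\<dots> = g c ?y (cov_deriv (g c) ?P ?y (u, 0)) (z, 0)"
    using tangential_part_eq[OF c y]
    by (simp add: leaf_christoffel[OF c x] cov_deriv_def bl fdP) (simp add: induced_metric_def)
  finally have 1: "G c t x (E c t x u) z = g c ?y (cov_deriv (g c) ?P ?y (u, 0)) (z, 0)" .
  \<comment> \<open>\<open>k\<close> is \<open>- f\<close>, and the covariant derivative of
    \<open>N\<close> is minus the shape operator; the two signs cancel.\<close>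
  define k where "k y = g c y (\<xi> c y) (N c y)" for y
  have dk: "k differentiable (at ?y)"
    unfolding k_def
    by (rule Ck_on_imp_differentiable[OF M.Ck_G[OF Ck_field[OF \<xi> c] Ck_field[OF vfN c], of "Suc 0"] y])
  have "?P = (\<lambda>y. \<xi> c y + k y *\<^sub>R N c y)" by (simp add: tangential_part_def[abs_def] k_def)
  moreover have "((\<lambda>y. \<xi> c y + k y *\<^sub>R N c y) has_derivative
      (\<lambda>u. fd (\<xi> c) ?y u + (k ?y *\<^sub>R fd (N c) ?y u + fd k ?y u *\<^sub>R N c ?y))) (at ?y)"
    by (intro has_derivative_add has_derivative_scaleR fd_works d\<xi> dN dk)
  ultimately have "cov_deriv (g c) ?P ?y w = cov_deriv (g c) (\<xi> c) ?y w + k ?y *\<^sub>R cov_deriv (g c) (N c) ?y w + fd k ?y w *\<^sub>R N c ?y" for w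
    by (simp add: cov_deriv_def fd_eqI linear_add[OF M.christoffel_linear(1)[OF y]]
        linear_cmul[OF M.christoffel_linear(1)[OF y]] algebra_simps)
  moreover have "cov_deriv (g c) (\<xi> c) ?y w = \<sigma> (chart_inv c ?y) *\<^sub>R w" for w
    using conformal[OF FA[OF c] slice_point(3)[OF c x]] slice_point(4)[OF c x] by simp
  ultimately have "cov_deriv (g c) ?P ?y (u, 0) = \<sigma> (chart_inv c ?y) *\<^sub>R (u, 0) +
      f c ?y *\<^sub>R shape_operator g N c ?y (u, 0) + fd k ?y (u, 0) *\<^sub>R N c ?y"
    by (simp only: f_def k_def shape_operator_def scaleR_minus_left scaleR_minus_right minus_minus)
  \<comment> \<open>The derivative of the coefficient \<open>k\<close> multiplies \<open>N\<close>
    and disappears when paired with a tangential vector.\<close>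
  then show ?thesis
    unfolding 1 by (simp only: bl N_normal[OF c y]) (simp add: induced_metric_def)
qed

lemma E_linear:
  assumes c: "c \<in> F" and x: "x \<in> slice c t" shows "linear (E c t x)"
proof -
  interpret R: riemannian_domain "slice c t" "G c t" by (rule riemannian[OF c])
  show ?thesis
    by (rule R.cov_deriv_linear[OF x Ck_on_imp_differentiable[OF Ck_leaf_tangential_part[OF c, of "Suc 0"] x]])
qed

lemma E_selfadjoint:
  assumes c: "c \<in> F" and x: "x \<in> slice c t"
  shows "G c t x (E c t x u) v = G c t x u (E c t x v)"
proof -
  interpret R: riemannian_domain "slice c t" "G c t" by (rule riemannian[OF c])
  have "G c t x (E c t x u) v = G c t x (E c t x v) u"
    unfolding leaf_derivative[OF c x] using shape_sym[OF c slice_point(1)[OF c x], of u v] R.sym[OF x, of u v] by simp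
  then show ?thesis using R.sym[OF x] by simp
qed

lemma shape_operator_of_scalar_E:
  assumes c: "c \<in> F" and x: "x \<in> slice c t" and E: "\<And>u. E c t x u = \<mu> *\<^sub>R u" and f: "f c (x, t) \<noteq> 0"
  shows "shape_operator g N c (x, t) (u, 0) = ((\<mu> - \<sigma> (chart_inv c (x, t))) / f c (x, t)) *\<^sub>R (u, 0)"
proof -
  interpret R: riemannian_domain "slice c t" "G c t" by (rule riemannian[OF c])
  let ?s = "\<sigma> (chart_inv c (x, t))"
  define a where "a = fst (shape_operator g N c (x, t) (u, 0))"
  have a: "shape_operator g N c (x, t) (u, 0) = (a, 0)"
    using shape_tangent[OF c slice_point(1)[OF c x], of "(u, 0)"] by (simp add: a_def prod_eq_iff)
  have "f c (x, t) *\<^sub>R a = (\<mu> - ?s) *\<^sub>R u"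
  proof (rule R.G_inject[OF x])
    fix z
    have "\<mu> * G c t x u z = ?s * G c t x u z + f c (x, t) * G c t x a z"
      using leaf_derivative[OF c x, of u z] E[of u] a bilinear_lmul[OF R.bilinear[OF x]] by (simp add: induced_metric_def[of g c t x a])
    then show "G c t x (f c (x, t) *\<^sub>R a) z = G c t x ((\<mu> - ?s) *\<^sub>R u) z"
      by (simp add: bilinear_lmul[OF R.bilinear[OF x]] left_diff_distrib)
  qed
  then have "a = ((\<mu> - ?s) / f c (x, t)) *\<^sub>R u"
    using f by (metis (no_types, lifting) divide_inverse_commute inverse_eq_divide nonzero_divide_eq_eq scaleR_scaleR vector_fraction_eq_iff)
  then show ?thesis using a by simp
qed

section \<open>Changes of foliated charts\<close>

lemma metric_transform:
  assumes "c \<in> F" "d \<in> F" "p \<in> chart_dom c" "p \<in> chart_dom d"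
  shows "g c (chart_map c p) u v = g d (chart_map d p)
    (fd (transition c d) (chart_map c p) u) (fd (transition c d) (chart_map c p) v)"
  using g FA[OF assms(1)] FA[OF assms(2)] assms(3,4) unfolding lorentz_metric_def Let_def by blast

lemma field_transform:
  assumes "vector_field A X" "c \<in> F" "d \<in> F" "p \<in> chart_dom c" "p \<in> chart_dom d"
  shows "X d (chart_map d p) = fd (transition c d) (chart_map c p) (X c (chart_map c p))"
  using assms(1) FA[OF assms(2)] FA[OF assms(3)] assms(4,5) unfolding vector_field_def by blast

lemma f_transform:
  assumes "c \<in> F" "d \<in> F" "p \<in> chart_dom c" "p \<in> chart_dom d"
  shows "f d (chart_map d p) = f c (chart_map c p)"
  unfolding f_def field_transform[OF \<xi> assms] field_transform[OF vfN assms] metric_transform[OF assms] ..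

text \<open>A zero of \<open>f\<close> in one chart is a zero in all foliated charts at the point,
  because \<open>f\<close> is invariant. Then \<open>\<xi>\<close> is orthogonal to \<open>N\<close>
  in each of them, hence tangent to the leaf.\<close>

lemma f_nonzero:
  assumes c: "c \<in> F" and p: "p \<in> chart_dom c"
  shows "f c (chart_map c p) \<noteq> 0"
proof
  assume f0: "f c (chart_map c p) = 0"
  have "tangent_at_leaf F \<xi> p"
    unfolding tangent_at_leaf_def
  proof (intro ballI impI)
    fix d assume d: "d \<in> F" "p \<in> chart_dom d"
    have "g d (chart_map d p) (\<xi> d (chart_map d p)) (N d (chart_map d p)) = 0"
      using f_transform[OF c d(1) p d(2)] f0 by (simp add: f_def)
    from normal_complement[OF d(1) chart_map_img[OF F_chart[OF d(1)] d(2)] this]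
    show "\<exists>u. \<xi> d (chart_map d p) = (u, 0)" by (metis prod.collapse)
  qed
  then show False using transversal by blast
qed

text \<open>The transition map between charts of the leaf. The height in the target chart is no
  argument, as it is determined by the point.\<close>

definition "\<phi> c t d x = fst (transition c d (x, t))"

text \<open>On the overlap of two leaf charts the last coordinate of the ambient transition map is
  the constant \<open>s\<close>. So this map restricts to \<phi>, and its derivative takes vectors
  (u, 0) to vectors of this form.\<close>

lemma leaf_overlap:
  fixes s t :: real
  assumes c: "c \<in> F" and d: "d \<in> F"
  defines "O' \<equiv> {x \<in> slice c t. chart_inv c (x, t) \<in> (\<lambda>x. chart_inv d (x, s)) ` slice d s}"
  shows "open O'"
    and "x \<in> O' \<Longrightarrow> transition c d (x, t) = (\<phi> c t d x, s)"
    and "x \<in> O' \<Longrightarrow> \<phi> c t d x \<in> slice d s"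
    and "x \<in> O' \<Longrightarrow> chart_inv d (\<phi> c t d x, s) = chart_inv c (x, t)"
    and "Ck_on k O' (\<phi> c t d)"
    and "x \<in> O' \<Longrightarrow> fd (transition c d) (x, t) (u, 0) = (fd (\<phi> c t d) x u, 0)"
proof -
  \<comment> \<open>Membership in the image of the other slice becomes a condition on the height in
    \<open>d\<close>, to which \<open>foliation_locally_constant\<close> applies.\<close>
  have O': "x \<in> O' \<longleftrightarrow> x \<in> slice c t \<and> chart_inv c (x, t) \<in> chart_dom d \<and> snd (chart_map d (chart_inv c (x, t))) = s" for x
  proof
    assume "x \<in> O'"
    then obtain x' where x': "x' \<in> slice d s" "chart_inv c (x, t) = chart_inv d (x', s)" "x \<in> slice c t" by (auto simp: O'_def)
    then show "x \<in> slice c t \<and> chart_inv c (x, t) \<in> chart_dom d \<and> snd (chart_map d (chart_inv c (x, t))) = s"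
      using slice_point[OF d x'(1)] by simp
  next
    assume x: "x \<in> slice c t \<and> chart_inv c (x, t) \<in> chart_dom d \<and> snd (chart_map d (chart_inv c (x, t))) = s"
    let ?p = "chart_inv c (x, t)"
    have e: "(fst (chart_map d ?p), s) = chart_map d ?p" using x by (simp add: prod_eq_iff)
    have "fst (chart_map d ?p) \<in> slice d s"
      unfolding slice_def using x slice_point(2)[OF c, of x t] chart_map_img[OF F_chart[OF d], of ?p] chart_inv_map[OF F_chart[OF d], of ?p]
      by (simp add: e)
    moreover have "chart_inv d (fst (chart_map d ?p), s) = ?p"
      unfolding e using x by (simp add: chart_inv_map[OF F_chart[OF d]])
    ultimately show "x \<in> O'" using x unfolding O'_def by (metis (mono_tags, lifting) imageI mem_Collect_eq)
  qed
  have "O' = slice c t \<inter> {x. (x, t) \<in> chart_img c \<and> chart_inv c (x, t) \<in> chart_dom d \<and> snd (chart_map d (chart_inv c (x, t))) = s}"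
    using O' slice_point(1)[OF c] by blast
  then show op: "open O'"
    using foliation_locally_constant[OF A F c d open_chart_dom[OF F_chart[OF d]] subset_refl, of t s] open_slice[OF c] by auto
  show tr: "transition c d (x, t) = (\<phi> c t d x, s)" if "x \<in> O'" for x
    using that[unfolded O'] by (simp add: \<phi>_def transition_def prod_eq_iff)
  show inv: "chart_inv d (\<phi> c t d x, s) = chart_inv c (x, t)" if x: "x \<in> O'" for x
    unfolding tr[OF x, symmetric] using x[unfolded O'] by (simp add: transition_def chart_inv_map[OF F_chart[OF d]])
  show "\<phi> c t d x \<in> slice d s" if x: "x \<in> O'" for x
    unfolding slice_def mem_Collect_eq inv[OF x] unfolding tr[OF x, symmetric]
    using x[unfolded O'] slice_point(2)[OF c, of x t] by (simp add: transition_def chart_map_img[OF F_chart[OF d]])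
  have T: "(x, t) \<in> chart_map c ` (chart_dom c \<inter> chart_dom d)" if "x \<in> O'" for x
    using that[unfolded O'] slice_point(3,4)[OF c, of x t] by (metis IntI imageI)
  have "Ck_on k O' (\<lambda>x. transition c d (x, t))" for k
    by (rule Ck_on_slice[OF op open_overlap_image[OF A FA[OF c] FA[OF d]] Ck_transition[OF A FA[OF c] FA[OF d]] T])
  from Ck_on_bounded_linear[OF op bounded_linear_fst this]
  show "Ck_on k O' (\<phi> c t d)" by (simp add: \<phi>_def[abs_def])
  show "fd (transition c d) (x, t) (u, 0) = (fd (\<phi> c t d) x u, 0)" if x: "x \<in> O'"
  proof -
    have "transition c d differentiable (at (x, t))"
      using Ck_on_imp_differentiable[OF Ck_transition[OF A FA[OF c] FA[OF d], of "Suc 0"] T[OF x]] .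
    note D = slice_derivative[OF this]
    have "fd (\<phi> c t d) x u = fst (fd (transition c d) (x, t) (u, 0))"
      using fd_eqI[OF has_derivative_fst[OF D]] by (simp add: \<phi>_def[abs_def])
    moreover have "snd (fd (transition c d) (x, t) (u, 0)) = 0"
    proof -
      have "((\<lambda>x. snd (transition c d (x, t))) has_derivative (\<lambda>u. 0)) (at x)"
        by (rule has_derivative_transform_within_open[OF has_derivative_const[of s] op x]) (simp add: tr)
      from has_derivative_unique[OF this has_derivative_snd[OF D]] show ?thesis by metis
    qed
    ultimately show ?thesis by (simp add: prod_eq_iff)
  qed
qed

lemma leaf_transform:
  assumes c: "c \<in> F" and d: "d \<in> F" and x: "x \<in> slice c t"
    and ov: "chart_inv c (x, t) \<in> (\<lambda>x. chart_inv d (x, s)) ` slice d s"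
  shows metric_leaf: "G c t x u v =
      G d s (\<phi> c t d x) (fd (\<phi> c t d) x u) (fd (\<phi> c t d) x v)"
    and V_leaf: "V d s (\<phi> c t d x) = fd (\<phi> c t d) x (V c t x)"
proof -
  have xO: "x \<in> {x \<in> slice c t. chart_inv c (x, t) \<in> (\<lambda>x. chart_inv d (x, s)) ` slice d s}" using x ov by simp
  let ?p = "chart_inv c (x, t)"
  note sp = slice_point[OF c x]
  note lo = leaf_overlap[OF c d, where t = t and s = s]
  have pd: "?p \<in> chart_dom d" using ov slice_point(3)[OF d] by auto
  have cd: "chart_map d ?p = (\<phi> c t d x, s)"
    using lo(2)[OF xO] transition_chart[OF A FA[OF c] sp(3), of d] sp(4) by simp
  note D = lo(6)[OF xO]
  show "G c t x u v = G d s (\<phi> c t d x) (fd (\<phi> c t d) x u) (fd (\<phi> c t d) x v)"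
    using metric_transform[OF c d sp(3) pd, of "(u, 0)" "(v, 0)"] by (simp add: induced_metric_def sp(4) cd D)
  have lin: "linear (fd (transition c d) (chart_map c ?p))"
    by (rule linear_frechet_derivative[OF transition_differentiable[OF A FA[OF c] FA[OF d] sp(3) pd]])
  have "tangential_part g N \<xi> d (chart_map d ?p) = fd (transition c d) (chart_map c ?p) (tangential_part g N \<xi> c (chart_map c ?p))"
    using f_transform[OF c d sp(3) pd] field_transform[OF \<xi> c d sp(3) pd] field_transform[OF vfN c d sp(3) pd]
    by (simp add: tangential_part_def f_def linear_add[OF lin] linear_cmul[OF lin])
  then show "V d s (\<phi> c t d x) = fd (\<phi> c t d) x (V c t x)"
    using tangential_part_eq[OF c sp(1)] slice_point(1)[OF d lo(3)[OF xO]] tangential_part_eq[OF d]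
    by (simp add: cd sp(4) D)
qed

text \<open>The transition map is an isometry that carries the tangential field to itself, so
  \<open>cov_deriv_natural\<close> applies. The two values of \<open>E\<close> are conjugate and
  have the same trace.\<close>

lemma leaf_transform_E:
  assumes c: "c \<in> F" and d: "d \<in> F" and x: "x \<in> slice c t"
    and ov: "chart_inv c (x, t) \<in> (\<lambda>x. chart_inv d (x, s)) ` slice d s"
  shows E_leaf: "E d s (\<phi> c t d x) (fd (\<phi> c t d) x u) = fd (\<phi> c t d) x (E c t x u)"
    and trace_leaf: "linear_trace (E d s (\<phi> c t d x)) = linear_trace (E c t x)"
proof -
  let ?O = "{x \<in> slice c t. chart_inv c (x, t) \<in> (\<lambda>x. chart_inv d (x, s)) ` slice d s}"
  have xO: "x \<in> ?O" using x ov by simp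
  note lo = leaf_overlap[OF c d, where t = t and s = s]
  interpret R: riemannian_domain "slice c t" "G c t" by (rule riemannian[OF c])
  interpret R': riemannian_domain "slice d s" "G d s" by (rule riemannian[OF d])
  show *: "E d s (\<phi> c t d x) (fd (\<phi> c t d) x u) = fd (\<phi> c t d) x (E c t x u)" for u
  proof (rule cov_deriv_natural[OF R.metric_domain_axioms R'.metric_domain_axioms lo(1) _ xO lo(5) lo(3)])
    show "V c t differentiable at x"
      by (rule Ck_on_imp_differentiable[OF Ck_leaf_tangential_part[OF c, of "Suc 0"] x])
    show "V d s differentiable at (\<phi> c t d x)"
      by (rule Ck_on_imp_differentiable[OF Ck_leaf_tangential_part[OF d, of "Suc 0"] lo(3)[OF xO]])
  qed (use metric_leaf[OF c d] V_leaf[OF c d] in auto)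
  have lin: "linear (fd (\<phi> c t d) x)"
    by (rule linear_frechet_derivative[OF Ck_on_imp_differentiable[OF lo(5)[of "Suc 0"] xO]])
  have "inj (fd (\<phi> c t d) x)"
  proof (rule linear_injective_0[OF lin, THEN iffD2], intro allI impI)
    fix w assume "fd (\<phi> c t d) x w = 0"
    then have "G c t x w z = 0" for z
      using metric_leaf[OF c d x ov, of w z] bilinear_lzero[OF R'.bilinear[OF lo(3)[OF xO]]] by simp
    then show "w = 0" using R.nondegenerate[OF x] by blast
  qed
  then show "linear_trace (E d s (\<phi> c t d x)) = linear_trace (E c t x)"
    using linear_trace_conj[where E' = "E d s (\<phi> c t d x)", OF lin _ E_linear[OF c x]] * by blast
qed

section \<open>The field W and its integration over the leaf\<close>

definition "W c t y = E c t y (V c t y) -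
  linear_trace (E c t y) *\<^sub>R V c t y"

lemma Ck_W:
  assumes c: "c \<in> F" shows "Ck_on k (slice c t) (W c t)"
proof -
  interpret R: riemannian_domain "slice c t" "G c t" by (rule riemannian[OF c])
  note CV = Ck_leaf_tangential_part[OF c]
  have CE: "Ck_on k (slice c t) (\<lambda>y. E c t y u)" for u by (rule R.Ck_cov_deriv[OF CV])
  have "Ck_on k (slice c t) (\<lambda>y. E c t y (V c t y))"
    by (rule Ck_on_apply_family[where A = "E c t", OF R.open_S E_linear[OF c] CE CV])
  moreover have "Ck_on k (slice c t) (\<lambda>y. linear_trace (E c t y) *\<^sub>R V c t y)"
    unfolding linear_trace_def
    by (intro Ck_on_scaleR Ck_on_sum Ck_on_inner Ck_on_const CE CV R.open_S)
  ultimately show ?thesis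
    unfolding W_def[abs_def] by (rule Ck_on_diff[OF R.open_S])
qed

lemma W_leaf:
  assumes c: "c \<in> F" and d: "d \<in> F" and x: "x \<in> slice c t"
    and ov: "chart_inv c (x, t) \<in> (\<lambda>x. chart_inv d (x, s)) ` slice d s"
  shows "W d s (\<phi> c t d x) = fd (\<phi> c t d) x (W c t x)"
proof -
  have xO: "x \<in> {x \<in> slice c t. chart_inv c (x, t) \<in> (\<lambda>x. chart_inv d (x, s)) ` slice d s}" using x ov by simp
  have lin: "linear (fd (\<phi> c t d) x)"
    by (rule linear_frechet_derivative[OF Ck_on_imp_differentiable[OF leaf_overlap(5)[OF c d, where t = t and s = s and k = "Suc 0"] xO]])
  show ?thesis
    by (simp add: W_def V_leaf[OF c d x ov] E_leaf[OF c d x ov] trace_leaf[OF c d x ov]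
        linear_diff[OF lin] linear_cmul[OF lin])
qed

lemma density_leaf:
  assumes c: "c \<in> F" and d: "d \<in> F" and x: "x \<in> slice c t"
    and ov: "chart_inv c (x, t) \<in> (\<lambda>x. chart_inv d (x, s)) ` slice d s"
  shows "volume_density (G c t) x =
    volume_density (G d s) (\<phi> c t d x) * \<bar>edet (fd (\<phi> c t d) x)\<bar>"
proof -
  have xO: "x \<in> {x \<in> slice c t. chart_inv c (x, t) \<in> (\<lambda>x. chart_inv d (x, s)) ` slice d s}" using x ov by simp
  have lin: "linear (fd (\<phi> c t d) x)"
    by (rule linear_frechet_derivative[OF Ck_on_imp_differentiable[OF leaf_overlap(5)[OF c d, where t = t and s = s and k = "Suc 0"] xO]])
  show ?thesis
    by (rule density_natural[OF riemannian[OF c] riemannian[OF d] x leaf_overlap(3)[OF c d xO] lin])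
       (rule metric_leaf[OF c d x ov])
qed

text \<open>The leaf is covered by coordinate balls, each recorded as a tuple of a foliated chart, the height of
  a plaque in it, and the center and the radius of a ball in this plaque.\<close>

abbreviation (input) "height \<equiv> \<lambda>i::('m, 'e \<times> real) chart \<times> real \<times> 'e \<times> real. fst (snd i)"
abbreviation (input) "center \<equiv> \<lambda>i::('m, 'e \<times> real) chart \<times> real \<times> 'e \<times> real. fst (snd (snd i))"
abbreviation (input) "radius \<equiv> \<lambda>i::('m, 'e \<times> real) chart \<times> real \<times> 'e \<times> real. snd (snd (snd i))"

text \<open>Compactness in the leaf topology yields finitely many balls. A prescribed ball is
  included because the vanishing of the divergence will be concluded only inside the balls of the
  cover.\<close>

lemma finite_chart_cover:
  assumes c: "c \<in> F" and r: "r > 0" "cball x r \<subseteq> slice c t"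
  obtains I where "finite I" "(c, t, x, r) \<in> I"
    "\<And>i. i \<in> I \<Longrightarrow> fst i \<in> F \<and> radius i > 0 \<and>
      cball (center i) (radius i) \<subseteq> slice (fst i) (height i)"
    "\<And>p. p \<in> L \<Longrightarrow> \<exists>i\<in>I. p \<in> (\<lambda>x. chart_inv (fst i) (x, height i)) ` ball (center i) (radius i)"
proof -
  define I' where "I' = {(c, t, x, r) | c t x r. c \<in> F \<and> r > 0 \<and> cball x r \<subseteq> slice c t}"
  have I': "fst i \<in> F \<and> radius i > 0 \<and>
      cball (center i) (radius i) \<subseteq> slice (fst i) (height i)" if "i \<in> I'" for i
    using that by (auto simp: I'_def)
  define O' where "O' i = (\<lambda>x. chart_inv (fst i) (x, height i)) ` ball (center i) (radius i)"
    for i :: "('m, 'e \<times> real) chart \<times> real \<times> 'e \<times> real"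
  have op: "openin (leaf_topology F) (O' i)" if "i \<in> I'" for i
    unfolding O'_def
  proof (rule openin_leaf_ball[OF A F _ open_ball])
    show "fst i \<in> F" using I'[OF that] by simp
    fix x assume "x \<in> ball (center i) (radius i)"
    then have "x \<in> slice (fst i) (height i)"
      using I'[OF that] ball_subset_cball[of "center i" "radius i"] by blast
    then show "(x, height i) \<in> chart_img (fst i)" by (simp add: slice_def)
  qed
  have cov: "\<exists>i\<in>I'. p \<in> O' i" if p: "p \<in> L" for p
  proof -
    have "p \<in> (\<Union>c\<in>F. chart_dom c)" using F by (simp add: foliation_def)
    then obtain d where d: "d \<in> F" "p \<in> chart_dom d" by blast
    obtain y s where ys: "chart_map d p = (y, s)" by fastforce
    have inv: "chart_inv d (y, s) = p" using chart_inv_map[OF F_chart[OF d(1)] d(2)] ys by simp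
    have "y \<in> slice d s"
      unfolding slice_def using inv p chart_map_img[OF F_chart[OF d(1)] d(2)] ys by simp
    then obtain e where e: "e > 0" "cball y e \<subseteq> slice d s"
      using open_slice[OF d(1)] open_contains_cball by blast
    have "(d, s, y, e) \<in> I'" unfolding I'_def using d(1) e by blast
    moreover have "p \<in> O' (d, s, y, e)" unfolding O'_def using e(1) inv by (auto intro!: image_eqI[of _ _ y])
    ultimately show ?thesis by blast
  qed
  have "\<exists>\<F>. finite \<F> \<and> \<F> \<subseteq> O' ` I' \<and> L \<subseteq> \<Union> \<F>"
    using compact_L op cov unfolding compact_leaf_def compactin_def by (auto simp: subset_iff)
  then obtain I0 where I0: "finite I0" "I0 \<subseteq> I'" "L \<subseteq> \<Union> (O' ` I0)"
    by (metis finite_subset_image)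
  have i0: "(c, t, x, r) \<in> I'" unfolding I'_def using c r by blast
  show thesis
  proof (rule that[of "insert (c, t, x, r) I0"])
    show "finite (insert (c, t, x, r) I0)" "(c, t, x, r) \<in> insert (c, t, x, r) I0" using I0(1) by simp_all
    show "fst i \<in> F \<and> radius i > 0 \<and>
        cball (center i) (radius i) \<subseteq> slice (fst i) (height i)"
      if "i \<in> insert (c, t, x, r) I0" for i
      by (rule I') (use that i0 I0(2) in blast)
    show "\<exists>i\<in>insert (c, t, x, r) I0. p \<in> (\<lambda>x. chart_inv (fst i) (x, height i)) ` ball (center i) (radius i)"
      if "p \<in> L" for p
      unfolding O'_def[symmetric] using that I0(3) by blast
  qed
qed

lemma E_scalar:
  assumes ric: "\<And>c x t. c \<in> F \<Longrightarrow> x \<in> slice c t \<Longrightarrow>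
      ricci (G c t) x (V c t x) (V c t x)
      \<ge> (real DIM('e) - 1) / real DIM('e) * (divergence (G c t) (V c t) x)\<^sup>2"
    and c0: "c0 \<in> F" and x0: "x0 \<in> slice c0 t0"
  shows "E c0 t0 x0 u = (linear_trace (E c0 t0 x0) / DIM('e)) *\<^sub>R u"
proof -
  have div_W: "divergence (G c t) (W c t) x \<ge> linear_trace (\<lambda>u. E c t x (E c t x u)) -
      (linear_trace (E c t x))\<^sup>2 / DIM('e)"
    and trace_ge: "linear_trace (\<lambda>u. E c t x (E c t x u)) \<ge> (linear_trace (E c t x))\<^sup>2 / DIM('e)"
    if c: "c \<in> F" and x: "x \<in> slice c t" for c x t
  proof -
    interpret R: riemannian_domain "slice c t" "G c t" by (rule riemannian[OF c])
    have "divergence (G c t) (W c t) x =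
      ricci (G c t) x (V c t x) (V c t x) +
      linear_trace (\<lambda>u. E c t x (E c t x u)) - (linear_trace (E c t x))\<^sup>2"
      unfolding W_def[abs_def] by (rule R.bochner_identity[OF x Ck_leaf_tangential_part[OF c]])
    moreover have "ricci (G c t) x (V c t x) (V c t x)
        \<ge> (linear_trace (E c t x))\<^sup>2 - (linear_trace (E c t x))\<^sup>2 / DIM('e)"
    proof -
      \<comment> \<open>With s = (tr E)^2 the hypothesis cancels the term -(tr E)^2 of the Bochner
        identity up to -(tr E)^2/n.\<close>
      have "(real DIM('e) - 1) / real DIM('e) * s = s - s / DIM('e)" for s
        by (simp add: field_simps)
      then show ?thesis using ric[OF c x] unfolding divergence_def by metis
    qed
    ultimately show "divergence (G c t) (W c t) x \<ge> linear_trace (\<lambda>u. E c t x (E c t x u)) -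
      (linear_trace (E c t x))\<^sup>2 / DIM('e)" by linarith
    show "linear_trace (\<lambda>u. E c t x (E c t x u)) \<ge> (linear_trace (E c t x))\<^sup>2 / DIM('e)"
      by (rule inner_form.selfadjoint_trace_inequality(1)[where E = "E c t x", OF R.inner_form[OF x] E_linear[OF c x] E_selfadjoint[OF c x]])
  qed
  obtain r where r: "r > 0" "cball x0 r \<subseteq> slice c0 t0"
    using open_slice[OF c0] x0 open_contains_cball by blast
  obtain I where I: "finite I" "(c0, t0, x0, r) \<in> I"
    and valid: "\<And>i. i \<in> I \<Longrightarrow> fst i \<in> F \<and> radius i > 0 \<and>
      cball (center i) (radius i) \<subseteq> slice (fst i) (height i)"
    and cover: "\<And>p. p \<in> L \<Longrightarrow> \<exists>i\<in>I. p \<in> (\<lambda>x. chart_inv (fst i) (x, height i)) ` ball (center i) (radius i)"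
    by (rule finite_chart_cover[OF c0 r]) blast
  have IF: "fst i \<in> F" if "i \<in> I" for i using valid[OF that] by simp
  interpret atlas: compact_atlas I "\<lambda>i. slice (fst i) (height i)" "\<lambda>i x. chart_inv (fst i) (x, height i)"
    "\<lambda>i. center i" "\<lambda>i. radius i" "\<lambda>i j. \<phi> (fst i) (height i) (fst j)"
    "\<lambda>i. volume_density (G (fst i) (height i))" "\<lambda>i. W (fst i) (height i)"
  proof
    show "finite I" by (rule I(1))
  next
    fix i assume i: "i \<in> I"
    note c = IF[OF i]
    interpret R: riemannian_domain "slice (fst i) (height i)" "G (fst i) (height i)"
      by (rule riemannian[OF c])
    show "open (slice (fst i) (height i))" by (rule open_slice[OF c])
    show "inj_on (\<lambda>x. chart_inv (fst i) (x, height i)) (slice (fst i) (height i))"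
      using slice_point(4)[OF c] by (metis (no_types, lifting) inj_onI prod.inject)
    show "continuous_on (slice (fst i) (height i)) (\<lambda>x. chart_inv (fst i) (x, height i))"
      by (rule continuous_on_compose2[OF continuous_chart_inv[OF F_chart[OF c]]])
         (auto intro!: continuous_intros simp: slice_def)
    show "0 < radius i" "cball (center i) (radius i) \<subseteq> slice (fst i) (height i)"
      using valid[OF i] by auto
    show "Ck_on 1 (slice (fst i) (height i)) (volume_density (G (fst i) (height i)))"
      by (rule R.Ck_density)
    show "Ck_on 1 (slice (fst i) (height i)) (W (fst i) (height i))"
      by (rule Ck_W[OF c])
    fix x assume x: "x \<in> slice (fst i) (height i)"
    show "\<exists>j\<in>I. chart_inv (fst i) (x, height i) \<in>
        (\<lambda>x. chart_inv (fst j) (x, height j)) ` ball (center j) (radius j)"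
      by (rule cover[OF slice_point(2)[OF c x]])
    show "0 < volume_density (G (fst i) (height i)) x" by (rule R.density_pos[OF x])
  next
    fix i j assume ij: "i \<in> I" "j \<in> I"
    note lo = leaf_overlap[OF IF[OF ij(1)] IF[OF ij(2)], where t = "height i" and s = "height j"]
    show "open {x \<in> slice (fst i) (height i). chart_inv (fst i) (x, height i) \<in>
        (\<lambda>x. chart_inv (fst j) (x, height j)) ` slice (fst j) (height j)}"
      by (rule lo(1))
    show "Ck_on 1 {x \<in> slice (fst i) (height i). chart_inv (fst i) (x, height i) \<in>
        (\<lambda>x. chart_inv (fst j) (x, height j)) ` slice (fst j) (height j)} (\<phi> (fst i) (height i) (fst j))"
      by (rule lo(5))
    fix x assume x: "x \<in> slice (fst i) (height i)" "chart_inv (fst i) (x, height i) \<in>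
        (\<lambda>x. chart_inv (fst j) (x, height j)) ` slice (fst j) (height j)"
    then have xO: "x \<in> {x \<in> slice (fst i) (height i). chart_inv (fst i) (x, height i) \<in>
        (\<lambda>x. chart_inv (fst j) (x, height j)) ` slice (fst j) (height j)}" by simp
    show "\<phi> (fst i) (height i) (fst j) x \<in> slice (fst j) (height j) \<and>
        chart_inv (fst j) (\<phi> (fst i) (height i) (fst j) x, height j) = chart_inv (fst i) (x, height i)"
      using lo(3)[OF xO] lo(4)[OF xO] by simp
    show "volume_density (G (fst i) (height i)) x =
        volume_density (G (fst j) (height j)) (\<phi> (fst i) (height i) (fst j) x) *
        \<bar>edet (fd (\<phi> (fst i) (height i) (fst j)) x)\<bar>"
      by (rule density_leaf[OF IF[OF ij(1)] IF[OF ij(2)] x])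
    show "W (fst j) (height j) (\<phi> (fst i) (height i) (fst j) x) =
        fd (\<phi> (fst i) (height i) (fst j)) x (W (fst i) (height i) x)"
      by (rule W_leaf[OF IF[OF ij(1)] IF[OF ij(2)] x])
  qed
  have dd: "atlas.div_density i x = volume_density (G (fst i) (height i)) x *
      divergence (G (fst i) (height i)) (W (fst i) (height i)) x"
    if "i \<in> I" "x \<in> slice (fst i) (height i)" for i x
  proof -
    interpret R: riemannian_domain "slice (fst i) (height i)" "G (fst i) (height i)"
      by (rule riemannian[OF IF[OF that(1)]])
    show ?thesis
      unfolding atlas.div_density_def
      by (rule R.divergence_density[OF that(2) Ck_on_imp_differentiable[OF Ck_W[OF IF[OF that(1)], of "Suc 0"] that(2)]])
  qed
  have "atlas.div_density i x \<ge> 0" if "i \<in> I" "x \<in> slice (fst i) (height i)" for i x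
    unfolding dd[OF that]
    using atlas.w_pos[OF that] div_W[OF IF[OF that(1)] that(2)] trace_ge[OF IF[OF that(1)] that(2)]
    by (intro mult_nonneg_nonneg) auto
  from atlas.nonneg_divergence_zero[OF this I(2), of x0]
  have "atlas.div_density (c0, t0, x0, r) x0 = 0" using r(1) by simp
  then have "divergence (G c0 t0) (W c0 t0) x0 = 0"
    using dd[OF I(2), of x0] atlas.w_pos[OF I(2), of x0] x0 by simp
  \<comment> \<open>The vanishing divergence is bounded below by the defect of the trace inequality,
    so this is its equality case.\<close>
  then have eq: "linear_trace (\<lambda>u. E c0 t0 x0 (E c0 t0 x0 u)) = (linear_trace (E c0 t0 x0))\<^sup>2 / DIM('e)"
    using div_W[OF c0 x0] trace_ge[OF c0 x0] by linarith
  interpret R: riemannian_domain "slice c0 t0" "G c0 t0" by (rule riemannian[OF c0])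
  show ?thesis
    by (rule inner_form.selfadjoint_trace_inequality(2)[where E = "E c0 t0 x0", OF R.inner_form[OF x0] E_linear[OF c0 x0] E_selfadjoint[OF c0 x0] eq])
qed

text \<open>Umbilicity asks for one factor at \<open>p\<close> that serves all foliated charts. It
  is built from the trace of \<open>E\<close>, from \<open>f\<close> and from
  \<open>\<sigma>\<close>, each of which has the same value at \<open>p\<close> in every
  chart.\<close>

lemma umbilical:
  assumes ric: "\<And>c x t. c \<in> F \<Longrightarrow> x \<in> slice c t \<Longrightarrow>
      ricci (G c t) x (V c t x) (V c t x)
      \<ge> (real DIM('e) - 1) / real DIM('e) * (divergence (G c t) (V c t) x)\<^sup>2"
  shows "totally_umbilical F g N L"
  unfolding totally_umbilical_def
proof
  fix p assume p: "p \<in> L"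
  have at_p: "\<exists>x t. chart_map c p = (x, t) \<and> x \<in> slice c t \<and> chart_inv c (x, t) = p" if "c \<in> F" "p \<in> chart_dom c" for c
    using p chart_inv_map[OF F_chart[OF that(1)] that(2)] chart_map_img[OF F_chart[OF that(1)] that(2)]
    by (cases "chart_map c p") (auto simp: slice_def)
  have "p \<in> (\<Union>c\<in>F. chart_dom c)" using F by (simp add: foliation_def)
  then obtain c0 where c0: "c0 \<in> F" "p \<in> chart_dom c0" by blast
  obtain x0 t0 where x0: "chart_map c0 p = (x0, t0)" "x0 \<in> slice c0 t0" "chart_inv c0 (x0, t0) = p"
    using at_p[OF c0] by blast
  \<comment> \<open>This solves \<open>E = \<sigma> I + f A\<close> for \<open>A\<close>, with
    \<open>E\<close> replaced by the multiple tr E / n of the identity.\<close>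
  define a where "a = (linear_trace (E c0 t0 x0) / DIM('e) - \<sigma> p) / f c0 (x0, t0)"
  have "shape_operator g N c (chart_map c p) (u, 0) = a *\<^sub>R (u, 0)" if c: "c \<in> F" "p \<in> chart_dom c" for c u
  proof -
    obtain x t where x: "chart_map c p = (x, t)" "x \<in> slice c t" "chart_inv c (x, t) = p"
      using at_p[OF c] by blast
    have ov: "chart_inv c0 (x0, t0) \<in> (\<lambda>x. chart_inv c (x, t)) ` slice c t"
      using x x0 by (auto intro!: image_eqI[of _ _ x])
    have "transition c0 c (x0, t0) = (x, t)"
      using transition_chart[OF A FA[OF c0(1)] c0(2), of c] x0 x by simp
    then have "linear_trace (E c t x) = linear_trace (E c0 t0 x0)"
      using trace_leaf[OF c0(1) c(1) x0(2) ov] by (simp add: \<phi>_def)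
    moreover have "f c (x, t) = f c0 (x0, t0)"
      using f_transform[OF c0(1) c(1) c0(2) c(2)] x x0 by simp
    moreover have "f c (x, t) \<noteq> 0" using f_nonzero[OF c] x by simp
    ultimately show ?thesis
      using shape_operator_of_scalar_E[OF c(1) x(2) E_scalar[OF ric c(1) x(2)], of u]
      unfolding a_def x(1) x(3) by simp
  qed
  then show "\<exists>a. \<forall>c\<in>F. p \<in> chart_dom c \<longrightarrow> (\<forall>u. shape_operator g N c (chart_map c p) (u, 0) = a *\<^sub>R (u, 0))"
    by blast
qed

end

theorem theorem5p2:
  fixes A F :: "('m::{t2_space, second_countable_topology}, 'e::euclidean_space \<times> real) chart set"
    and g :: "('m, 'e \<times> real) tensor2"
    and \<xi> N :: "('m, 'e \<times> real) vfield"
    and n :: nat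
  assumes "n = DIM('e)"
    and "smooth_structure A"
    and "lorentz_metric A g"
    and "closed_conformal A g \<xi>"
    and "foliation A F"
    and "\<And>L. L \<in> leaves F \<Longrightarrow> compact_leaf F L \<and> spacelike_leaf F g L"
    and "unit_timelike_normal A F g N"
    and "\<And>p. \<not> tangent_at_leaf F \<xi> p"
    and "\<And>L p c x t. L \<in> leaves F \<Longrightarrow> p \<in> L \<Longrightarrow> c \<in> F \<Longrightarrow> p \<in> chart_dom c \<Longrightarrow>
           chart_map c p = (x, t) \<Longrightarrow>
           ricci (induced_metric g c t) x
                 (leaf_tangential_part g N \<xi> c t x) (leaf_tangential_part g N \<xi> c t x)
           \<ge> (real n - 1) / real n *
               (divergence (induced_metric g c t) (leaf_tangential_part g N \<xi> c t) x)\<^sup>2"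
  shows "\<forall>L\<in>leaves F. totally_umbilical F g N L"
proof
  fix L assume L: "L \<in> leaves F"
  obtain \<sigma> where \<sigma>: "\<And>c p v. c \<in> A \<Longrightarrow> p \<in> chart_dom c \<Longrightarrow>
      cov_deriv (g c) (\<xi> c) (chart_map c p) v = \<sigma> p *\<^sub>R v"
    by (rule closed_conformal_pointwise[OF assms(2,4)]) blast
  interpret conformal_leaf A F g \<xi> N \<sigma> L
    using assms(2,3,5,7,8) assms(4)[unfolded closed_conformal_def] assms(6)[OF L] \<sigma> L
    by unfold_locales blast+
  show "totally_umbilical F g N L"
  proof (rule umbilical)
    fix c x t assume c: "c \<in> F" and x: "x \<in> slice c t"
    show "ricci (induced_metric g c t) x (leaf_tangential_part g N \<xi> c t x) (leaf_tangential_part g N \<xi> c t x)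
      \<ge> (real DIM('e) - 1) / real DIM('e) * (divergence (induced_metric g c t) (leaf_tangential_part g N \<xi> c t) x)\<^sup>2"
      using assms(9)[OF L slice_point(2)[OF c x] c slice_point(3,4)[OF c x]] unfolding assms(1) .
  qed
qed

end
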